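(* Let $\operatorname{SPD}(n)$ be the manifold of symmetric positive-definite real $n\times n$ matrices with the affine-invariant Riemannian metric $\langle X,Y\rangle_x=\operatorname{Tr}(x^{-1}Xx^{-1}Y)$ and associated distance $\operatorname{dist}$. Let $E$ be a linear subspace of $\operatorname{Sym}(n)$ such that $[X,[X,Y]]\in E$ for all $X,Y\in E$. Then there exists a continuous orthogonal projection from $\operatorname{SPD}(n)$ onto the totally geodesic submanifold $\exp(E)=\{\exp u: u\in E\}$, i.e. a continuous map $\pi:\operatorname{SPD}(n)\to\exp(E)$ such that for every $x\in\operatorname{SPD}(n)$ $$\operatorname{dist}(x,\exp(E))=\operatorname{dist}(x,\pi(x)),$$ and such that the geodesic joining $x$ to $\pi(x)$ is orthogonal (at $\pi(x)$) to every geodesic starting at $\pi(x)$ and included in $\exp(E)$.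
   Context: $\operatorname{Sym}(n)$ is the vector space of symmetric $n\times n$ real matrices, identified with the tangent space of $\operatorname{SPD}(n)$ at each point; $[A,B]=AB-BA$; $\exp$ is the matrix exponential. Any two points $x,y\in\operatorname{SPD}(n)$ are joined by a unique geodesic, $t\mapsto x^{1/2}\exp\bigl(t\log(x^{-1/2}yx^{-1/2})\bigr)x^{1/2}$, $0\le t\le 1$. A submanifold of a Riemannian manifold is totally geodesic if any of its geodesics for the induced metric is also a geodesic of the ambient manifold. $\operatorname{dist}(x,S)=\inf_{y\in S}\operatorname{dist}(x,y)$. *)

theory Defs
  imports "HOL-Analysis.Analysis"
begin

section \<open>Symmetric matrices, bracket, exponential\<close>

definition Sym :: "(real^'n^'n) set" where
  "Sym = {A. transpose A = A}"

definition SPD :: "(real^'n^'n) set" where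
  "SPD = {A. transpose A = A \<and> (\<forall>v. v \<noteq> 0 \<longrightarrow> v \<bullet> (A *v v) > 0)}"

definition mbracket :: "real^'n^'n \<Rightarrow> real^'n^'n \<Rightarrow> real^'n^'n" where
  "mbracket A B = A ** B - B ** A"

text \<open>The library operations \<open>*\<close>, \<open>^\<close> on vectors of vectors act componentwise, so matrix powers are
  iterated from \<open>**\<close>.\<close>

definition mexp :: "real^'n^'n \<Rightarrow> real^'n^'n" where
  "mexp A = (\<Sum>k. (1 / fact k) *\<^sub>R ((\<lambda>B. A ** B) ^^ k) (mat 1))"


section \<open>The affine-invariant metric and its distance\<close>

definition spd_metric :: "real^'n^'n \<Rightarrow> real^'n^'n \<Rightarrow> real^'n^'n \<Rightarrow> real" where
  "spd_metric x X Y = trace (matrix_inv x ** X ** matrix_inv x ** Y)"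

definition spd_speed :: "(real \<Rightarrow> real^'n^'n) \<Rightarrow> real \<Rightarrow> real" where
  "spd_speed c t = sqrt (spd_metric (c t) (vector_derivative c (at t)) (vector_derivative c (at t)))"

text \<open>The library's \<open>piecewise_C1_differentiable_on\<close> does not bound the derivative near the
  exceptional points, so it admits curves of infinite length, to which \<open>integral\<close> would assign
  length 0. The integrability condition excludes exactly these.\<close>

definition spd_paths :: "real^'n^'n \<Rightarrow> real^'n^'n \<Rightarrow> (real \<Rightarrow> real^'n^'n) set" where
  "spd_paths x y = {c. c piecewise_C1_differentiable_on {0..1} \<and> c ` {0..1} \<subseteq> SPD \<and>
     c 0 = x \<and> c 1 = y \<and> spd_speed c integrable_on {0..1}}"

definition spd_dist :: "real^'n^'n \<Rightarrow> real^'n^'n \<Rightarrow> real" where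
  "spd_dist x y = (INF c\<in>spd_paths x y. integral {0..1} (spd_speed c))"

definition spd_setdist :: "real^'n^'n \<Rightarrow> (real^'n^'n) set \<Rightarrow> real" where
  "spd_setdist x S = (INF y\<in>S. spd_dist x y)"


section \<open>Submanifolds\<close>

text \<open>\<open>C\<^sup>k\<close> maps on an open subset of a finite-dimensional space, through iterated directional
  derivatives.\<close>

primrec Ck_on :: "nat \<Rightarrow> 'a::euclidean_space set \<Rightarrow> ('a \<Rightarrow> 'b::real_normed_vector) \<Rightarrow> bool" where
  "Ck_on 0 U f \<longleftrightarrow> continuous_on U f"
| "Ck_on (Suc k) U f \<longleftrightarrow> (\<forall>x\<in>U. f differentiable (at x)) \<and>
     (\<forall>v. Ck_on k U (\<lambda>x. frechet_derivative f (at x) v))"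

definition smooth_on :: "'a::euclidean_space set \<Rightarrow> ('a \<Rightarrow> 'b::real_normed_vector) \<Rightarrow> bool" where
  "smooth_on U f \<longleftrightarrow> (\<forall>k. Ck_on k U f)"

text \<open>Embedded smooth submanifolds of a Euclidean space, given by local parametrizations: a linear
  subspace \<open>L\<close> of the ambient space plays the role of the model \<open>\<real>\<^sup>d\<close>, and smoothness on the open
  subset \<open>U \<inter> L\<close> of \<open>L\<close> is expressed by a smooth map on \<open>U\<close>.\<close>

definition embedded_submanifold :: "'a::euclidean_space set \<Rightarrow> bool" where
  "embedded_submanifold S \<longleftrightarrow> (\<exists>L. subspace L \<and>
     (\<forall>p\<in>S. \<exists>U W (f::'a \<Rightarrow> 'a) h. open U \<and> open W \<and> p \<in> W \<and> smooth_on U f \<and>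
        homeomorphism (U \<inter> L) (S \<inter> W) f h \<and>
        (\<forall>u\<in>U \<inter> L. \<forall>v\<in>L. frechet_derivative f (at u) v = 0 \<longrightarrow> v = 0)))"

definition tangent_vectors :: "'a::real_normed_vector set \<Rightarrow> 'a \<Rightarrow> 'a set" where
  "tangent_vectors S p = {v. \<exists>c e. e > 0 \<and> c C1_differentiable_on {-e<..<e} \<and>
     c ` {-e<..<e} \<subseteq> S \<and> c 0 = p \<and> (c has_vector_derivative v) (at 0)}"


section \<open>Geodesics\<close>

definition velocity :: "real set \<Rightarrow> (real \<Rightarrow> 'a::real_normed_vector) \<Rightarrow> real \<Rightarrow> 'a" where
  "velocity I c t = vector_derivative c (at t within I)"

text \<open>Geodesics, on the interval from \<open>a\<close> to \<open>b\<close>, of a submanifold \<open>S\<close> of \<open>SPD\<close> (possibly \<open>SPD\<close> itself)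
  for the induced metric. Write \<open>g\<close> for the metric and \<open>\<nabla>\<close> for the Levi-Civita connection of the
  induced metric. For a curve \<open>c\<close> in \<open>S\<close> and \<open>Z\<close> tangent to \<open>S\<close> at \<open>c t\<close>, Koszul's formula reads
  \<open>g(\<nabla>\<^sub>c\<^sub>' c', Z) = d/ds g\<^bsub>c s\<^esub>(c' s, Z) - (1/2) d/dp g\<^bsub>p\<^esub>(c' t, c' t) [Z]\<close> at \<open>s = t\<close>, \<open>p = c t\<close>,
  where \<open>Z\<close> and \<open>c' t\<close> are extended as constant matrices. Hence the condition below is
  \<open>\<nabla>\<^sub>c\<^sub>' c' = 0\<close>, i.e. the Euler-Lagrange equation of the energy of curves in \<open>S\<close>. For \<open>S = SPD\<close> it
  becomes \<open>c'' = c' c\<^sup>-\<^sup>1 c'\<close>, solved by \<open>c t = x\<^sup>1\<^sup>/\<^sup>2 exp (t V) x\<^sup>1\<^sup>/\<^sup>2\<close> with \<open>V\<close> symmetric.\<close>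

definition spd_geodesic_in :: "(real^'n^'n) set \<Rightarrow> real \<Rightarrow> real \<Rightarrow> (real \<Rightarrow> real^'n^'n) \<Rightarrow> bool" where
  "spd_geodesic_in S a b c \<longleftrightarrow> a < b \<and> c ` {a..b} \<subseteq> S \<and>
     c differentiable_on {a..b} \<and> velocity {a..b} c differentiable_on {a..b} \<and>
     (\<forall>t\<in>{a..b}. \<forall>Z\<in>tangent_vectors S (c t).
        ((\<lambda>s. spd_metric (c s) (velocity {a..b} c s) Z) has_real_derivative
           (1/2) * frechet_derivative
                     (\<lambda>p. spd_metric p (velocity {a..b} c t) (velocity {a..b} c t)) (at (c t)) Z)
        (at t within {a..b}))"

definition totally_geodesic_submanifold :: "(real^'n^'n) set \<Rightarrow> bool" where
  "totally_geodesic_submanifold S \<longleftrightarrow> S \<subseteq> SPD \<and> embedded_submanifold S \<and>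
     (\<forall>a b c. spd_geodesic_in S a b c \<longrightarrow> spd_geodesic_in SPD a b c)"

end

theory Submission
  imports Defs
begin

text \<open>Put \<open>G\<^sub>Z A = e\<^bsup>-Z/2\<^esup> (d exp\<^sub>Z A) e\<^bsup>-Z/2\<^esup>\<close>, which is the integral of \<open>e\<^bsup>sZ\<^esup> A e\<^bsup>-sZ\<^esup>\<close> over \<open>-1/2 \<le> s \<le> 1/2\<close>.
  Two facts carry the proof. First, \<open>|G\<^sub>Z A| \<ge> |A|\<close>, so \<open>log\<close> does not increase lengths and
  \<open>dist (e\<^bsup>V\<^esup>) (e\<^bsup>W\<^esup>) \<ge> |V - W|\<close>, with equality for \<open>W = 0\<close>. Second, \<open>G\<^sub>Z\<close> is even in \<open>ad Z\<close>, so it maps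
  \<open>E\<close> into \<open>E\<close> for \<open>Z \<in> E\<close>; hence \<open>M = exp E\<close> is stable under \<open>p \<mapsto> e\<^bsup>X\<^esup> p e\<^bsup>X\<^esup>\<close> for \<open>X \<in> E\<close>, and every point of \<open>M\<close>
  can be moved to the identity. There \<open>c'' - c' c\<^sup>-\<^sup>1 c'\<close> is tangent to \<open>M\<close> for each curve in \<open>M\<close>, so \<open>M\<close> is
  totally geodesic. The map \<open>(Y, V) \<mapsto> e\<^bsup>Y\<^esup> e\<^bsup>V\<^esup> e\<^bsup>Y\<^esup>\<close>, for \<open>Y \<in> E\<close> and \<open>V\<close> symmetric and orthogonal to \<open>E\<close>, is
  injective and proper by the distance estimate, hence a homeomorphism onto \<open>SPD\<close> by invariance of
  domain; the projection sends \<open>e\<^bsup>Y\<^esup> e\<^bsup>V\<^esup> e\<^bsup>Y\<^esup>\<close> to \<open>e\<^bsup>2Y\<^esup>\<close>.\<close>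

section \<open>Matrix products and the exponential series\<close>

text \<open>The obstacle is that \<open>E\<close> is closed under double brackets only: brackets of
  its elements need not lie in \<open>E\<close>, so only even expressions in \<open>ad Z\<close> can
  be expected to preserve it. Both basic stability statements are therefore proved by differential
  equations: the component orthogonal to \<open>E\<close> satisfies a Gronwall inequality with
  initial value zero. No diagonalization occurs. Positivity comes from splitting the exponential of
  a symmetric matrix into two equal factors, \<open>mexp Z = P ** P\<close> with
  \<open>P = mexp ((1/2) *\<^sub>R Z)\<close>, and recognizing a squared Frobenius norm. The foot
  \<open>e^(2Y)\<close> of \<open>x = e^Y e^V e^Y\<close> is the nearest point for this reason: the
  congruence by \<open>e^(-Y)\<close> moves the foot to the identity, \<open>x\<close> to
  \<open>e^V\<close> and any competitor to some \<open>e^W\<close> with \<open>W\<close> in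
  \<open>E\<close>. The distance estimate and Pythagoras give
  \<open>dist^2 \<ge> |V|^2 + |W|^2\<close>, while the foot is at distance \<open>|V|\<close>.
  Orthogonality is read off at the same place, because the metric at the identity is the Frobenius
  inner product.\<close>

lemma matrix_mult_row: "((A::real^'n^'m) ** (B::real^'p^'n)) $ i = (\<Sum>k\<in>UNIV. A $ i $ k *\<^sub>R B $ k)"
  by (simp add: vec_eq_iff matrix_matrix_mult_def)

text \<open>The norm of \<open>real^'n^'n\<close> is the Frobenius norm, and Cauchy-Schwarz on each
  row gives the constant 1. The identity does not have norm 1, hence the factor
  \<open>norm (mat 1)\<close> in the bounds below.\<close>

lemma norm_matrix_mult_le:
  fixes A :: "real^'n^'m" and B :: "real^'p^'n"
  shows "norm (A ** B) \<le> norm A * norm B"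
proof -
  have "norm ((A ** B) $ i) \<le> norm (A $ i) * norm B" for i
  proof -
    have "norm ((A ** B) $ i) \<le> (\<Sum>k\<in>UNIV. \<bar>A $ i $ k\<bar> * norm (B $ k))"
      unfolding matrix_mult_row by (rule order_trans[OF norm_sum]) simp
    also have "\<dots> = (\<Sum>k\<in>UNIV. \<bar>A $ i $ k\<bar> * \<bar>norm (B $ k)\<bar>)" by simp
    also have "\<dots> \<le> norm (A $ i) * norm B"
      unfolding norm_vec_def[of "A $ i"] norm_vec_def[of B]
      using L2_set_mult_ineq[of "\<lambda>k. \<bar>A $ i $ k\<bar>" "\<lambda>k. norm (B $ k)" UNIV] by simp
    finally show ?thesis .
  qed
  then have "norm (A ** B) \<le> L2_set (\<lambda>i. norm (A $ i) * norm B) UNIV"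
    unfolding norm_vec_def[of "A ** B"] by (intro L2_set_mono) auto
  also have "\<dots> = norm A * norm B"
    by (simp add: L2_set_left_distrib norm_vec_def[of A])
  finally show ?thesis .
qed

lemma bounded_bilinear_matrix_mult:
  "bounded_bilinear ((**) :: real^'n^'m \<Rightarrow> real^'p^'n \<Rightarrow> real^'p^'m)"
proof
  show "\<exists>K. \<forall>(a::real^'n^'m) (b::real^'p^'n). norm (a ** b) \<le> norm a * norm b * K"
    using norm_matrix_mult_le by (metis mult.right_neutral)
qed (simp_all add: vec_eq_iff matrix_matrix_mult_def sum.distrib distrib_left distrib_right
    sum_distrib_left mult.assoc mult.left_commute)

interpretation mm: bounded_bilinear "(**) :: real^'n^'m \<Rightarrow> real^'p^'n \<Rightarrow> real^'p^'m"
  by (rule bounded_bilinear_matrix_mult)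

lemma bounded_linear_transpose: "bounded_linear (transpose :: real^'n^'m \<Rightarrow> real^'m^'n)"
  by (intro linear_conv_bounded_linear[THEN iffD1] linearI) (auto simp: transpose_def vec_eq_iff)

lemmas transpose_add = linear_add[OF bounded_linear.linear[OF bounded_linear_transpose]]
  and transpose_diff = linear_diff[OF bounded_linear.linear[OF bounded_linear_transpose]]
  and transpose_scaleR = linear_scale[OF bounded_linear.linear[OF bounded_linear_transpose]]

lemma inner_matrix_eq_trace: "(A::real^'n^'m) \<bullet> B = trace (transpose A ** B)"
  unfolding trace_def matrix_matrix_mult_def transpose_def inner_vec_def
  by simp (rule sum.swap)

lemma inner_matrix_mult_left:
  fixes A :: "real^'n^'m" and B :: "real^'n^'k" and C :: "real^'m^'k"
  shows "(C ** A) \<bullet> B = A \<bullet> (transpose C ** B)"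
  by (simp add: inner_matrix_eq_trace matrix_transpose_mul matrix_mul_assoc)

lemma inner_transpose: "transpose A \<bullet> transpose B = (A::real^'n^'m) \<bullet> B"
  unfolding inner_vec_def transpose_def by simp (rule sum.swap)

lemma inner_matrix_mult_right:
  fixes A :: "real^'n^'m" and B :: "real^'k^'m" and C :: "real^'k^'n"
  shows "(A ** C) \<bullet> B = A \<bullet> (B ** transpose C)"
proof -
  have "(A ** C) \<bullet> B = (transpose C ** transpose A) \<bullet> transpose B"
    by (simp add: inner_transpose flip: matrix_transpose_mul)
  also have "\<dots> = transpose A \<bullet> transpose (B ** transpose C)"
    by (simp add: inner_matrix_mult_left matrix_transpose_mul)
  finally show ?thesis by (simp add: inner_transpose)
qed

lemma norm_transpose: "norm (transpose A) = norm (A::real^'n^'m)"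
  by (simp add: norm_eq_sqrt_inner inner_transpose)

text \<open>The sum of all noncommutative words of length \<open>j\<close> that use each entry of
  \<open>vs\<close> exactly once and are filled up with \<open>A\<close>, that is, the derivative of
  the \<open>j\<close>-th power at \<open>A\<close> in the directions \<open>vs\<close>. The
  recursion splits off the first letter. Carrying a list of directions makes the family closed under
  differentiation, so that all orders are treated at once.\<close>

primrec wordsum :: "nat \<Rightarrow> (real^'n^'n) list \<Rightarrow> real^'n^'n \<Rightarrow> real^'n^'n" where
  "wordsum 0 vs A = (if vs = [] then mat 1 else 0)"
| "wordsum (Suc j) vs A = A ** wordsum j vs A +
     (\<Sum>i<length vs. vs ! i ** wordsum j (take i vs @ drop (Suc i) vs) A)"

text \<open>Each of the \<open>j\<close> letters is \<open>A\<close> or one of at most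
  \<open>length vs\<close> directions, whose norms are collected in the product; hence the base
  \<open>norm A + length vs\<close>.\<close>

lemma norm_wordsum_le:
  fixes A :: "real^'n^'n"
  shows "norm (wordsum j vs A) \<le>
    norm (mat 1 :: real^'n^'n) * prod_list (map norm vs) * (norm A + real (length vs)) ^ j"
proof (induction j arbitrary: vs)
  case 0
  then show ?case by (auto intro!: mult_nonneg_nonneg prod_list_nonneg)
next
  case (Suc j)
  let ?k = "norm (mat 1 :: real^'n^'n)" and ?p = "prod_list (map norm vs)"
  let ?r = "norm A + real (length vs)"
  have p0: "?p \<ge> 0" by (auto intro!: prod_list_nonneg)
  have 1: "norm (vs ! i ** wordsum j (take i vs @ drop (Suc i) vs) A) \<le> ?k * ?p * ?r ^ j"
    if i: "i < length vs" for i
  proof -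
    let ?ws = "take i vs @ drop (Suc i) vs"
    have p: "norm (vs ! i) * prod_list (map norm ?ws) = ?p"
      by (subst (3) id_take_nth_drop[OF i]) (simp add: ac_simps)
    have "norm (vs ! i ** wordsum j ?ws A) \<le>
        norm (vs ! i) * (?k * prod_list (map norm ?ws) * (norm A + real (length ?ws)) ^ j)"
      by (intro order_trans[OF norm_matrix_mult_le] mult_left_mono Suc) auto
    also have "\<dots> = ?k * ?p * (norm A + real (length ?ws)) ^ j"
      unfolding p[symmetric] by simp
    also have "\<dots> \<le> ?k * ?p * ?r ^ j"
      by (intro mult_left_mono power_mono mult_nonneg_nonneg p0) (use i in auto)
    finally show ?thesis .
  qed
  have "norm (wordsum (Suc j) vs A) \<le> norm A * (?k * ?p * ?r ^ j) + (\<Sum>i<length vs. ?k * ?p * ?r ^ j)"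
    unfolding wordsum.simps
    by (intro norm_triangle_le add_mono order_trans[OF norm_matrix_mult_le] mult_left_mono Suc
        order_trans[OF norm_sum] sum_mono 1) auto
  also have "\<dots> = ?k * ?p * ?r ^ Suc j"
    by (simp add: algebra_simps)
  finally show ?case .
qed

text \<open>Product rule: differentiating the leading \<open>A\<close> gives the words that start
  with \<open>h\<close>, which are the summand of index 0 in the recursion for
  \<open>h # vs\<close>.\<close>

lemma has_derivative_wordsum:
  "(wordsum j vs has_derivative (\<lambda>h. wordsum j (h # vs) A)) (at A)"
proof (induction j arbitrary: vs)
  case 0
  have "wordsum 0 vs = (\<lambda>_. if vs = [] then mat 1 else 0)" by auto
  then show ?case by auto
next
  case (Suc j)
  have eq: "wordsum (Suc j) vs = (\<lambda>A. A ** wordsum j vs A +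
     (\<Sum>i<length vs. vs ! i ** wordsum j (take i vs @ drop (Suc i) vs) A))"
    by auto
  show ?case unfolding eq
    by (rule has_derivative_eq_rhs, rule has_derivative_add[OF
          mm.FDERIV[OF has_derivative_ident Suc]
          has_derivative_sum[OF bounded_linear.has_derivative[OF mm.bounded_linear_right Suc]]])
      (simp add: fun_eq_iff sum.lessThan_Suc_shift add_ac del: sum.lessThan_Suc)
qed

text \<open>The iterated directional derivative of the exponential along \<open>vs\<close>; the
  empty list gives the exponential itself.\<close>

definition expsum :: "(real^'n^'n) list \<Rightarrow> real^'n^'n \<Rightarrow> real^'n^'n" where
  "expsum vs A = (\<Sum>j. (1 / fact j) *\<^sub>R wordsum j vs A)"

lemma norm_expsum_term_le:
  fixes A :: "real^'n^'n"
  shows "norm ((1 / fact j) *\<^sub>R wordsum j vs A) \<le>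
    norm (mat 1 :: real^'n^'n) * prod_list (map norm vs) * ((norm A + real (length vs)) ^ j /\<^sub>R fact j)"
proof -
  have "norm ((1 / fact j) *\<^sub>R wordsum j vs A) = norm (wordsum j vs A) / fact j"
    by simp
  also have "\<dots> \<le> (norm (mat 1 :: real^'n^'n) * prod_list (map norm vs) * (norm A + real (length vs)) ^ j) / fact j"
    by (intro divide_right_mono norm_wordsum_le) auto
  finally show ?thesis by (simp add: divide_inverse ac_simps)
qed

lemma summable_expsum_bound:
  "summable (\<lambda>j. c * ((x::real) ^ j /\<^sub>R fact j))"
  by (intro summable_mult summable_exp_generic)

lemma summable_expsum: "summable (\<lambda>j. (1 / fact j) *\<^sub>R wordsum j vs A)"
  by (rule summable_comparison_test'[OF summable_expsum_bound norm_expsum_term_le])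

lemma norm_expsum_le:
  fixes A :: "real^'n^'n"
  shows "norm (expsum vs A) \<le>
    norm (mat 1 :: real^'n^'n) * prod_list (map norm vs) * exp (norm A + real (length vs))"
proof -
  have "norm (expsum vs A) \<le> (\<Sum>j. norm (mat 1 :: real^'n^'n) * prod_list (map norm vs) * ((norm A + real (length vs)) ^ j /\<^sub>R fact j))"
    unfolding expsum_def by (rule norm_suminf_le[OF norm_expsum_term_le summable_expsum_bound])
  also have "\<dots> = norm (mat 1 :: real^'n^'n) * prod_list (map norm vs) * exp (norm A + real (length vs))"
    unfolding exp_def by (rule suminf_mult[OF summable_exp_generic])
  finally show ?thesis .
qed

lemma has_derivative_expsum:
  fixes A :: "real^'n^'n"
  shows "(expsum vs has_derivative (\<lambda>h. expsum (h # vs) A)) (at A)"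
proof -
  define R where "R = norm A + 1"
  let ?S = "ball (0::real^'n^'n) R"
  let ?c = "norm (mat 1 :: real^'n^'n) * prod_list (map norm vs)"
  \<comment> \<open>The list \<open>h # vs\<close> has one direction more than \<open>vs\<close>,
    and \<open>norm x < R\<close> on the ball, so \<open>norm h * ?f ?c j\<close> dominates the
    differentiated terms uniformly in \<open>x\<close> and linearly in \<open>h\<close>, as termwise
    differentiation requires.\<close>
  let ?f = "\<lambda>c j. c * ((R + real (length vs) + 1) ^ j /\<^sub>R fact j)"
  have A: "A \<in> ?S" by (simp add: R_def)
  have der: "((\<lambda>x. (1 / fact n) *\<^sub>R wordsum n vs x) has_derivative
      (\<lambda>h. (1 / fact n) *\<^sub>R wordsum n (h # vs) x)) (at x within ?S)" for n x
    by (rule has_derivative_scaleR_right[OF has_derivative_at_withinI[OF has_derivative_wordsum]])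
  have ev: "\<forall>\<^sub>F n in sequentially. \<forall>x\<in>?S. \<forall>h.
      norm ((\<Sum>i<n. (1 / fact i) *\<^sub>R wordsum i (h # vs) x) - expsum (h # vs) x) \<le> e * norm h"
    if e: "0 < e" for e :: real
  proof -
    have "(\<lambda>n. (\<Sum>j. ?f ?c (j + n))) \<longlonglongrightarrow> 0"
      using suminf_exist_split2[OF summable_expsum_bound] by blast
    then have "\<forall>\<^sub>F n in sequentially. (\<Sum>j. ?f ?c (j + n)) < e"
      using e by (intro order_tendstoD(2)) auto
    then show ?thesis
    proof eventually_elim
      case (elim n)
      show ?case
      proof (intro ballI allI)
        fix x h :: "real^'n^'n" assume x: "x \<in> ?S"
        let ?t = "\<lambda>j. (1 / fact j) *\<^sub>R wordsum j (h # vs) x"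
        have "expsum (h # vs) x = (\<Sum>j. ?t (j + n)) + (\<Sum>i<n. ?t i)"
          unfolding expsum_def by (rule suminf_split_initial_segment[OF summable_expsum])
        then have "norm ((\<Sum>i<n. ?t i) - expsum (h # vs) x) = norm (\<Sum>j. ?t (j + n))"
          by simp
        also have "\<dots> \<le> (\<Sum>j. norm h * ?f ?c (j + n))"
        proof (rule norm_suminf_le)
          show "summable (\<lambda>j. norm h * ?f ?c (j + n))"
            by (intro summable_mult summable_ignore_initial_segment summable_expsum_bound)
          show "norm (?t (j + n)) \<le> norm h * ?f ?c (j + n)" for j
          proof -
            have "norm (?t (j + n)) \<le> norm (mat 1 :: real^'n^'n) * prod_list (map norm (h # vs)) *
               ((norm x + real (length (h # vs))) ^ (j + n) /\<^sub>R fact (j + n))"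
              by (rule norm_expsum_term_le)
            also have "\<dots> \<le> norm (mat 1 :: real^'n^'n) * prod_list (map norm (h # vs)) *
               ((R + real (length vs) + 1) ^ (j + n) /\<^sub>R fact (j + n))"
              by (intro mult_left_mono scaleR_left_mono power_mono mult_nonneg_nonneg prod_list_nonneg)
                (use x in auto)
            finally show ?thesis by (simp add: ac_simps)
          qed
        qed
        also have "\<dots> = norm h * (\<Sum>j. ?f ?c (j + n))"
          by (intro suminf_mult summable_ignore_initial_segment summable_expsum_bound)
        also have "\<dots> \<le> e * norm h"
            using mult_left_mono[OF less_imp_le[OF elim] norm_ge_zero[of h]] by (simp only: mult.commute)
          finally show "norm ((\<Sum>i<n. ?t i) - expsum (h # vs) x) \<le> e * norm h" .
      qed
    qed
  qed
  have sums: "(\<lambda>n. (1 / fact n) *\<^sub>R wordsum n vs A) sums expsum vs A"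
    unfolding expsum_def by (rule summable_sums[OF summable_expsum])
  have "\<exists>g. \<forall>x\<in>?S. (\<lambda>j. (1 / fact j) *\<^sub>R wordsum j vs x) sums g x \<and>
      (g has_derivative (\<lambda>h. expsum (h # vs) x)) (at x within ?S)"
    by (rule has_derivative_series[OF convex_ball der ev A sums])
  then obtain g where g: "\<And>x. x \<in> ?S \<Longrightarrow> (\<lambda>j. (1 / fact j) *\<^sub>R wordsum j vs x) sums g x"
    "(g has_derivative (\<lambda>h. expsum (h # vs) A)) (at A within ?S)"
    using A by blast
  have "g x = expsum vs x" if "x \<in> ?S" for x
    using sums_unique[OF g(1)[OF that]] by (simp add: expsum_def)
  then have "(expsum vs has_derivative (\<lambda>h. expsum (h # vs) A)) (at A within ?S)"
    using has_derivative_transform[OF A _ g(2), of "expsum vs"] by auto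
  then show ?thesis using A by (simp add: at_within_open[OF A])
qed

lemma frechet_derivative_expsum: "frechet_derivative (expsum vs) (at A) h = expsum (h # vs) A"
  using frechet_derivative_at[OF has_derivative_expsum] by metis

lemma smooth_on_expsum: "smooth_on U (expsum vs)"
  unfolding smooth_on_def
proof
  show "Ck_on k U (expsum vs)" for k
  proof (induction k arbitrary: vs)
    case 0
    then show ?case using has_derivative_expsum
      by (auto intro!: continuous_at_imp_continuous_on has_derivative_continuous)
  next
    case (Suc k)
    then show ?case using has_derivative_expsum
      by (auto simp: frechet_derivative_expsum differentiable_def)
  qed
qed

lemma mexp_eq_expsum: "(mexp :: real^'n^'n \<Rightarrow> _) = expsum []"
proof
  fix A :: "real^'n^'n"
  have "((\<lambda>B. A ** B) ^^ k) (mat 1) = wordsum k [] A" for k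
    by (induction k) auto
  then show "mexp A = expsum [] A"
    by (simp add: mexp_def expsum_def)
qed

definition dexp :: "real^'n^'n \<Rightarrow> real^'n^'n \<Rightarrow> real^'n^'n" where
  "dexp Z A = expsum [A] Z"

lemma has_derivative_mexp: "(mexp has_derivative dexp Z) (at Z)"
  unfolding mexp_eq_expsum dexp_def by (rule has_derivative_expsum)

lemma smooth_on_mexp: "smooth_on U mexp"
  by (simp add: mexp_eq_expsum smooth_on_expsum)

lemma frechet_derivative_mexp: "frechet_derivative mexp (at Z) = dexp Z"
  using frechet_derivative_at[OF has_derivative_mexp] by metis

lemma linear_dexp: "linear (dexp Z)"
  using has_derivative_mexp has_derivative_linear by blast

lemma norm_dexp_le:
  fixes Z A :: "real^'n^'n"
  shows "norm (dexp Z A) \<le> norm (mat 1 :: real^'n^'n) * exp (norm Z + 1) * norm A"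
  using norm_expsum_le[of "[A]" Z] by (simp add: dexp_def ac_simps)

lemma mexp_lipschitz:
  fixes X Y :: "real^'n^'n"
  assumes "norm X \<le> R" "norm Y \<le> R"
  shows "norm (mexp X - mexp Y) \<le> norm (mat 1 :: real^'n^'n) * exp (R + 1) * norm (X - Y)"
proof -
  have der: "(mexp has_derivative dexp Z) (at Z within cball 0 R)" for Z :: "real^'n^'n"
    by (rule has_derivative_at_withinI[OF has_derivative_mexp])
  have bd: "onorm (dexp Z) \<le> norm (mat 1 :: real^'n^'n) * exp (R + 1)"
    if Z: "Z \<in> cball 0 R" for Z :: "real^'n^'n"
  proof (rule onorm_le)
    fix A :: "real^'n^'n"
    have "norm (mat 1 :: real^'n^'n) * exp (norm Z + 1) * norm A \<le>
        norm (mat 1 :: real^'n^'n) * exp (R + 1) * norm A"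
      using Z by (intro mult_right_mono mult_left_mono) auto
    then show "norm (dexp Z A) \<le> norm (mat 1 :: real^'n^'n) * exp (R + 1) * norm A"
      using norm_dexp_le[of Z A] by linarith
  qed
  show ?thesis
    by (rule differentiable_bound[OF convex_cball der bd]) (use assms in auto)
qed

text \<open>The second derivative is \<open>expsum [h, A]\<close>, and its two directions account
  for \<open>R + 2\<close>. The estimate enters the Gronwall argument for the stability of
  \<open>exp E\<close> under congruence.\<close>

lemma dexp_lipschitz:
  fixes X Y A :: "real^'n^'n"
  assumes "norm X \<le> R" "norm Y \<le> R"
  shows "norm (dexp X A - dexp Y A) \<le> norm (mat 1 :: real^'n^'n) * norm A * exp (R + 2) * norm (X - Y)"
proof -
  have der: "(expsum [A] has_derivative (\<lambda>h. expsum [h, A] Z)) (at Z within cball 0 R)" for Z :: "real^'n^'n"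
    by (rule has_derivative_at_withinI[OF has_derivative_expsum])
  have bd: "onorm (\<lambda>h. expsum [h, A] Z) \<le> norm (mat 1 :: real^'n^'n) * norm A * exp (R + 2)"
    if Z: "Z \<in> cball 0 R" for Z :: "real^'n^'n"
  proof (rule onorm_le)
    fix h :: "real^'n^'n"
    have "norm (expsum [h, A] Z) \<le> norm (mat 1 :: real^'n^'n) * (norm h * norm A) * exp (norm Z + 2)"
      using norm_expsum_le[of "[h, A]" Z] by simp
    also have "\<dots> \<le> norm (mat 1 :: real^'n^'n) * (norm h * norm A) * exp (R + 2)"
      using Z by (intro mult_left_mono) auto
    finally show "norm (expsum [h, A] Z) \<le> norm (mat 1 :: real^'n^'n) * norm A * exp (R + 2) * norm h"
      by (simp only: ac_simps)
  qed
  show ?thesis unfolding dexp_def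
    by (rule differentiable_bound[OF convex_cball der bd]) (use assms in auto)
qed

section \<open>One-parameter groups and the derivative of the exponential\<close>

lemma has_vector_derivative_mexp_compose:
  assumes "(z has_vector_derivative z') (at t within S)"
  shows "((\<lambda>t. mexp (z t)) has_vector_derivative dexp (z t) z') (at t within S)"
  using vector_derivative_diff_chain_within[OF assms has_derivative_at_withinI[OF has_derivative_mexp]]
  by (simp add: o_def)

lemma continuous_on_mexp [continuous_intros]:
  "continuous_on S f \<Longrightarrow> continuous_on S (\<lambda>x. mexp (f x))"
  by (rule continuous_on_compose2[of UNIV mexp S f])
    (auto intro!: continuous_at_imp_continuous_on has_derivative_continuous[OF has_derivative_mexp])

lemmas continuous_on_matrix_mult [continuous_intros] = mm.continuous_on

lemma summable_mexp: "summable (\<lambda>j. (1 / fact j) *\<^sub>R wordsum j [] A)"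
  by (rule summable_expsum)

lemma mexp_series: "mexp A = (\<Sum>j. (1 / fact j) *\<^sub>R wordsum j [] A)"
  by (simp add: mexp_eq_expsum expsum_def)

lemma mexp_commute:
  fixes A C :: "real^'n^'n"
  assumes "C ** A = A ** C"
  shows "C ** mexp A = mexp A ** C"
proof -
  have w: "C ** wordsum j [] A = wordsum j [] A ** C" for j
    by (induction j) (simp_all, metis assms matrix_mul_assoc)
  show ?thesis unfolding mexp_series
    bounded_linear.suminf[OF mm.bounded_linear_right summable_mexp]
    bounded_linear.suminf[OF mm.bounded_linear_left summable_mexp]
    by (simp add: mm.scaleR_left mm.scaleR_right w)
qed

lemma transpose_mexp: "transpose (mexp A) = mexp (transpose A)"
proof -
  have c: "B ** wordsum j [] B = wordsum j [] B ** B" for j and B :: "real^'n^'n"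
    by (induction j) (simp_all add: matrix_mul_assoc)
  have w: "transpose (wordsum j [] A) = wordsum j [] (transpose A)" for j
    by (induction j) (simp_all add: matrix_transpose_mul c)
  show ?thesis unfolding mexp_series bounded_linear.suminf[OF bounded_linear_transpose summable_mexp]
    by (simp add: transpose_scaleR w)
qed

text \<open>All \<open>j + 1\<close> words of length \<open>j + 1\<close> with one marked letter
  coincide when the letters are multiples of \<open>A\<close>; the factor \<open>j + 1\<close>
  cancels against the factorial. Counting words instead of dividing by \<open>t\<close> covers
  \<open>t = 0\<close>.\<close>

lemma dexp_scaleR_self:
  fixes A :: "real^'n^'n"
  shows "dexp (t *\<^sub>R A) A = A ** mexp (t *\<^sub>R A)"
proof -
  let ?B = "t *\<^sub>R A"
  have w: "wordsum (Suc j) [A] ?B = real (Suc j) *\<^sub>R (A ** wordsum j [] ?B)" for j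
  proof (induction j)
    case (Suc j)
    have "wordsum (Suc (Suc j)) [A] ?B = ?B ** wordsum (Suc j) [A] ?B + A ** wordsum (Suc j) [] ?B"
      by simp
    also have "?B ** wordsum (Suc j) [A] ?B = real (Suc j) *\<^sub>R (A ** wordsum (Suc j) [] ?B)"
      unfolding Suc by (simp add: mm.scaleR_left mm.scaleR_right)
    finally have "wordsum (Suc (Suc j)) [A] ?B =
        real (Suc j) *\<^sub>R (A ** wordsum (Suc j) [] ?B) + A ** wordsum (Suc j) [] ?B" .
    also have "\<dots> = (real (Suc j) + 1) *\<^sub>R (A ** wordsum (Suc j) [] ?B)"
      by (simp only: scaleR_add_left scaleR_one)
    finally show ?case by (simp only: of_nat_Suc add_ac)
  qed (simp add: mm.zero_right)
  have "dexp ?B A = (\<Sum>j. (1 / fact (Suc j)) *\<^sub>R wordsum (Suc j) [A] ?B)"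
    unfolding dexp_def expsum_def using suminf_split_head[OF summable_expsum[of "[A]" ?B]] by simp
  also have "\<dots> = (\<Sum>j. A ** ((1 / fact j) *\<^sub>R wordsum j [] ?B))"
    unfolding w by (simp add: mm.scaleR_right del: of_nat_Suc)
  also have "\<dots> = A ** mexp ?B"
    unfolding mexp_series by (rule bounded_linear.suminf[OF mm.bounded_linear_right summable_mexp, symmetric])
  finally show ?thesis .
qed

lemma has_vector_derivative_mexp:
  fixes A :: "real^'n^'n"
  assumes "(f has_real_derivative f') (at t within S)"
  shows "((\<lambda>t. mexp (f t *\<^sub>R A)) has_vector_derivative f' *\<^sub>R (A ** mexp (f t *\<^sub>R A))) (at t within S)"
proof -
  have "((\<lambda>t. f t *\<^sub>R A) has_vector_derivative f' *\<^sub>R A) (at t within S)"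
    using has_vector_derivative_scaleR[OF assms has_vector_derivative_const[of A]] by simp
  from has_vector_derivative_mexp_compose[OF this] show ?thesis
    by (simp add: linear_scale[OF linear_dexp] dexp_scaleR_self)
qed

lemma mexp_zero [simp]: "mexp 0 = mat 1"
proof -
  have "(1 / fact (Suc j)) *\<^sub>R wordsum (Suc j) [] 0 = 0" for j
    by (simp add: mm.zero_left)
  then show ?thesis
    unfolding mexp_series using suminf_split_head[OF summable_mexp[of 0]] by simp
qed

lemma dexp_zero: "dexp 0 A = A"
  using dexp_scaleR_self[of 0 A] by simp

lemma has_vector_derivative_matrix_mult:
  fixes f :: "real \<Rightarrow> real^'n^'m" and g :: "real \<Rightarrow> real^'p^'n"
  assumes "(f has_vector_derivative f') (at t within S)" "(g has_vector_derivative g') (at t within S)"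
  shows "((\<lambda>t. f t ** g t) has_vector_derivative f t ** g' + f' ** g t) (at t within S)"
  by (rule mm.has_vector_derivative[OF assms])

lemma mexp_add_scaleR:
  fixes A :: "real^'n^'n"
  shows "mexp (s *\<^sub>R A) ** mexp (t *\<^sub>R A) = mexp ((s + t) *\<^sub>R A)"
proof -
  let ?f = "\<lambda>u. mexp ((s + t - u) *\<^sub>R A) ** mexp (u *\<^sub>R A)"
  have "(?f has_vector_derivative 0) (at u within UNIV)" for u
  proof -
    have 1: "((\<lambda>u. s + t - u) has_real_derivative (-1)) (at u)"
      by (auto intro!: derivative_eq_intros)
    have "(?f has_vector_derivative mexp ((s + t - u) *\<^sub>R A) ** (1 *\<^sub>R (A ** mexp (u *\<^sub>R A))) +
        (-1) *\<^sub>R (A ** mexp ((s + t - u) *\<^sub>R A)) ** mexp (u *\<^sub>R A)) (at u)"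
      by (rule has_vector_derivative_matrix_mult[OF has_vector_derivative_mexp[OF 1]
          has_vector_derivative_mexp[OF DERIV_ident]])
    moreover have "mexp ((s + t - u) *\<^sub>R A) ** A = A ** mexp ((s + t - u) *\<^sub>R A)"
      by (rule mexp_commute[symmetric]) (simp add: mm.scaleR_left mm.scaleR_right)
    ultimately show ?thesis by (simp add: matrix_mul_assoc mm.minus_left)
  qed
  then obtain c where "\<And>u. ?f u = c"
    using has_vector_derivative_zero_constant[of UNIV ?f] by auto
  then have "?f t = ?f 0" by metis
  then show ?thesis by simp
qed

lemma mexp_minus_right [simp]: "mexp A ** mexp (- A) = mat 1"
  and mexp_minus_left [simp]: "mexp (- A) ** mexp A = mat 1"
  using mexp_add_scaleR[of 1 A "-1"] mexp_add_scaleR[of "-1" A 1] by simp_all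

lemma mult_mexp_minus_right [simp]: "(B::real^'n^'m) ** mexp A ** mexp (- A) = B"
  and mult_mexp_minus_left [simp]: "(B::real^'n^'m) ** mexp (- A) ** mexp A = B"
  by (simp_all flip: matrix_mul_assoc)

lemma mexp_half: "mexp ((1/2) *\<^sub>R A) ** mexp ((1/2) *\<^sub>R A) = mexp A"
  by (simp add: mexp_add_scaleR)

section \<open>Matrix inverses and integral formulas for the exponential\<close>

lemma matrix_inv_inverse:
  assumes "invertible (A::real^'n^'n)"
  shows "A ** matrix_inv A = mat 1" "matrix_inv A ** A = mat 1"
proof -
  have "\<exists>B. A ** B = mat 1 \<and> B ** A = mat 1" using assms by (simp add: invertible_def)
  from someI_ex[OF this] show "A ** matrix_inv A = mat 1" "matrix_inv A ** A = mat 1"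
    unfolding matrix_inv_def by blast+
qed

lemma matrix_inv_unique_right:
  fixes A B :: "real^'n^'n"
  assumes "A ** B = mat 1"
  shows "invertible A" "matrix_inv A = B"
proof -
  have "B ** A = mat 1" using assms matrix_left_right_inverse by blast
  then show i: "invertible A" using assms invertible_def by blast
  have "matrix_inv A ** A = mat 1" by (rule matrix_inv_inverse[OF i])
  then have "matrix_inv A ** (A ** B) = B" by (simp add: matrix_mul_assoc)
  then show "matrix_inv A = B" by (simp add: assms)
qed

lemma invertible_mexp: "invertible (mexp A)"
  and matrix_inv_mexp: "matrix_inv (mexp A) = mexp (- A)"
  by (rule matrix_inv_unique_right[OF mexp_minus_right])+

text \<open>The product \<open>e^(sX) e^((1-s)Y)\<close> interpolates between \<open>e^Y\<close> and
  \<open>e^X\<close>, and the integrand is its derivative in \<open>s\<close>.\<close>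

lemma mexp_duhamel:
  fixes X Y :: "real^'n^'n"
  shows "((\<lambda>s. mexp (s *\<^sub>R X) ** (X - Y) ** mexp ((1 - s) *\<^sub>R Y)) has_integral (mexp X - mexp Y)) {0..1}"
proof -
  let ?f = "\<lambda>s. mexp (s *\<^sub>R X) ** mexp ((1 - s) *\<^sub>R Y)"
  have "(?f has_vector_derivative mexp (s *\<^sub>R X) ** (X - Y) ** mexp ((1 - s) *\<^sub>R Y)) (at s within {0..1})" for s
  proof -
    have 1: "((\<lambda>s. 1 - s) has_real_derivative (-1)) (at s within {0..1})"
      by (auto intro!: derivative_eq_intros)
    have "(?f has_vector_derivative mexp (s *\<^sub>R X) ** ((-1) *\<^sub>R (Y ** mexp ((1 - s) *\<^sub>R Y))) +
        1 *\<^sub>R (X ** mexp (s *\<^sub>R X)) ** mexp ((1 - s) *\<^sub>R Y)) (at s within {0..1})"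
      by (rule has_vector_derivative_matrix_mult[OF has_vector_derivative_mexp[OF DERIV_ident]
            has_vector_derivative_mexp[OF 1]])
    moreover have "X ** mexp (s *\<^sub>R X) = mexp (s *\<^sub>R X) ** X"
      by (rule mexp_commute) (simp add: mm.scaleR_left mm.scaleR_right)
    ultimately show ?thesis
      by (simp add: matrix_mul_assoc mm.minus_right mm.diff_left mm.diff_right)
  qed
  then have "((\<lambda>s. mexp (s *\<^sub>R X) ** (X - Y) ** mexp ((1 - s) *\<^sub>R Y)) has_integral ?f 1 - ?f 0) {0..1}"
    by (intro fundamental_theorem_of_calculus) auto
  then show ?thesis by simp
qed

text \<open>Duhamel's formula for \<open>Z + e *\<^sub>R A\<close> and \<open>Z\<close>, divided by
  \<open>e\<close>, in the limit \<open>e \<rightarrow> 0\<close>: for \<open>e \<noteq> 0\<close>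
  the integral \<open>I e\<close> is the difference quotient of the exponential, and
  \<open>I\<close> is continuous at 0.\<close>

lemma dexp_has_integral:
  fixes Z A :: "real^'n^'n"
  shows "((\<lambda>s. mexp (s *\<^sub>R Z) ** A ** mexp ((1 - s) *\<^sub>R Z)) has_integral dexp Z A) {0..1}"
proof -
  let ?f = "\<lambda>e s. mexp (s *\<^sub>R (Z + e *\<^sub>R A)) ** A ** mexp ((1 - s) *\<^sub>R Z)"
  define I where "I e = integral {0..1} (?f e)" for e
  have "continuous_on UNIV I"
    unfolding I_def cbox_interval[symmetric]
    by (rule integral_continuous_on_param) (auto simp: split_beta intro!: continuous_intros)
  then have lim: "(I \<longlongrightarrow> I 0) (at 0)"
    by (simp add: continuous_on_eq_continuous_at continuous_at)
  have I: "I e = (1 / e) *\<^sub>R (mexp (Z + e *\<^sub>R A) - mexp Z)" if "e \<noteq> 0" for e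
  proof -
    have "((\<lambda>s. (1 / e) *\<^sub>R (mexp (s *\<^sub>R (Z + e *\<^sub>R A)) ** (e *\<^sub>R A) ** mexp ((1 - s) *\<^sub>R Z)))
        has_integral (1 / e) *\<^sub>R (mexp (Z + e *\<^sub>R A) - mexp Z)) {0..1}"
      using has_integral_cmul[OF mexp_duhamel[of "Z + e *\<^sub>R A" Z], of "1 / e"] by simp
    then have "(?f e has_integral (1 / e) *\<^sub>R (mexp (Z + e *\<^sub>R A) - mexp Z)) {0..1}"
      using that by (simp add: mm.scaleR_left mm.scaleR_right)
    then show ?thesis unfolding I_def by (rule integral_unique)
  qed
  have "((\<lambda>e. Z + e *\<^sub>R A) has_vector_derivative A) (at 0)"
    by (auto intro!: derivative_eq_intros)
  from has_vector_derivative_mexp_compose[OF this]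
  have "((\<lambda>e. mexp (Z + e *\<^sub>R A)) has_vector_derivative dexp Z A) (at 0)" by simp
  then have "((\<lambda>e. norm (mexp (Z + e *\<^sub>R A) - mexp Z - e *\<^sub>R dexp Z A) / \<bar>e\<bar>) \<longlongrightarrow> 0) (at 0)"
    unfolding has_vector_derivative_def has_derivative_iff_norm by simp
  moreover have "norm (mexp (Z + e *\<^sub>R A) - mexp Z - e *\<^sub>R dexp Z A) / \<bar>e\<bar> =
      norm ((1 / e) *\<^sub>R (mexp (Z + e *\<^sub>R A) - mexp Z) - dexp Z A)" if "e \<noteq> 0" for e
  proof -
    have "(1 / e) *\<^sub>R (mexp (Z + e *\<^sub>R A) - mexp Z) - dexp Z A =
        (1 / e) *\<^sub>R (mexp (Z + e *\<^sub>R A) - mexp Z - e *\<^sub>R dexp Z A)"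
      using that by (simp add: scaleR_diff_right)
    then show ?thesis by simp
  qed
  ultimately have "((\<lambda>e. norm ((1 / e) *\<^sub>R (mexp (Z + e *\<^sub>R A) - mexp Z) - dexp Z A)) \<longlongrightarrow> 0) (at 0)"
    by (auto elim!: Lim_transform_eventually simp: eventually_at_filter)
  then have "((\<lambda>e. (1 / e) *\<^sub>R (mexp (Z + e *\<^sub>R A) - mexp Z)) \<longlongrightarrow> dexp Z A) (at 0)"
    by (simp only: LIM_zero_iff tendsto_norm_zero_iff)
  then have "(I \<longlongrightarrow> dexp Z A) (at 0)"
    by (rule Lim_transform_eventually) (auto simp: I eventually_at_filter)
  with lim have "dexp Z A = I 0" by (metis LIM_unique)
  then have *: "dexp Z A = integral {0..1} (?f 0)" by (simp add: I_def)
  have "?f 0 integrable_on {0..1}"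
    by (intro integrable_continuous_interval continuous_intros)
  then show ?thesis using * by (simp add: has_integral_integral)
qed

section \<open>Projection onto a subspace\<close>

definition oproj :: "'a::euclidean_space set \<Rightarrow> 'a \<Rightarrow> 'a" where
  "oproj E x = (\<Sum>b\<in>(SOME B. pairwise orthogonal B \<and> (\<forall>b\<in>B. norm b = 1) \<and> independent B \<and> span B = E).
     (x \<bullet> b) *\<^sub>R b)"

lemma bounded_linear_oproj: "bounded_linear (oproj E)"
  unfolding oproj_def
  by (intro bounded_linear_sum bounded_linear_scaleR_const bounded_linear_inner_left)

context
  fixes E :: "'a::euclidean_space set"
  assumes E: "subspace E"
begin

lemma oproj_in: "oproj E x \<in> E"
  and oproj_orth: "y \<in> E \<Longrightarrow> (x - oproj E x) \<bullet> y = 0"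
proof -
  define B where "B = (SOME B. pairwise orthogonal B \<and> (\<forall>b\<in>B. norm b = 1) \<and> independent B \<and> span B = E)"
  have "\<exists>B. pairwise orthogonal B \<and> (\<forall>b\<in>B. norm b = 1) \<and> independent B \<and> span B = E"
    using orthonormal_basis_subspace[OF E] by metis
  from someI_ex[OF this] have B: "pairwise orthogonal B" "\<And>b. b \<in> B \<Longrightarrow> norm b = 1"
    "independent B" "span B = E"
    unfolding B_def by auto
  have fin: "finite B" using B(3) independent_imp_finite by blast
  have P: "oproj E x = (\<Sum>b\<in>B. (x \<bullet> b) *\<^sub>R b)" by (simp add: oproj_def B_def)
  have "oproj E x \<in> span B"
    unfolding P by (intro span_sum span_scale span_base)
  then show "oproj E x \<in> E" by (simp add: B(4))
  have "(x - oproj E x) \<bullet> b = 0" if b: "b \<in> B" for b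
  proof -
    have "oproj E x \<bullet> b = (\<Sum>c\<in>B. if c = b then x \<bullet> b else 0)"
      unfolding P inner_sum_left
    proof (rule sum.cong[OF refl])
      fix c assume c: "c \<in> B"
      show "(x \<bullet> c) *\<^sub>R c \<bullet> b = (if c = b then x \<bullet> b else 0)"
        using B(1) B(2)[OF b] b c by (auto simp: pairwise_def orthogonal_def dot_square_norm)
    qed
    then show ?thesis using fin b by (simp add: inner_diff_left)
  qed
  then have "orthogonal (x - oproj E x) y" if "y \<in> span B"
    by (intro orthogonal_to_span[OF that]) (auto simp: orthogonal_def)
  then show "y \<in> E \<Longrightarrow> (x - oproj E x) \<bullet> y = 0"
    using B(4) by (auto simp: orthogonal_def)
qed

lemma oproj_ident: "x \<in> E \<Longrightarrow> oproj E x = x"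
proof -
  assume x: "x \<in> E"
  have "x - oproj E x \<in> E" using x oproj_in E by (intro subspace_diff)
  from oproj_orth[OF this, of x] show ?thesis by simp
qed

lemma oproj_eq_iff: "oproj E x = x \<longleftrightarrow> x \<in> E"
  using oproj_ident oproj_in by metis

lemma norm_oproj_decomp: "(norm x)\<^sup>2 = (norm (oproj E x))\<^sup>2 + (norm (x - oproj E x))\<^sup>2"
  using norm_add_Pythagorean[of "x - oproj E x" "oproj E x"] oproj_orth[OF oproj_in, of x]
  by (simp add: orthogonal_def)

lemma norm_oproj_le: "norm (oproj E x) \<le> norm x"
  and norm_diff_oproj_le: "norm (x - oproj E x) \<le> norm x"
  by (rule power2_le_imp_le; use norm_oproj_decomp[of x] in simp)+

text \<open>A point lies in \<open>E\<close> iff \<open>oproj E\<close> fixes it, and a bounded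
  linear map commutes with differentiation. The next lemma is the same argument for
  integrals.\<close>

lemma has_vector_derivative_in_subspace:
  assumes f: "(f has_vector_derivative f') (at t within S)" and S: "at t within S \<noteq> bot"
    and mem: "\<And>s. s \<in> S \<Longrightarrow> f s \<in> E" and t: "t \<in> S"
  shows "f' \<in> E"
proof -
  have "((\<lambda>s. oproj E (f s)) has_vector_derivative oproj E f') (at t within S)"
    by (rule bounded_linear.has_vector_derivative[OF bounded_linear_oproj f])
  then have "(f has_vector_derivative oproj E f') (at t within S)"
    by (rule has_vector_derivative_transform[OF t, rotated]) (simp add: oproj_ident mem)
  then have "oproj E f' = f'" by (rule vector_derivative_unique_within[OF S _ f])
  then show ?thesis by (simp add: oproj_eq_iff)
qed

lemma has_integral_in_subspace:
  assumes "(f has_integral I) S" and "\<And>s. s \<in> S \<Longrightarrow> f s \<in> E"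
  shows "I \<in> E"
proof -
  have "((oproj E \<circ> f) has_integral oproj E I) S"
    by (rule has_integral_linear[OF assms(1) bounded_linear_oproj])
  then have "(f has_integral oproj E I) S"
    by (rule has_integral_eq[rotated]) (simp add: oproj_ident assms(2))
  then have "oproj E I = I" by (rule has_integral_unique[OF _ assms(1)])
  then show ?thesis by (simp add: oproj_eq_iff)
qed

end

text \<open>The function \<open>f t * exp (- K * t)\<close> does not increase, so
  \<open>f 1 \<le> 0\<close>. In the applications \<open>f\<close> is built from squared norms of
  components orthogonal to \<open>E\<close>.\<close>

lemma gronwall_zero:
  fixes f :: "real \<Rightarrow> real"
  assumes cont: "continuous_on {0..1} f"
    and der: "\<And>t. 0 < t \<Longrightarrow> t < 1 \<Longrightarrow> \<exists>d. (f has_real_derivative d) (at t) \<and> d \<le> K * f t"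
    and "f 0 = 0" and nonneg: "f 1 \<ge> 0"
  shows "f 1 = 0"
proof -
  let ?g = "\<lambda>t. f t * exp (- K * t)"
  have "?g 1 \<le> ?g 0"
  proof (rule DERIV_nonpos_imp_decreasing_open[of 0 1])
    fix t :: real assume t: "0 < t" "t < 1"
    from der[OF this] obtain d where d: "(f has_real_derivative d) (at t)" "d \<le> K * f t" by blast
    have "(?g has_real_derivative (d - K * f t) * exp (- K * t)) (at t)"
      by (auto intro!: derivative_eq_intros d(1) simp: algebra_simps)
    moreover have "(d - K * f t) * exp (- K * t) \<le> 0"
      using d(2) by (simp add: mult_nonpos_nonneg)
    ultimately show "\<exists>y. (?g has_real_derivative y) (at t) \<and> y \<le> 0" by blast
  qed (auto intro!: continuous_intros cont)
  then show ?thesis using assms(3) nonneg by (simp add: mult_le_0_iff)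
qed

section \<open>The derivative of the exponential along a Lie triple system\<close>

text \<open>This is \<open>exp (r ad Z) A\<close>.\<close>

definition conjexp :: "real^'n^'n \<Rightarrow> real^'n^'n \<Rightarrow> real \<Rightarrow> real^'n^'n" where
  "conjexp Z A r = mexp (r *\<^sub>R Z) ** A ** mexp (- (r *\<^sub>R Z))"

lemma conjexp_zero [simp]: "conjexp Z A 0 = A"
  by (simp add: conjexp_def)

lemma has_vector_derivative_conjexp:
  "(conjexp Z A has_vector_derivative mbracket Z (conjexp Z A r)) (at r within S)"
proof -
  have 1: "((\<lambda>r. - r) has_real_derivative (-1)) (at r within S)"
    by (auto intro!: derivative_eq_intros)
  have "((\<lambda>r. mexp (r *\<^sub>R Z) ** A ** mexp ((- r) *\<^sub>R Z)) has_vector_derivative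
      (mexp (r *\<^sub>R Z) ** A) ** ((-1) *\<^sub>R (Z ** mexp ((- r) *\<^sub>R Z))) +
      (mexp (r *\<^sub>R Z) ** 0 + 1 *\<^sub>R (Z ** mexp (r *\<^sub>R Z)) ** A) ** mexp ((- r) *\<^sub>R Z)) (at r within S)"
    by (rule has_vector_derivative_matrix_mult[OF
          has_vector_derivative_matrix_mult[OF has_vector_derivative_mexp[OF DERIV_ident] has_vector_derivative_const]
          has_vector_derivative_mexp[OF 1]])
  moreover have "Z ** mexp (- (r *\<^sub>R Z)) = mexp (- (r *\<^sub>R Z)) ** Z"
    by (rule mexp_commute) (simp add: mm.scaleR_left mm.scaleR_right mm.minus_left mm.minus_right)
  ultimately show ?thesis
    unfolding conjexp_def mbracket_def
    by (simp add: matrix_mul_assoc mm.minus_right mm.zero_right)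
qed

lemma norm_mbracket_le: "norm (mbracket X Y) \<le> 2 * norm X * norm Y"
proof -
  have "norm (mbracket X Y) \<le> norm (X ** Y) + norm (Y ** X)"
    unfolding mbracket_def by (rule norm_triangle_ineq4)
  also have "\<dots> \<le> norm X * norm Y + norm Y * norm X"
    by (intro add_mono norm_matrix_mult_le)
  finally show ?thesis by (simp add: algebra_simps)
qed

lemma bounded_linear_mbracket: "bounded_linear (mbracket X)"
  unfolding mbracket_def
  by (intro bounded_linear_sub mm.bounded_linear_left mm.bounded_linear_right)

definition lie_triple :: "(real^'n^'n) set \<Rightarrow> bool" where
  "lie_triple E \<longleftrightarrow> subspace E \<and> E \<subseteq> Sym \<and> (\<forall>X\<in>E. \<forall>Y\<in>E. mbracket X (mbracket X Y) \<in> E)"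

text \<open>The sum is \<open>2 cosh (r ad Z) A\<close>, in which only even powers of
  \<open>ad Z\<close> occur. In terms of differential equations,
  \<open>h = 2 cosh (t ad W) A\<close> solves \<open>h'' = (ad W)^2 h\<close>, and
  \<open>(ad W)^2\<close> maps \<open>E\<close> into itself.\<close>

lemma conjexp_even_in_lie_triple:
  assumes E: "lie_triple E" and Z: "Z \<in> E" and A: "A \<in> E"
  shows "conjexp Z A r + conjexp Z A (- r) \<in> E"
proof -
  have sub: "subspace E" and triple: "\<And>X Y. X \<in> E \<Longrightarrow> Y \<in> E \<Longrightarrow> mbracket X (mbracket X Y) \<in> E"
    using E by (auto simp: lie_triple_def)
  \<comment> \<open>Absorbing \<open>r\<close> into the matrix reduces the claim to time 1, where
    \<open>gronwall_zero\<close> applies, for either sign of \<open>r\<close>.\<close>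
  define W where "W = r *\<^sub>R Z"
  have W: "W \<in> E" using Z sub by (simp add: W_def subspace_scale)
  let ?Q = "\<lambda>X. X - oproj E X"
  have Q: "bounded_linear ?Q"
    by (intro bounded_linear_sub bounded_linear_ident bounded_linear_oproj)
  have Qlin: "linear ?Q" using Q by (rule bounded_linear.linear)
  have blin: "linear (mbracket X)" for X :: "real^'n^'n"
    by (rule bounded_linear.linear[OF bounded_linear_mbracket])
  have Q0: "X \<in> E \<Longrightarrow> ?Q X = 0" for X by (simp add: oproj_ident[OF sub])
  define h where "h = (\<lambda>t. conjexp W A t + conjexp W A (- t))"
  define k where "k = (\<lambda>t. conjexp W A t - conjexp W A (- t))"
  have neg: "((\<lambda>t. conjexp W A (- t)) has_vector_derivative - mbracket W (conjexp W A (- t))) (at t)" for t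
  proof -
    have "(uminus has_vector_derivative (- 1)) (at t)"
      by (auto intro!: derivative_eq_intros)
    from vector_diff_chain_at[OF this has_vector_derivative_conjexp, of W A] show ?thesis
      by (simp add: o_def)
  qed
  have h': "(h has_vector_derivative mbracket W (k t)) (at t)"
    and k': "(k has_vector_derivative mbracket W (h t)) (at t)" for t
    unfolding h_def k_def
    using has_vector_derivative_add[OF has_vector_derivative_conjexp neg, of W A t]
      has_vector_derivative_diff[OF has_vector_derivative_conjexp neg, of W A t]
    by (simp_all add: linear_add[OF blin] linear_diff[OF blin])
  define p where "p = (\<lambda>t. ?Q (h t))"
  define q where "q = (\<lambda>t. ?Q (mbracket W (k t)))"
  have p': "(p has_vector_derivative q t) (at t)" for t
    unfolding p_def q_def by (rule bounded_linear.has_vector_derivative[OF Q h'])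
  have q': "(q has_vector_derivative ?Q (mbracket W (mbracket W (h t)))) (at t)" for t
    unfolding q_def
    by (rule bounded_linear.has_vector_derivative[OF Q bounded_linear.has_vector_derivative[OF bounded_linear_mbracket k']])
  \<comment> \<open>The triple condition enters here: the part of \<open>h t\<close> in
    \<open>E\<close> contributes nothing to the component orthogonal to \<open>E\<close>, so the
    equation for \<open>p\<close> closes up.\<close>
  have q'_eq: "?Q (mbracket W (mbracket W (h t))) = ?Q (mbracket W (mbracket W (p t)))" for t
  proof -
    have "mbracket W (mbracket W (p t)) =
        mbracket W (mbracket W (h t)) - mbracket W (mbracket W (oproj E (h t)))"
      unfolding p_def by (simp only: linear_diff[OF blin])
    moreover have "?Q (mbracket W (mbracket W (oproj E (h t)))) = 0"
      by (intro Q0 triple W oproj_in sub)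
    ultimately show ?thesis
      using linear_diff[OF Qlin, of "mbracket W (mbracket W (h t))" "mbracket W (mbracket W (oproj E (h t)))"]
      by simp
  qed
  let ?C = "4 * (norm W)\<^sup>2"
  have bound: "norm (?Q (mbracket W (mbracket W X))) \<le> ?C * norm X" for X
  proof -
    have "norm (?Q (mbracket W (mbracket W X))) \<le> norm (mbracket W (mbracket W X))"
      by (rule norm_diff_oproj_le[OF sub])
    also have "\<dots> \<le> 2 * norm W * (2 * norm W * norm X)"
      by (intro order_trans[OF norm_mbracket_le] mult_left_mono norm_mbracket_le) auto
    finally show ?thesis by (simp add: power2_eq_square)
  qed
  \<comment> \<open>The equation for \<open>p\<close> is of second order; including
    \<open>q = p'\<close> turns it into a first order system with a Gronwall estimate.\<close>
  define f where "f = (\<lambda>t. p t \<bullet> p t + q t \<bullet> q t)"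
  have f': "(f has_real_derivative
      2 * (p t \<bullet> q t) + 2 * (q t \<bullet> ?Q (mbracket W (mbracket W (p t))))) (at t)" for t
  proof -
    have "(f has_vector_derivative (p t \<bullet> q t + q t \<bullet> p t) +
       (q t \<bullet> ?Q (mbracket W (mbracket W (h t))) + ?Q (mbracket W (mbracket W (h t))) \<bullet> q t)) (at t)"
      unfolding f_def
      by (intro has_vector_derivative_add bounded_bilinear.has_vector_derivative[OF bounded_bilinear_inner] p' q')
    then show ?thesis
      by (simp add: has_real_derivative_iff_has_vector_derivative q'_eq inner_commute)
  qed
  have "f 1 = 0"
  proof (rule gronwall_zero)
    show "continuous_on {0..1} f"
      using f' DERIV_continuous by (intro continuous_at_imp_continuous_on) blast
    show "f 0 = 0"
    proof -
      have "p 0 = 0" unfolding p_def by (rule Q0) (use A sub in \<open>simp only: h_def conjexp_zero minus_zero subspace_add\<close>)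
      moreover have "q 0 = 0"
        unfolding q_def by (rule Q0) (use sub in \<open>simp add: k_def linear_0[OF blin] subspace_0\<close>)
      ultimately show ?thesis by (simp add: f_def)
    qed
    show "f 1 \<ge> 0" by (simp add: f_def)
    fix t :: real
    have "2 * (p t \<bullet> q t) \<le> p t \<bullet> p t + q t \<bullet> q t"
      using inner_ge_zero[of "p t - q t"] by (simp add: inner_diff_left inner_diff_right inner_commute)
    moreover have "2 * (q t \<bullet> ?Q (mbracket W (mbracket W (p t)))) \<le> ?C * (p t \<bullet> p t + q t \<bullet> q t)"
    proof -
      have "q t \<bullet> ?Q (mbracket W (mbracket W (p t))) \<le> norm (q t) * (?C * norm (p t))"
        by (intro order_trans[OF norm_cauchy_schwarz] mult_left_mono bound) auto
      then have "2 * (q t \<bullet> ?Q (mbracket W (mbracket W (p t)))) \<le> ?C * (2 * norm (p t) * norm (q t))"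
        by (simp add: ac_simps)
      also have "\<dots> \<le> ?C * ((norm (p t))\<^sup>2 + (norm (q t))\<^sup>2)"
        by (intro mult_left_mono sum_squares_bound) auto
      finally show ?thesis by (simp add: dot_square_norm)
    qed
    ultimately have "2 * (p t \<bullet> q t) + 2 * (q t \<bullet> ?Q (mbracket W (mbracket W (p t)))) \<le> (1 + ?C) * f t"
      unfolding f_def by (simp only: distrib_right mult_1_left)
    with f' show "\<exists>d. (f has_real_derivative d) (at t) \<and> d \<le> (1 + ?C) * f t" by blast
  qed
  then have "p 1 \<bullet> p 1 = 0"
    unfolding f_def using inner_ge_zero[of "p 1"] inner_ge_zero[of "q 1"] by linarith
  then have "h 1 = oproj E (h 1)" by (simp add: p_def)
  then have "h 1 \<in> E" using oproj_in[OF sub] by metis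
  then show ?thesis by (simp add: h_def conjexp_def W_def)
qed

text \<open>The derivative of \<open>exp\<close> at \<open>Z\<close>, transported to the identity by the isometry
  \<open>X \<mapsto> e\<^bsup>-Z/2\<^esup> X e\<^bsup>-Z/2\<^esup>\<close>.\<close>

definition gexp :: "real^'n^'n \<Rightarrow> real^'n^'n \<Rightarrow> real^'n^'n" where
  "gexp Z A = mexp (- ((1/2) *\<^sub>R Z)) ** dexp Z A ** mexp (- ((1/2) *\<^sub>R Z))"

lemma gexp_has_integral: "((\<lambda>s. conjexp Z A (s - 1/2)) has_integral gexp Z A) {0..1}"
proof -
  let ?P = "mexp (- ((1/2) *\<^sub>R Z))"
  have "bounded_linear (\<lambda>X. ?P ** X ** ?P)"
    using bounded_linear_compose[OF mm.bounded_linear_left[of ?P] mm.bounded_linear_right[of ?P]] .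
  from has_integral_linear[OF dexp_has_integral this, of Z A]
  have "((\<lambda>s. ?P ** (mexp (s *\<^sub>R Z) ** A ** mexp ((1 - s) *\<^sub>R Z)) ** ?P) has_integral gexp Z A) {0..1}"
    by (simp add: o_def gexp_def)
  moreover have "?P ** (mexp (s *\<^sub>R Z) ** A ** mexp ((1 - s) *\<^sub>R Z)) ** ?P = conjexp Z A (s - 1/2)" for s
  proof -
    have "?P ** mexp (s *\<^sub>R Z) = mexp ((s - 1/2) *\<^sub>R Z)" "mexp ((1 - s) *\<^sub>R Z) ** ?P = mexp (- ((s - 1/2) *\<^sub>R Z))"
      using mexp_add_scaleR[of "-1/2" Z s] mexp_add_scaleR[of "1 - s" Z "-1/2"]
      by (simp_all add: algebra_simps)
    then show ?thesis
      unfolding conjexp_def by (metis matrix_mul_assoc)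
  qed
  ultimately show ?thesis by simp
qed

text \<open>Adding the integral to its reflection under \<open>s \<mapsto> 1 - s\<close> leaves only
  \<open>conjexp Z A r + conjexp Z A (- r)\<close>, which lies in \<open>E\<close>, and
  \<open>E\<close> is closed under integration.\<close>

lemma gexp_in_lie_triple:
  assumes E: "lie_triple E" and "Z \<in> E" "A \<in> E"
  shows "gexp Z A \<in> E"
proof -
  have sub: "subspace E" using E by (simp add: lie_triple_def)
  have img: "(\<lambda>x::real. - x + 1) ` {0..1} = {0..1}"
    by (auto simp: image_iff intro!: bexI[of _ "1 - _"])
  have "((\<lambda>s. conjexp Z A ((- s + 1) - 1/2)) has_integral gexp Z A) {0..1}"
    using has_integral_affinity[of "\<lambda>s. conjexp Z A (s - 1/2)" "gexp Z A" 0 1 "-1" 1] gexp_has_integral[of Z A] img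
    by simp
  moreover have "- s + 1 - 1/2 = - (s - 1/2)" for s :: real by simp
  ultimately have "((\<lambda>s. conjexp Z A (- (s - 1/2))) has_integral gexp Z A) {0..1}" by simp
  with gexp_has_integral
  have "((\<lambda>s. conjexp Z A (s - 1/2) + conjexp Z A (- (s - 1/2))) has_integral gexp Z A + gexp Z A) {0..1}"
    by (rule has_integral_add)
  then have "gexp Z A + gexp Z A \<in> E"
    by (rule has_integral_in_subspace[OF sub]) (rule conjexp_even_in_lie_triple[OF assms])
  then have "(1/2) *\<^sub>R (gexp Z A + gexp Z A) \<in> E" by (rule subspace_scale[OF sub])
  then show ?thesis by (simp only: scaleR_half_double)
qed

lemma Sym_iff: "A \<in> Sym \<longleftrightarrow> transpose A = A"
  by (simp add: Sym_def)

lemma mexp_in_Sym: "A \<in> Sym \<Longrightarrow> mexp A \<in> Sym"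
  by (simp add: Sym_iff transpose_mexp)

lemma inner_conj_Sym:
  assumes "P \<in> Sym" "Q \<in> Sym"
  shows "(P ** A ** Q) \<bullet> B = A \<bullet> (P ** B ** Q)"
proof -
  have "(P ** A ** Q) \<bullet> B = (P ** A) \<bullet> (B ** transpose Q)" by (rule inner_matrix_mult_right)
  also have "\<dots> = A \<bullet> (transpose P ** (B ** transpose Q))" by (rule inner_matrix_mult_left)
  finally show ?thesis using assms by (simp add: Sym_iff matrix_mul_assoc)
qed

lemma subspace_Sym: "subspace Sym"
  by (auto simp: subspace_def Sym_iff transpose_add transpose_scaleR) (simp add: transpose_def vec_eq_iff)

text \<open>With \<open>B = g A g\<^sup>-\<^sup>1\<close> and \<open>g = e\<^bsup>rZ/2\<^esup>\<close>, this is \<open>tr (B\<^sup>2) \<le> |B|\<^sup>2\<close>.\<close>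

lemma inner_conjexp_ge:
  assumes Z: "Z \<in> Sym" and A: "A \<in> Sym"
  shows "(norm A)\<^sup>2 \<le> A \<bullet> conjexp Z A r"
proof -
  define P where "P = mexp ((r/2) *\<^sub>R Z)"
  define Q where "Q = mexp (- ((r/2) *\<^sub>R Z))"
  define B where "B = P ** A ** Q"
  have sym: "P \<in> Sym" "Q \<in> Sym"
    unfolding P_def Q_def using Z by (auto intro!: mexp_in_Sym subspace_scale subspace_neg subspace_Sym)
  have PQ: "P ** Q = mat 1" "Q ** P = mat 1" by (simp_all add: P_def Q_def)
  have PP: "P ** P = mexp (r *\<^sub>R Z)" "Q ** Q = mexp (- (r *\<^sub>R Z))"
    unfolding P_def Q_def using mexp_half[of "r *\<^sub>R Z"] mexp_half[of "- (r *\<^sub>R Z)"] by simp_all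
  have "B \<bullet> B = A \<bullet> (P ** (P ** A ** Q) ** Q)"
    unfolding B_def by (rule inner_conj_Sym[OF sym])
  also have "P ** (P ** A ** Q) ** Q = conjexp Z A r"
    unfolding conjexp_def PP[symmetric] by (simp add: matrix_mul_assoc)
  finally have BB: "(norm B)\<^sup>2 = A \<bullet> conjexp Z A r" by (simp add: dot_square_norm)
  have "B \<bullet> transpose B = A \<bullet> (P ** transpose B ** Q)"
    unfolding B_def by (rule inner_conj_Sym[OF sym])
  also have "P ** transpose B ** Q = P ** Q ** A ** (P ** Q)"
    using sym A unfolding B_def by (simp add: matrix_transpose_mul Sym_iff matrix_mul_assoc)
  also have "\<dots> = A" by (simp add: PQ)
  finally have "A \<bullet> A = B \<bullet> transpose B" by simp
  also have "\<dots> \<le> norm B * norm (transpose B)" by (rule norm_cauchy_schwarz)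
  finally show ?thesis by (simp add: norm_transpose BB[symmetric] dot_square_norm power2_eq_square)
qed

lemma inner_gexp_ge:
  assumes "Z \<in> Sym" "A \<in> Sym"
  shows "(norm A)\<^sup>2 \<le> A \<bullet> gexp Z A"
proof (rule has_integral_le)
  show "((\<lambda>s::real. (norm A)\<^sup>2) has_integral (norm A)\<^sup>2) {0..1}"
    using has_integral_const_real[of "(norm A)\<^sup>2" 0 1] by simp
  show "((\<lambda>s. A \<bullet> conjexp Z A (s - 1/2)) has_integral A \<bullet> gexp Z A) {0..1}"
    using has_integral_linear[OF gexp_has_integral bounded_linear_inner_right] by (simp add: o_def)
qed (rule inner_conjexp_ge[OF assms])

lemma norm_gexp_ge:
  assumes "Z \<in> Sym" "A \<in> Sym"
  shows "norm A \<le> norm (gexp Z A)"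
proof (cases "A = 0")
  case False
  have "norm A * norm A \<le> norm A * norm (gexp Z A)"
    using inner_gexp_ge[OF assms] norm_cauchy_schwarz[of A "gexp Z A"] by (simp add: power2_eq_square)
  then show ?thesis using False by simp
qed simp

lemma dexp_eq_zero_iff:
  assumes "Z \<in> Sym" "A \<in> Sym"
  shows "dexp Z A = 0 \<longleftrightarrow> A = 0"
  using norm_gexp_ge[OF assms] linear_0[OF linear_dexp]
  by (auto simp: gexp_def mm.zero_left mm.zero_right)

section \<open>The logarithm on positive definite matrices\<close>

text \<open>By invariance of domain the range is open. It is closed in \<open>T\<close>, because
  properness yields a convergent subsequence of preimages whenever the images converge in
  \<open>T\<close>. Connectedness then gives surjectivity.\<close>

lemma proper_injective_homeomorphism:
  fixes f :: "'a::euclidean_space \<Rightarrow> 'a"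
  assumes cont: "continuous_on UNIV f" and inj: "inj f" and T: "connected T" "range f \<subseteq> T"
    and proper: "\<And>X y. y \<in> T \<Longrightarrow> (\<lambda>n. f (X n)) \<longlonglongrightarrow> y \<Longrightarrow> bounded (range X)"
  shows "homeomorphism UNIV T f (inv f)" "open T"
proof -
  have op: "open (range f)"
    by (rule invariance_of_domain[OF cont open_UNIV inj])
  have "closedin (top_of_set T) (range f)"
    unfolding closedin_closed
  proof (rule exI[of _ "closure (range f)"], rule conjI[OF closed_closure])
    have "y \<in> range f" if y: "y \<in> T" "y \<in> closure (range f)" for y
    proof -
      from y(2) obtain Y where Y: "\<And>n. Y n \<in> range f" "Y \<longlonglongrightarrow> y"
        unfolding closure_sequential by blast
      define X where "X = (\<lambda>n. inv f (Y n))"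
      have lim: "(\<lambda>n. f (X n)) \<longlonglongrightarrow> y"
        using Y by (simp add: X_def f_inv_into_f)
      from bounded_imp_convergent_subsequence[OF proper[OF y(1) this]]
      obtain x r where r: "strict_mono r" "(X \<circ> r) \<longlonglongrightarrow> x" by blast
      have "isCont f x" using cont by (simp add: continuous_on_eq_continuous_at)
      from isCont_tendsto_compose[OF this r(2)] have "(\<lambda>n. f (X (r n))) \<longlonglongrightarrow> f x"
        by (simp add: o_def)
      moreover have "(\<lambda>n. f (X (r n))) \<longlonglongrightarrow> y"
        using LIMSEQ_subseq_LIMSEQ[OF lim r(1)] by (simp add: o_def)
      ultimately have "f x = y" by (rule LIMSEQ_unique)
      then show ?thesis by blast
    qed
    then show "range f = T \<inter> closure (range f)"
      using T(2) closure_subset[of "range f"] by auto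
  qed
  moreover have "openin (top_of_set T) (range f)"
    by (rule open_subset[OF T(2) op])
  ultimately have "range f = T"
    using T(1) unfolding connected_clopen by blast
  moreover have "continuous_on (range f) (inv f)"
    by (rule continuous_on_inverse_open[OF open_UNIV cont]) (simp_all add: inj)
  then have "homeomorphism UNIV (range f) f (inv f)"
    using cont inj by (simp add: homeomorphism_def f_inv_into_f)
  ultimately show "homeomorphism UNIV T f (inv f)" "open T" using op by auto
qed

section \<open>Symmetric parts, positive definite matrices and injectivity of the
  exponential\<close>

definition sympart :: "real^'n^'n \<Rightarrow> real^'n^'n" where
  "sympart A = (1/2) *\<^sub>R (A + transpose A)"

lemma bounded_linear_sympart: "bounded_linear sympart"
  unfolding sympart_def
  by (intro bounded_linear_const_scaleR bounded_linear_add bounded_linear_ident bounded_linear_transpose)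

lemma sympart_in_Sym [simp]: "sympart A \<in> Sym"
  by (simp add: sympart_def Sym_iff transpose_add transpose_scaleR add.commute)

lemma sympart_ident: "A \<in> Sym \<Longrightarrow> sympart A = A"
  by (simp only: sympart_def Sym_iff scaleR_half_double)

lemmas sympart_add = linear_add[OF bounded_linear.linear[OF bounded_linear_sympart]]
  and sympart_diff = linear_diff[OF bounded_linear.linear[OF bounded_linear_sympart]]
  and sympart_zero = linear_0[OF bounded_linear.linear[OF bounded_linear_sympart]]

lemma continuous_on_sympart [continuous_intros]:
  "continuous_on S f \<Longrightarrow> continuous_on S (\<lambda>x. sympart (f x))"
  by (rule bounded_linear.continuous_on[OF bounded_linear_sympart])

lemma SPD_subset_Sym: "SPD \<subseteq> Sym"
  by (auto simp: SPD_def Sym_def)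

lemma convex_SPD: "convex SPD"
proof (rule convexI)
  fix A B :: "real^'n^'n" and u v :: real
  assume AB: "A \<in> SPD" "B \<in> SPD" and uv: "0 \<le> u" "0 \<le> v" "u + v = 1"
  have "x \<bullet> ((u *\<^sub>R A + v *\<^sub>R B) *v x) > 0" if "x \<noteq> 0" for x
  proof -
    have pos: "x \<bullet> (A *v x) > 0" "x \<bullet> (B *v x) > 0" using AB that by (auto simp: SPD_def)
    have "x \<bullet> ((u *\<^sub>R A + v *\<^sub>R B) *v x) = u * (x \<bullet> (A *v x)) + v * (x \<bullet> (B *v x))"
      by (simp add: matrix_vector_mult_add_rdistrib inner_add_right flip: scaleR_matrix_vector_assoc)
    moreover have "u > 0 \<or> v > 0" using uv by auto
    ultimately show ?thesis
      using pos uv by (auto intro: add_pos_nonneg add_nonneg_pos)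
  qed
  then show "u *\<^sub>R A + v *\<^sub>R B \<in> SPD"
    using AB by (simp add: SPD_def transpose_add transpose_scaleR)
qed

lemma invertible_SPD:
  assumes "A \<in> SPD"
  shows "invertible A"
proof -
  have "x = 0" if "A *v x = 0" for x
    using assms that by (auto simp: SPD_def)
  then show ?thesis
    by (simp add: invertible_left_inverse matrix_left_invertible_ker)
qed

lemma congruence_SPD:
  assumes A: "A \<in> SPD" and P: "P \<in> Sym" "invertible P"
  shows "P ** A ** P \<in> SPD"
proof -
  have "x \<bullet> ((P ** A ** P) *v x) > 0" if "x \<noteq> 0" for x
  proof -
    have "P *v x \<noteq> 0"
      using P(2) that by (simp add: invertible_left_inverse matrix_left_invertible_ker) blast
    then have "(P *v x) \<bullet> (A *v (P *v x)) > 0" using A by (simp add: SPD_def)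
    moreover have "(P *v x) \<bullet> w = x \<bullet> (P *v w)" for w
      using P(1) by (metis Sym_iff dot_lmul_matrix vector_transpose_matrix)
    ultimately show ?thesis
      by (simp add: matrix_vector_mul_assoc matrix_mul_assoc)
  qed
  then show ?thesis using A P(1) by (simp add: SPD_def Sym_iff matrix_transpose_mul matrix_mul_assoc)
qed

lemma mat_1_SPD: "mat 1 \<in> SPD"
  by (simp add: SPD_def)

lemma mexp_SPD:
  assumes "X \<in> Sym"
  shows "mexp X \<in> SPD"
proof -
  have "mexp ((1/2) *\<^sub>R X) ** mat 1 ** mexp ((1/2) *\<^sub>R X) \<in> SPD"
    using assms by (intro congruence_SPD mat_1_SPD mexp_in_Sym invertible_mexp subspace_scale subspace_Sym)
  then show ?thesis by (simp add: mexp_half)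
qed

text \<open>Pairing Duhamel's formula with \<open>A = X - Y\<close> gives the integral of the
  continuous function \<open>|e^(sX/2) A e^((1-s)Y/2)|^2\<close>, which must vanish if
  \<open>e^X = e^Y\<close>. Its value at \<open>s = 0\<close> already shows
  \<open>A = 0\<close>.\<close>

lemma inj_on_mexp_Sym: "inj_on mexp Sym"
proof (rule inj_onI)
  fix X Y :: "real^'n^'n" assume XY: "X \<in> Sym" "Y \<in> Sym" and eq: "mexp X = mexp Y"
  define A where "A = X - Y"
  let ?f = "\<lambda>s. norm (mexp ((s/2) *\<^sub>R X) ** A ** mexp (((1 - s)/2) *\<^sub>R Y))"
  have "A \<bullet> (mexp (s *\<^sub>R X) ** A ** mexp ((1 - s) *\<^sub>R Y)) = (?f s)\<^sup>2" for s
  proof -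
    let ?P = "mexp ((s/2) *\<^sub>R X)" and ?Q = "mexp (((1 - s)/2) *\<^sub>R Y)"
    have sym: "?P \<in> Sym" "?Q \<in> Sym" using XY by (auto intro!: mexp_in_Sym subspace_scale subspace_Sym)
    have "mexp (s *\<^sub>R X) = ?P ** ?P" "mexp ((1 - s) *\<^sub>R Y) = ?Q ** ?Q"
      using mexp_half[of "s *\<^sub>R X"] mexp_half[of "(1 - s) *\<^sub>R Y"] by simp_all
    then have "A \<bullet> (mexp (s *\<^sub>R X) ** A ** mexp ((1 - s) *\<^sub>R Y)) = A \<bullet> (?P ** (?P ** A ** ?Q) ** ?Q)"
      by (simp add: matrix_mul_assoc)
    also have "\<dots> = (?P ** A ** ?Q) \<bullet> (?P ** A ** ?Q)"
      by (rule inner_conj_Sym[OF sym, symmetric])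
    finally show ?thesis by (simp add: dot_square_norm)
  qed
  moreover have "((\<lambda>s. A \<bullet> (mexp (s *\<^sub>R X) ** A ** mexp ((1 - s) *\<^sub>R Y))) has_integral A \<bullet> 0) {0..1}"
    using has_integral_linear[OF mexp_duhamel[of X Y] bounded_linear_inner_right[of A]] eq
    by (simp add: o_def A_def)
  ultimately have "((\<lambda>s. (?f s)\<^sup>2) has_integral 0) (cbox 0 1)" by simp
  then have "(?f 0)\<^sup>2 = 0"
    by (rule has_integral_0_cbox_imp_0[rotated 2]) (auto intro!: continuous_intros)
  then have "A ** mexp ((1/2) *\<^sub>R Y) ** mexp (- ((1/2) *\<^sub>R Y)) = 0"
    by (simp add: mm.zero_left)
  then show "X = Y" by (simp add: A_def)
qed

lemma norm_mexp_half: "X \<in> Sym \<Longrightarrow> norm (mexp ((1/2) *\<^sub>R X)) = sqrt (trace (mexp X))"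
  using mexp_in_Sym[OF subspace_scale[OF subspace_Sym], of X "1/2"]
  by (simp add: norm_eq_sqrt_inner inner_matrix_eq_trace Sym_iff mexp_half)

text \<open>This controls the logarithm by a matrix and its inverse, which makes the exponential
  proper. The core is \<open>|X|^2 \<le> X \<bullet> 2 sinh (X/2)\<close>, the inequality
  \<open>f (1/2) \<ge> f 0\<close>, followed by Cauchy-Schwarz.\<close>

lemma norm_le_trace_mexp:
  fixes X :: "real^'n^'n"
  assumes X: "X \<in> Sym"
  shows "norm X \<le> sqrt (trace (mexp X)) + sqrt (trace (mexp (- X)))"
proof (cases "X = 0")
  case False
  define f where "f t = X \<bullet> (mexp (t *\<^sub>R X) - mexp ((- t) *\<^sub>R X)) - 2 * t * (norm X)\<^sup>2" for t
  have f': "(f has_real_derivative X \<bullet> (X ** mexp (t *\<^sub>R X) + X ** mexp ((- t) *\<^sub>R X)) - 2 * (norm X)\<^sup>2) (at t)" for t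
  proof -
    have 1: "((\<lambda>r. - r) has_real_derivative (-1)) (at t)"
      by (auto intro!: derivative_eq_intros)
    have "((\<lambda>t. X \<bullet> (mexp (t *\<^sub>R X) - mexp ((- t) *\<^sub>R X))) has_vector_derivative
       X \<bullet> (1 *\<^sub>R (X ** mexp (t *\<^sub>R X)) - (-1) *\<^sub>R (X ** mexp ((- t) *\<^sub>R X)))) (at t)"
      by (rule bounded_linear.has_vector_derivative[OF bounded_linear_inner_right
            has_vector_derivative_diff[OF has_vector_derivative_mexp[OF DERIV_ident] has_vector_derivative_mexp[OF 1]]])
    then have "((\<lambda>t. X \<bullet> (mexp (t *\<^sub>R X) - mexp ((- t) *\<^sub>R X))) has_real_derivative
       X \<bullet> (X ** mexp (t *\<^sub>R X) + X ** mexp ((- t) *\<^sub>R X))) (at t)"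
      by (simp add: has_real_derivative_iff_has_vector_derivative)
    then show ?thesis unfolding f_def
      by (auto intro!: derivative_eq_intros)
  qed
  \<comment> \<open>This is \<open>cosh \<ge> 1\<close> in matrix form: expand
    \<open>|X P - X Q|^2 \<ge> 0\<close> with \<open>P = e^(tX/2)\<close> and
    \<open>Q = e^(-tX/2)\<close>; as \<open>Q ** P\<close> is the identity, the cross term is
    \<open>2 |X|^2\<close>.\<close>
  have "X \<bullet> (X ** mexp (t *\<^sub>R X) + X ** mexp ((- t) *\<^sub>R X)) \<ge> 2 * (norm X)\<^sup>2" for t
  proof -
    define P where "P = mexp ((t/2) *\<^sub>R X)"
    define Q where "Q = mexp (- ((t/2) *\<^sub>R X))"
    have sym: "P \<in> Sym" "Q \<in> Sym"
      unfolding P_def Q_def using X by (auto intro!: mexp_in_Sym subspace_scale subspace_neg subspace_Sym)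
    have PP: "P ** P = mexp (t *\<^sub>R X)" "Q ** Q = mexp (- (t *\<^sub>R X))"
      unfolding P_def Q_def using mexp_half[of "t *\<^sub>R X"] mexp_half[of "- (t *\<^sub>R X)"] by simp_all
    have QP: "Q ** P = mat 1" by (simp_all add: P_def Q_def)
    have i: "(X ** R) \<bullet> (X ** R') = X \<bullet> (X ** (R' ** R))" if "R \<in> Sym" for R R' :: "real^'n^'n"
      using that by (simp add: inner_matrix_mult_right Sym_iff matrix_mul_assoc)
    have "0 \<le> (X ** P - X ** Q) \<bullet> (X ** P - X ** Q)" by simp
    also have "\<dots> = (X ** P) \<bullet> (X ** P) + (X ** Q) \<bullet> (X ** Q) - 2 * ((X ** P) \<bullet> (X ** Q))"
      by (simp add: inner_diff_left inner_diff_right inner_commute)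
    also have "\<dots> = X \<bullet> (X ** mexp (t *\<^sub>R X) + X ** mexp ((- t) *\<^sub>R X)) - 2 * (X \<bullet> X)"
      by (simp add: i sym PP QP inner_add_right)
    finally show ?thesis by (simp add: dot_square_norm)
  qed
  then have "f 0 \<le> f (1/2)"
    by (intro DERIV_nonneg_imp_nondecreasing[of 0 "1/2" f]) (auto intro!: exI f')
  then have "norm X * norm X \<le> X \<bullet> (mexp ((1/2) *\<^sub>R X) - mexp (- ((1/2) *\<^sub>R X)))"
    by (simp add: f_def power2_eq_square)
  also have "\<dots> \<le> norm X * norm (mexp ((1/2) *\<^sub>R X) - mexp (- ((1/2) *\<^sub>R X)))"
    by (rule norm_cauchy_schwarz)
  finally have "norm X \<le> norm (mexp ((1/2) *\<^sub>R X) - mexp ((1/2) *\<^sub>R (- X)))"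
    using False by simp
  also have "\<dots> \<le> norm (mexp ((1/2) *\<^sub>R X)) + norm (mexp ((1/2) *\<^sub>R (- X)))"
    by (rule norm_triangle_ineq4)
  finally show ?thesis
    by (simp only: norm_mexp_half[OF X] norm_mexp_half[OF subspace_neg[OF subspace_Sym X]])
qed (simp add: trace_I)

section \<open>Differentiability of matrix inversion\<close>

lemma open_invertible: "open {A::real^'n^'n. invertible A}"
proof -
  have "continuous_on UNIV (det :: real^'n^'n \<Rightarrow> real)"
    unfolding det_def by (intro continuous_intros)
  then show ?thesis
    unfolding invertible_det_nz by (intro open_Collect_neq continuous_intros)
qed

text \<open>Everything follows from \<open>B^-1 - C = - C (B - A) B^-1\<close> with
  \<open>C = A^-1\<close>: it first gives continuity, and substituted into the remainder it then
  gives the derivative.\<close>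

lemma has_derivative_matrix_inv:
  fixes A :: "real^'n^'n"
  assumes A: "invertible A"
  shows "(matrix_inv has_derivative (\<lambda>H. - (matrix_inv A ** H ** matrix_inv A))) (at A)"
proof -
  define C where "C = matrix_inv A"
  have ev: "\<forall>\<^sub>F B in at A. invertible B"
    using topological_tendstoD[OF tendsto_ident_at open_invertible] A by auto
  have diff: "matrix_inv B - C = - (C ** (B - A) ** matrix_inv B)" if "invertible B" for B
    using matrix_inv_inverse[OF A] matrix_inv_inverse[OF that]
    by (simp add: C_def mm.diff_left mm.diff_right matrix_mul_assoc)
      (simp flip: matrix_mul_assoc)
  have cont: "(matrix_inv \<longlongrightarrow> C) (at A)"
  proof -
    have "((\<lambda>B. norm C * norm (B - A)) \<longlongrightarrow> norm C * norm (A - A)) (at A)"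
      by (intro tendsto_intros)
    then have "\<forall>\<^sub>F B in at A. norm C * norm (B - A) < 1/2"
      by (intro order_tendstoD(2)[where y = "norm C * norm (A - A)"]) auto
    with ev have "\<forall>\<^sub>F B in at A. norm (matrix_inv B - C) \<le> norm C * norm (B - A) * (2 * norm C)"
    proof eventually_elim
      case (elim B)
      have d: "norm (matrix_inv B - C) \<le> norm C * norm (B - A) * norm (matrix_inv B)"
        unfolding diff[OF elim(1)] norm_minus_cancel
        by (intro order_trans[OF norm_matrix_mult_le] mult_right_mono norm_matrix_mult_le norm_ge_zero)
      \<comment> \<open>Half of \<open>|B^-1|\<close> is absorbed through
        \<open>|B^-1| \<le> |B^-1 - C| + |C|\<close>, which bounds the inverses near
        \<open>A\<close> before their continuity is known.\<close>
      also have "\<dots> \<le> 1/2 * norm (matrix_inv B)"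
        using elim(2) by (intro mult_right_mono) auto
      finally have "norm (matrix_inv B) \<le> 2 * norm C"
        using norm_triangle_ineq2[of "matrix_inv B" C] by simp
      with d show ?case
        by (meson mult_left_mono mult_nonneg_nonneg norm_ge_zero order_trans)
    qed
    moreover have "((\<lambda>B. norm C * norm (B - A) * (2 * norm C)) \<longlongrightarrow> 0) (at A)"
      by (auto intro!: tendsto_eq_intros)
    ultimately have "((\<lambda>B. matrix_inv B - C) \<longlongrightarrow> 0) (at A)"
      by (rule Lim_null_comparison)
    then show ?thesis by (simp only: LIM_zero_iff)
  qed
  show ?thesis
    unfolding has_derivative_iff_norm C_def[symmetric]
  proof
    show "bounded_linear (\<lambda>H. - (C ** H ** C))"
      using bounded_linear_minus[OF bounded_linear_compose[OF mm.bounded_linear_left[of C] mm.bounded_linear_right[of C]]] .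
    have "\<forall>\<^sub>F B in at A. norm (norm (matrix_inv B - C - - (C ** (B - A) ** C)) / norm (B - A)) \<le>
        norm C * norm (matrix_inv B - C)"
      using ev
    proof eventually_elim
      case (elim B)
      have "matrix_inv B - C - - (C ** (B - A) ** C) = - (C ** (B - A) ** (matrix_inv B - C))"
      proof -
        have "C ** (B - A) ** (matrix_inv B - C) = C ** (B - A) ** matrix_inv B - C ** (B - A) ** C"
          by (rule mm.diff_right)
        then show ?thesis using diff[OF elim] by simp
      qed
      then have "norm (matrix_inv B - C - - (C ** (B - A) ** C)) \<le> norm C * norm (B - A) * norm (matrix_inv B - C)"
        by (simp only: norm_minus_cancel)
          (intro order_trans[OF norm_matrix_mult_le] mult_right_mono norm_matrix_mult_le norm_ge_zero)
      then show ?case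
        by (cases "B = A") (simp_all add: divide_le_eq ac_simps)
    qed
    moreover have "((\<lambda>B. norm C * norm (matrix_inv B - C)) \<longlongrightarrow> 0) (at A)"
      by (auto intro!: tendsto_eq_intros cont)
    ultimately show "((\<lambda>B. norm (matrix_inv B - C - - (C ** (B - A) ** C)) / norm (B - A)) \<longlongrightarrow> 0) (at A)"
      by (rule Lim_null_comparison)
  qed
qed

text \<open>\<open>mexp\<close> on \<open>Sym\<close>, extended to all matrices so that it becomes a bijection onto an open set
  and the inverse function results for open sets apply.\<close>

definition symexp :: "real^'n^'n \<Rightarrow> real^'n^'n" where
  "symexp A = mexp (sympart A) + (A - sympart A)"

definition mlog :: "real^'n^'n \<Rightarrow> real^'n^'n" where
  "mlog = inv symexp"

lemma sympart_symexp: "sympart (symexp A) = mexp (sympart A)"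
  by (simp add: symexp_def sympart_add sympart_diff sympart_ident mexp_in_Sym)

lemma connected_sympart_SPD: "connected (sympart -` SPD)"
  by (intro convex_connected convex_linear_vimage bounded_linear.linear[OF bounded_linear_sympart] convex_SPD)

lemma homeomorphism_symexp: "homeomorphism UNIV (sympart -` SPD) symexp (mlog :: real^'n^'n \<Rightarrow> _)"
  and open_sympart_SPD: "open (sympart -` (SPD :: (real^'n^'n) set))"
proof -
  have cont: "continuous_on UNIV (symexp :: real^'n^'n \<Rightarrow> _)"
    unfolding symexp_def by (intro continuous_intros)
  have inj: "inj (symexp :: real^'n^'n \<Rightarrow> _)"
  proof (rule injI)
    fix A B :: "real^'n^'n" assume eq: "symexp A = symexp B"
    then have "mexp (sympart A) = mexp (sympart B)" by (metis sympart_symexp)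
    then have "sympart A = sympart B" using inj_on_mexp_Sym by (auto dest: inj_onD)
    with eq show "A = B" by (simp add: symexp_def)
  qed
  have range: "range (symexp :: real^'n^'n \<Rightarrow> _) \<subseteq> sympart -` SPD"
    by (auto simp: sympart_symexp mexp_SPD)
  have proper: "bounded (range X)" if y: "y \<in> sympart -` SPD" and lim: "(\<lambda>n. symexp (X n)) \<longlonglongrightarrow> y"
    for X and y :: "real^'n^'n"
  proof -
    have "(\<lambda>n. sympart (symexp (X n))) \<longlonglongrightarrow> sympart y"
      by (rule bounded_linear.tendsto[OF bounded_linear_sympart lim])
    then have 1: "(\<lambda>n. mexp (sympart (X n))) \<longlonglongrightarrow> sympart y" by (simp add: sympart_symexp)
    \<comment> \<open>Sequences running to the boundary of \<open>SPD\<close> are excluded here: the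
      limit is invertible, so the inverses \<open>e^(-X)\<close> converge too, and the traces of
      \<open>e^X\<close> and \<open>e^(-X)\<close> are both bounded.\<close>
    have "isCont matrix_inv (sympart y)"
      using y by (intro has_derivative_continuous[OF has_derivative_matrix_inv] invertible_SPD) auto
    from isCont_tendsto_compose[OF this 1]
    have 2: "(\<lambda>n. mexp (- sympart (X n))) \<longlonglongrightarrow> matrix_inv (sympart y)"
      by (simp add: matrix_inv_mexp)
    have tr: "(\<lambda>n. sqrt (trace (Y n))) \<longlonglongrightarrow> sqrt (trace l)" if "Y \<longlonglongrightarrow> l" for Y and l :: "real^'n^'n"
      unfolding trace_def by (intro tendsto_intros that)
    have "convergent (\<lambda>n. sqrt (trace (mexp (sympart (X n)))) + sqrt (trace (mexp (- sympart (X n)))))"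
      unfolding convergent_def using tendsto_add[OF tr[OF 1] tr[OF 2]] by blast
    then have "Bseq (\<lambda>n. sqrt (trace (mexp (sympart (X n)))) + sqrt (trace (mexp (- sympart (X n)))))"
      by (rule convergent_imp_Bseq)
    then obtain K where K: "\<And>n. \<bar>sqrt (trace (mexp (sympart (X n)))) + sqrt (trace (mexp (- sympart (X n))))\<bar> \<le> K"
      by (auto simp: Bseq_def)
    have "convergent (\<lambda>n. symexp (X n) - mexp (sympart (X n)))"
      unfolding convergent_def using tendsto_diff[OF lim 1] by blast
    then have "Bseq (\<lambda>n. X n - sympart (X n))"
      unfolding symexp_def by (intro convergent_imp_Bseq) simp
    then obtain L where L: "\<And>n. norm (X n - sympart (X n)) \<le> L"
      by (auto simp: Bseq_def)
    have "norm (X n) \<le> K + L" for n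
      using norm_triangle_ineq[of "sympart (X n)" "X n - sympart (X n)"] L[of n] K[of n]
        norm_le_trace_mexp[OF sympart_in_Sym, of "X n"] by simp
    then show ?thesis by (auto simp: bounded_iff)
  qed
  show "homeomorphism UNIV (sympart -` SPD) symexp (mlog :: real^'n^'n \<Rightarrow> _)"
    unfolding mlog_def by (rule proper_injective_homeomorphism[OF cont inj connected_sympart_SPD range proper])
  show "open (sympart -` (SPD :: (real^'n^'n) set))"
    by (rule proper_injective_homeomorphism[OF cont inj connected_sympart_SPD range proper])
qed

lemma symexp_mlog: "sympart y \<in> SPD \<Longrightarrow> symexp (mlog y) = y"
  using homeomorphism_symexp by (auto simp: homeomorphism_def)

lemma mlog_mexp: "X \<in> Sym \<Longrightarrow> mlog (mexp X) = X"
proof -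
  assume X: "X \<in> Sym"
  have "mlog (symexp X) = X" using homeomorphism_symexp by (auto simp: homeomorphism_def)
  then show ?thesis using X by (simp add: symexp_def sympart_ident)
qed

lemma mexp_mlog:
  assumes y: "y \<in> SPD"
  shows "mexp (mlog y) = y" "mlog y \<in> Sym"
proof -
  have sy: "sympart y = y" using y SPD_subset_Sym by (auto simp: sympart_ident)
  have eq: "symexp (mlog y) = y" using y by (intro symexp_mlog) (simp add: sy)
  then have "mexp (sympart (mlog y)) = y" using sympart_symexp[of "mlog y"] by (simp add: sy)
  with eq have "sympart (mlog y) = mlog y" by (simp add: symexp_def)
  with \<open>mexp (sympart (mlog y)) = y\<close> show "mexp (mlog y) = y" by simp
  show "mlog y \<in> Sym" using sympart_in_Sym[of "mlog y"] \<open>sympart (mlog y) = mlog y\<close> by simp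
qed

lemma mexp_image_Sym: "mexp ` Sym = SPD"
  using mexp_SPD mexp_mlog by (force simp: image_iff)

lemma continuous_on_mlog: "continuous_on SPD mlog"
proof -
  have "continuous_on (sympart -` SPD) mlog"
    using homeomorphism_symexp by (auto simp: homeomorphism_def)
  then show ?thesis
    by (rule continuous_on_subset) (use SPD_subset_Sym sympart_ident in fastforce)
qed

lemma dexp_in_Sym:
  assumes "Z \<in> Sym" "A \<in> Sym"
  shows "dexp Z A \<in> Sym"
proof -
  have "((\<lambda>e. Z + e *\<^sub>R A) has_vector_derivative A) (at 0)"
    by (auto intro!: derivative_eq_intros)
  from has_vector_derivative_mexp_compose[OF this]
  have "((\<lambda>e. mexp (Z + e *\<^sub>R A)) has_vector_derivative dexp Z A) (at 0)" by simp
  then show ?thesis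
    by (rule has_vector_derivative_in_subspace[OF subspace_Sym])
      (use assms in \<open>auto intro!: mexp_in_Sym subspace_add subspace_scale subspace_Sym\<close>)
qed

text \<open>The inverse function rule for \<open>symexp\<close>. Its derivative \<open>D\<close> is
  injective because the symmetric part of \<open>D h\<close> is \<open>dexp Z (sympart h)\<close>,
  and \<open>dexp Z\<close> is injective on \<open>Sym\<close>.\<close>

lemma mlog_differentiable:
  fixes y :: "real^'n^'n"
  assumes y: "y \<in> SPD"
  shows "mlog differentiable (at y)"
proof -
  define Z where "Z = mlog y"
  have Z: "Z \<in> Sym" using mexp_mlog[OF y] by (simp add: Z_def)
  define D where "D = (\<lambda>h. dexp Z (sympart h) + (h - sympart h))"
  have der: "(symexp has_derivative D) (at Z)"
  proof -
    have "((\<lambda>A. mexp (sympart A)) has_derivative (\<lambda>h. dexp (sympart Z) (sympart h))) (at Z)"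
      using has_derivative_compose[OF bounded_linear_imp_has_derivative[OF bounded_linear_sympart] has_derivative_mexp]
      by blast
    then show ?thesis
      unfolding D_def symexp_def sympart_ident[OF Z]
      by (intro has_derivative_add has_derivative_diff has_derivative_ident
          bounded_linear_imp_has_derivative bounded_linear_sympart)
  qed
  have lin: "linear D" using der has_derivative_linear by blast
  have "inj D"
    unfolding linear_injective_0[OF lin]
  proof (intro allI impI)
    fix h assume h: "D h = 0"
    have "sympart (D h) = dexp Z (sympart h)"
      by (simp add: D_def sympart_add sympart_diff sympart_ident dexp_in_Sym Z)
    then have "sympart h = 0" using h dexp_eq_zero_iff[OF Z, of "sympart h"] by (simp add: sympart_zero)
    then show "h = 0" using h by (simp add: D_def linear_0[OF linear_dexp])
  qed
  then obtain D' where D': "linear D'" "D' \<circ> D = id"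
    using linear_injective_left_inverse[OF lin] by blast
  have y': "y \<in> sympart -` SPD" using y SPD_subset_Sym sympart_ident by fastforce
  have "continuous_on (sympart -` SPD) mlog"
    using homeomorphism_symexp by (auto simp: homeomorphism_def)
  then have "isCont mlog y"
    using continuous_on_eq_continuous_at[OF open_sympart_SPD] y' by blast
  then have "(mlog has_derivative D') (at y)"
    using der D' y'
    by (intro has_derivative_inverse_basic[OF _ _ D'(2) _ open_sympart_SPD])
      (auto simp: Z_def symexp_mlog linear_conv_bounded_linear)
  then show ?thesis by (auto simp: differentiable_def)
qed

text \<open>An explicit formula for the derivative of the logarithm is avoided: differentiating
  \<open>mexp (mlog (c t)) = c t\<close> determines \<open>z'\<close> through \<open>dexp\<close>.
  Nontriviality of the filter makes the derivative of \<open>c\<close> unique.\<close>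

lemma mlog_has_vector_derivative:
  assumes c: "(c has_vector_derivative c') (at t within S)" and S: "at t within S \<noteq> bot"
    and SPD: "c ` S \<subseteq> SPD" and t: "t \<in> S"
  obtains z' where "((\<lambda>t. mlog (c t)) has_vector_derivative z') (at t within S)"
    "z' \<in> Sym" "dexp (mlog (c t)) z' = c'"
proof -
  have ct: "c t \<in> SPD" using SPD t by auto
  from mlog_differentiable[OF this] obtain D where "(mlog has_derivative D) (at (c t))"
    unfolding differentiable_def by blast
  from vector_derivative_diff_chain_within[OF c has_derivative_at_withinI[OF this]]
  have z: "((\<lambda>t. mlog (c t)) has_vector_derivative D c') (at t within S)" by (simp add: o_def)
  have "((\<lambda>t. mexp (mlog (c t))) has_vector_derivative dexp (mlog (c t)) (D c')) (at t within S)"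
    by (rule has_vector_derivative_mexp_compose[OF z])
  then have "(c has_vector_derivative dexp (mlog (c t)) (D c')) (at t within S)"
    by (rule has_vector_derivative_transform[OF t, rotated]) (use SPD in \<open>auto simp: mexp_mlog\<close>)
  then have "dexp (mlog (c t)) (D c') = c'"
    by (rule vector_derivative_unique_within[OF S _ c])
  moreover have "D c' \<in> Sym"
    by (rule has_vector_derivative_in_subspace[OF subspace_Sym z S _ t]) (use SPD in \<open>auto intro!: mexp_mlog(2)\<close>)
  ultimately show ?thesis using that[OF z] by simp
qed

section \<open>The Riemannian distance\<close>

text \<open>By cyclicity of the trace, \<open>X \<mapsto> e^(-Z/2) X e^(-Z/2)\<close> carries the
  metric at \<open>e^Z\<close> to the Frobenius inner product, the metric at the identity.\<close>

lemma spd_metric_mexp: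
  assumes Z: "Z \<in> Sym" and X: "X \<in> Sym"
  shows "spd_metric (mexp Z) X W =
    (mexp (- ((1/2) *\<^sub>R Z)) ** X ** mexp (- ((1/2) *\<^sub>R Z))) \<bullet>
    (mexp (- ((1/2) *\<^sub>R Z)) ** W ** mexp (- ((1/2) *\<^sub>R Z)))"
proof -
  define h where "h = mexp (- ((1/2) *\<^sub>R Z))"
  have h: "transpose h = h" "h ** h = matrix_inv (mexp Z)"
    using mexp_in_Sym[of "- ((1/2) *\<^sub>R Z)"] Z mexp_half[of "- Z"]
    by (simp_all add: h_def matrix_inv_mexp Sym_iff transpose_scaleR subspace_neg[OF subspace_Sym, unfolded Sym_iff])
  have "(h ** X ** h) \<bullet> (h ** W ** h) = trace (h ** (X ** h ** h ** W ** h))"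
    using X h(1) by (simp add: inner_matrix_eq_trace matrix_transpose_mul Sym_iff matrix_mul_assoc)
  also have "\<dots> = trace ((X ** (h ** h) ** W ** h) ** h)"
    by (subst trace_mul_sym) (simp add: matrix_mul_assoc)
  also have "\<dots> = trace ((X ** (h ** h) ** W) ** (h ** h))"
    by (simp add: matrix_mul_assoc)
  also have "\<dots> = spd_metric (mexp Z) X W"
    unfolding spd_metric_def h(2)[symmetric] by (subst trace_mul_sym) (simp add: matrix_mul_assoc)
  finally show ?thesis by (simp add: h_def)
qed

lemma spd_speed_eq_gexp:
  assumes c: "(c has_vector_derivative dexp Z z') (at t)" and "c t = mexp Z" and Z: "Z \<in> Sym" "z' \<in> Sym"
  shows "spd_speed c t = norm (gexp Z z')"
  using vector_derivative_at[OF c] assms(2) spd_metric_mexp[OF Z(1) dexp_in_Sym[OF Z], of "dexp Z z'"]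
  by (simp add: spd_speed_def gexp_def norm_eq_sqrt_inner)

text \<open>The exponential metric increasing property.\<close>

lemma norm_mlog_diff_le_length:
  assumes c: "c \<in> spd_paths x y"
  shows "norm (mlog y - mlog x) \<le> integral {0..1} (spd_speed c)"
proof -
  define u where "u = mlog y - mlog x"
  have cont: "continuous_on {0..1} c" and SPD: "c ` {0..1} \<subseteq> SPD" and ends: "c 0 = x" "c 1 = y"
    and int: "spd_speed c integrable_on {0..1}"
    using c by (auto simp: spd_paths_def piecewise_C1_differentiable_on_def)
  obtain S where S: "finite S" "c C1_differentiable_on {0..1} - S"
    using c by (auto simp: spd_paths_def piecewise_C1_differentiable_on_def)
  then obtain D where D: "\<And>t. t \<in> {0..1} - S \<Longrightarrow> (c has_vector_derivative D t) (at t)"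
    unfolding C1_differentiable_on_def by blast
  define z where "z = (\<lambda>t. mlog (c t))"
  have der: "\<exists>z'. (z has_vector_derivative z') (at t) \<and> norm z' \<le> spd_speed c t"
    if t: "t \<in> {0<..<1} - S" for t
  proof -
    have t01: "t \<in> {0..1}" using t by auto
    have at: "at t within {0..1} = at t" using t by (intro at_within_Icc_at) auto
    have Dt: "(c has_vector_derivative D t) (at t)" using D t by auto
    then have "(c has_vector_derivative D t) (at t within {0..1})" by (simp add: at)
    moreover have "at t within {0..1} \<noteq> bot" unfolding at by simp
    ultimately obtain z' where z': "(z has_vector_derivative z') (at t within {0..1})"
      "z' \<in> Sym" "dexp (mlog (c t)) z' = D t"
      unfolding z_def using mlog_has_vector_derivative[OF _ _ SPD t01] by metis
    have m: "mexp (mlog (c t)) = c t" "mlog (c t) \<in> Sym"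
      using SPD t01 by (auto intro!: mexp_mlog)
    have "spd_speed c t = norm (gexp (mlog (c t)) z')"
      by (rule spd_speed_eq_gexp) (use Dt z' m in simp_all)
    then have "norm z' \<le> spd_speed c t" using norm_gexp_ge[OF m(2) z'(2)] by simp
    then show ?thesis using z'(1) by (auto simp: at)
  qed
  define z' where "z' t = (SOME z'. (z has_vector_derivative z') (at t) \<and> norm z' \<le> spd_speed c t)" for t
  have z': "(z has_vector_derivative z' t) (at t)" "norm (z' t) \<le> spd_speed c t"
    if "t \<in> {0<..<1} - S" for t
    using someI_ex[OF der[OF that]] by (auto simp: z'_def)
  \<comment> \<open>The scalar function \<open>u \<bullet> z\<close> is integrated, so integrability
    of its derivative comes from the fundamental theorem of calculus. At the finitely many
    exceptional points \<open>g\<close> takes the value of the upper bound, so that the comparison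
    holds everywhere.\<close>
  define g where "g t = (if t \<in> {0<..<1} - S then u \<bullet> z' t else norm u * spd_speed c t)" for t
  have contz: "continuous_on {0..1} z"
    unfolding z_def by (rule continuous_on_compose2[OF continuous_on_mlog cont SPD])
  have "(g has_integral (u \<bullet> z 1 - u \<bullet> z 0)) {0..1}"
  proof (rule fundamental_theorem_of_calculus_interior_strong[OF S(1)])
    fix t assume t: "t \<in> {0<..<1} - S"
    show "((\<lambda>t. u \<bullet> z t) has_vector_derivative g t) (at t)"
      using bounded_linear.has_vector_derivative[OF bounded_linear_inner_right z'(1)[OF t], of u] t
      by (simp add: g_def)
  qed (auto intro!: continuous_intros contz)
  moreover have "((\<lambda>t. norm u * spd_speed c t) has_integral norm u * integral {0..1} (spd_speed c)) {0..1}"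
    using has_integral_mult_right[OF integrable_integral[OF int]] .
  moreover have "g t \<le> norm u * spd_speed c t" for t
  proof (cases "t \<in> {0<..<1} - S")
    case True
    then have "u \<bullet> z' t \<le> norm u * spd_speed c t"
      by (intro order_trans[OF norm_cauchy_schwarz] mult_left_mono z') auto
    then show ?thesis using True by (simp add: g_def)
  next
    case False
    then show ?thesis by (simp only: g_def if_False order_refl)
  qed
  ultimately have "u \<bullet> z 1 - u \<bullet> z 0 \<le> norm u * integral {0..1} (spd_speed c)"
    by (rule has_integral_le)
  then have "norm u * norm u \<le> norm u * integral {0..1} (spd_speed c)"
    by (simp add: z_def ends u_def flip: inner_diff_right) (simp add: dot_square_norm power2_eq_square)
  then have "norm u \<le> integral {0..1} (spd_speed c) \<or> u = 0" by auto
  \<comment> \<open>Here \<open>norm u\<close> cannot be cancelled; instead the speed dominates a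
    norm off a finite set, so the length is nonnegative.\<close>
  moreover have "0 \<le> integral {0..1} (spd_speed c)" if "u = 0"
  proof (rule has_integral_nonneg[OF has_integral_spike_finite])
    show "finite (S \<union> {0, 1})" using S(1) by simp
    show "(spd_speed c has_integral integral {0..1} (spd_speed c)) {0..1}"
      by (rule integrable_integral[OF int])
    show "t \<in> {0..1} - (S \<union> {0, 1}) \<Longrightarrow> \<bar>spd_speed c t\<bar> = spd_speed c t" for t
      by (rule abs_of_nonneg[OF order_trans[OF norm_ge_zero z'(2)]]) auto
  qed simp
  ultimately show ?thesis unfolding u_def by auto
qed

lemma spd_dist_le_length:
  assumes "c \<in> spd_paths x y"
  shows "spd_dist x y \<le> integral {0..1} (spd_speed c)"
  unfolding spd_dist_def
  by (rule cINF_lower[OF bdd_belowI2 assms]) (rule norm_mlog_diff_le_length)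

lemma spd_dist_ge_norm_mlog_diff:
  assumes "spd_paths x y \<noteq> {}"
  shows "norm (mlog y - mlog x) \<le> spd_dist x y"
  unfolding spd_dist_def
  by (rule cINF_greatest[OF assms norm_mlog_diff_le_length])

lemma mexp_path:
  assumes V: "V \<in> Sym"
  shows "(\<lambda>t. mexp ((1 - t) *\<^sub>R V)) \<in> spd_paths (mexp V) (mat 1)"
    "integral {0..1} (spd_speed (\<lambda>t. mexp ((1 - t) *\<^sub>R V))) = norm V"
proof -
  let ?c = "\<lambda>t. mexp ((1 - t) *\<^sub>R V)"
  have 1: "((\<lambda>r. 1 - r) has_real_derivative (-1)) (at t)" for t :: real
    by (auto intro!: derivative_eq_intros)
  have der: "(?c has_vector_derivative - (V ** ?c t)) (at t)" for t
    using has_vector_derivative_mexp[OF 1, where A = V] by simp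
  have tr: "trace (V ** V) = (norm V)\<^sup>2"
    using V by (simp add: Sym_iff inner_matrix_eq_trace flip: dot_square_norm)
  have speed: "spd_speed ?c t = norm V" for t
  proof -
    have "spd_metric (?c t) (- (V ** ?c t)) (- (V ** ?c t)) =
        trace (mexp (- ((1 - t) *\<^sub>R V)) ** (V ** V ** mexp ((1 - t) *\<^sub>R V)))"
      by (simp add: spd_metric_def matrix_inv_mexp mm.minus_left mm.minus_right matrix_mul_assoc)
    also have "\<dots> = (norm V)\<^sup>2" by (subst trace_mul_sym) (simp add: tr)
    finally show ?thesis by (simp add: spd_speed_def vector_derivative_at[OF der])
  qed
  then have const: "spd_speed ?c = (\<lambda>t. norm V)" by blast
  show "integral {0..1} (spd_speed ?c) = norm V" unfolding const by simp
  have "?c C1_differentiable_on {0..1}"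
    unfolding C1_differentiable_on_def using der
    by (intro exI[of _ "\<lambda>t. - (V ** ?c t)"]) (auto intro!: continuous_intros)
  then have "?c piecewise_C1_differentiable_on {0..1}"
    by (rule C1_differentiable_imp_piecewise)
  moreover have "spd_speed ?c integrable_on {0..1}" unfolding const by auto
  ultimately show "?c \<in> spd_paths (mexp V) (mat 1)"
    using V by (auto simp: spd_paths_def intro!: mexp_SPD subspace_scale subspace_Sym)
qed

section \<open>Congruences as isometries, and the distance estimate\<close>

lemma matrix_inv_congruence:
  assumes p: "invertible p"
  shows "matrix_inv (mexp Y ** p ** mexp Y) = mexp (- Y) ** matrix_inv p ** mexp (- Y)"
proof (rule matrix_inv_unique_right)
  have "(mexp Y ** p ** mexp Y) ** (mexp (- Y) ** matrix_inv p ** mexp (- Y)) =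
      mexp Y ** (p ** matrix_inv p) ** mexp (- Y)"
    by (simp add: matrix_mul_assoc)
  then show "(mexp Y ** p ** mexp Y) ** (mexp (- Y) ** matrix_inv p ** mexp (- Y)) = mat 1"
    by (simp add: matrix_inv_inverse[OF p])
qed

lemma spd_metric_congruence:
  assumes p: "invertible p"
  shows "spd_metric (mexp Y ** p ** mexp Y) (mexp Y ** X ** mexp Y) (mexp Y ** W ** mexp Y) = spd_metric p X W"
proof -
  let ?P = "mexp Y" and ?Q = "mexp (- Y)"
  have "spd_metric (?P ** p ** ?P) (?P ** X ** ?P) (?P ** W ** ?P) =
      trace (?Q ** (matrix_inv p ** X ** matrix_inv p ** W ** ?P))"
    by (simp add: spd_metric_def matrix_inv_congruence[OF p] matrix_mul_assoc)
  also have "\<dots> = spd_metric p X W"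
    by (subst trace_mul_sym) (simp add: spd_metric_def)
  finally show ?thesis .
qed

lemma congruence_mexp_SPD: "p \<in> SPD \<Longrightarrow> Y \<in> Sym \<Longrightarrow> mexp Y ** p ** mexp Y \<in> SPD"
  by (intro congruence_SPD mexp_in_Sym invertible_mexp)

lemma bounded_linear_congruence: "bounded_linear (\<lambda>X. (P::real^'n^'n) ** X ** P)"
  by (rule bounded_linear_compose[OF mm.bounded_linear_left mm.bounded_linear_right])

lemma spd_paths_congruence:
  assumes c: "c \<in> spd_paths x y" and Y: "Y \<in> Sym"
  defines "d \<equiv> \<lambda>t. mexp Y ** c t ** mexp Y"
  shows "d \<in> spd_paths (mexp Y ** x ** mexp Y) (mexp Y ** y ** mexp Y)"
    "integral {0..1} (spd_speed d) = integral {0..1} (spd_speed c)"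
proof -
  let ?L = "\<lambda>X. mexp Y ** X ** mexp Y"
  have cont: "continuous_on {0..1} c" and SPD: "c ` {0..1} \<subseteq> SPD" and ends: "c 0 = x" "c 1 = y"
    and int: "spd_speed c integrable_on {0..1}"
    using c by (auto simp: spd_paths_def piecewise_C1_differentiable_on_def)
  obtain S where S: "finite S" "c C1_differentiable_on {0..1} - S"
    using c by (auto simp: spd_paths_def piecewise_C1_differentiable_on_def)
  then obtain D where D: "\<And>t. t \<in> {0..1} - S \<Longrightarrow> (c has_vector_derivative D t) (at t)"
      "continuous_on ({0..1} - S) D"
    unfolding C1_differentiable_on_def by blast
  have d: "(d has_vector_derivative ?L (D t)) (at t)" if "t \<in> {0..1} - S" for t
    unfolding d_def by (rule bounded_linear.has_vector_derivative[OF bounded_linear_congruence D(1)[OF that]])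
  have speed: "spd_speed d t = spd_speed c t" if t: "t \<in> {0..1} - S" for t
  proof -
    have "invertible (c t)" using SPD t by (intro invertible_SPD) auto
    then show ?thesis
      unfolding spd_speed_def vector_derivative_at[OF d[OF t]] vector_derivative_at[OF D(1)[OF t]]
      unfolding d_def by (simp only: spd_metric_congruence)
  qed
  show "integral {0..1} (spd_speed d) = integral {0..1} (spd_speed c)"
    by (rule integral_spike[OF negligible_finite[OF S(1)]]) (simp add: speed)
  have "d C1_differentiable_on {0..1} - S"
    unfolding C1_differentiable_on_def using d D(2)
    by (intro exI[of _ "\<lambda>t. ?L (D t)"]) (auto intro!: continuous_intros)
  moreover have "continuous_on {0..1} d"
    unfolding d_def by (intro continuous_intros cont)
  ultimately have "d piecewise_C1_differentiable_on {0..1}"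
    using S(1) by (auto simp: piecewise_C1_differentiable_on_def)
  moreover have "spd_speed d integrable_on {0..1}"
    by (rule integrable_spike_finite[OF S(1) _ int]) (simp add: speed)
  moreover have "d ` {0..1} \<subseteq> SPD"
    using SPD Y by (auto simp: d_def intro!: congruence_mexp_SPD)
  ultimately show "d \<in> spd_paths (?L x) (?L y)"
    using ends by (simp add: spd_paths_def d_def)
qed

lemma spd_dist_congruence:
  assumes Y: "Y \<in> Sym"
  shows "spd_dist (mexp Y ** x ** mexp Y) (mexp Y ** y ** mexp Y) = spd_dist x y"
proof -
  let ?I = "\<lambda>x y. (\<lambda>c. integral {0..1} (spd_speed c)) ` spd_paths x y"
  have sub: "?I x y \<subseteq> ?I (mexp Y ** x ** mexp Y) (mexp Y ** y ** mexp Y)"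
    if "Y \<in> Sym" for x y Y :: "real^'n^'n"
  proof
    fix l assume "l \<in> ?I x y"
    then obtain c where c: "c \<in> spd_paths x y" "l = integral {0..1} (spd_speed c)" by blast
    from spd_paths_congruence[OF c(1) that] c(2)
    show "l \<in> ?I (mexp Y ** x ** mexp Y) (mexp Y ** y ** mexp Y)"
      by (metis imageI)
  qed
  have "- Y \<in> Sym" by (rule subspace_neg[OF subspace_Sym Y])
  from sub[OF this, of "mexp Y ** x ** mexp Y" "mexp Y ** y ** mexp Y"]
  have "?I (mexp Y ** x ** mexp Y) (mexp Y ** y ** mexp Y) \<subseteq> ?I x y"
    by (simp add: matrix_mul_assoc)
  with sub[OF Y, of x y] have "?I (mexp Y ** x ** mexp Y) (mexp Y ** y ** mexp Y) = ?I x y"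
    by (rule subset_antisym[rotated])
  then show ?thesis by (simp add: spd_dist_def)
qed

lemma spd_dist_mexp_one:
  fixes V :: "real^'n^'n"
  assumes V: "V \<in> Sym"
  shows "spd_dist (mexp V) (mat 1) = norm V"
proof (rule antisym)
  show "spd_dist (mexp V) (mat 1) \<le> norm V"
    using spd_dist_le_length[OF mexp_path(1)[OF V]] mexp_path(2)[OF V] by simp
  have "mlog (mat 1 :: real^'n^'n) = 0"
    using mlog_mexp[OF subspace_0[OF subspace_Sym]] by simp
  moreover have "spd_paths (mexp V) (mat 1) \<noteq> {}" using mexp_path(1)[OF V] by blast
  ultimately show "norm V \<le> spd_dist (mexp V) (mat 1)"
    using spd_dist_ge_norm_mlog_diff[of "mexp V" "mat 1"] by (simp add: mlog_mexp[OF V])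
qed

lemma spd_dist_mexp_ge:
  fixes V W :: "real^'n^'n"
  assumes V: "V \<in> Sym" and W: "W \<in> Sym"
  shows "norm (V - W) \<le> spd_dist (mexp V) (mexp W)"
proof -
  \<comment> \<open>The congruence by \<open>e^(-R)\<close> moves \<open>e^W\<close> to the
    identity, where \<open>mexp_path\<close> supplies a path; moving it back shows that
    \<open>spd_paths\<close> is nonempty, so the infimum in the distance is meaningful.\<close>
  define R where "R = (1/2) *\<^sub>R W"
  have R: "R \<in> Sym" "- R \<in> Sym" using W by (auto simp: R_def intro!: subspace_scale subspace_neg subspace_Sym)
  define U where "U = mlog (mexp (- R) ** mexp V ** mexp (- R))"
  have U: "mexp U = mexp (- R) ** mexp V ** mexp (- R)" "U \<in> Sym"
    unfolding U_def by (intro mexp_mlog congruence_mexp_SPD mexp_SPD V R)+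
  have "(\<lambda>t. mexp R ** mexp ((1 - t) *\<^sub>R U) ** mexp R) \<in>
      spd_paths (mexp R ** mexp U ** mexp R) (mexp R ** mat 1 ** mexp R)"
    by (rule spd_paths_congruence[OF mexp_path(1)[OF U(2)] R(1)])
  then have "spd_paths (mexp V) (mexp W) \<noteq> {}"
    using mexp_half[of W] by (auto simp: U(1) R_def matrix_mul_assoc)
  from spd_dist_ge_norm_mlog_diff[OF this] show ?thesis
    by (simp add: mlog_mexp V W norm_minus_commute)
qed

section \<open>Symmetry of the exponential of a Lie triple system\<close>

lemma linear_gexp: "linear (gexp Z)"
  unfolding gexp_def
  using linear_compose[OF linear_dexp bounded_linear.linear[OF bounded_linear_congruence]]
  by (simp add: o_def)

lemma lie_triple_subspace: "lie_triple E \<Longrightarrow> subspace E"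
  and lie_triple_Sym: "lie_triple E \<Longrightarrow> X \<in> E \<Longrightarrow> X \<in> Sym"
  by (auto simp: lie_triple_def)

text \<open>Since \<open>SPD\<close> is the exponential of \<open>Sym\<close>, this makes
  \<open>SPD\<close> itself an instance of the results on \<open>exp E\<close>, in particular of the
  characterization of geodesics.\<close>

lemma lie_triple_Sym_all: "lie_triple (Sym :: (real^'n^'n) set)"
proof -
  have tr: "transpose (mbracket X Y) = mbracket (transpose Y) (transpose X)" for X Y :: "real^'n^'n"
    by (simp add: mbracket_def transpose_diff matrix_transpose_mul)
  have "mbracket (mbracket Y X) X = mbracket X (mbracket X Y)" for X Y :: "real^'n^'n"
    by (simp add: mbracket_def mm.diff_left mm.diff_right matrix_mul_assoc)
  then show ?thesis
    by (auto simp: lie_triple_def subspace_Sym Sym_iff tr)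
qed

lemma norm_mexp_le:
  fixes A :: "real^'n^'n"
  assumes "norm A \<le> R"
  shows "norm (mexp A) \<le> norm (mat 1 :: real^'n^'n) * (1 + exp (R + 1) * R)"
proof -
  have R: "0 \<le> R" using assms norm_ge_zero[of A] by linarith
  have "norm (mexp A - mat 1) \<le> norm (mat 1 :: real^'n^'n) * exp (R + 1) * norm A"
    using mexp_lipschitz[OF assms, of 0] R by simp
  also have "\<dots> \<le> norm (mat 1 :: real^'n^'n) * exp (R + 1) * R"
    using assms by (intro mult_left_mono) auto
  finally show ?thesis
    using norm_triangle_sub[of "mexp A" "mat 1"] by (simp add: algebra_simps)
qed

text \<open>The curve \<open>z = log (e\<^bsup>tX\<^esup> e\<^bsup>Y\<^esup> e\<^bsup>tX\<^esup>)\<close> solves \<open>gexp z z' = 2 cosh (ad z / 2) X\<close>, a differential equation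
  which is tangent to \<open>E\<close> along \<open>E\<close>. By a Gronwall estimate its component orthogonal to \<open>E\<close>
  vanishes.\<close>

lemma mexp_lie_triple_congruence:
  fixes X Y :: "real^'n^'n"
  assumes E: "lie_triple E" and X: "X \<in> E" and Y: "Y \<in> E"
  shows "mexp X ** mexp Y ** mexp X \<in> mexp ` E"
proof -
  note sub = lie_triple_subspace[OF E] and sym = lie_triple_Sym[OF E]
  let ?k = "norm (mat 1 :: real^'n^'n)"
  define w where "w t = mexp (t *\<^sub>R X) ** mexp Y ** mexp (t *\<^sub>R X)" for t
  have w_SPD: "w t \<in> SPD" for t
    unfolding w_def using X Y by (intro congruence_mexp_SPD mexp_SPD sym subspace_scale[OF sub])
  have w': "(w has_vector_derivative X ** w t + w t ** X) (at t)" for t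
  proof -
    have "X ** mexp (t *\<^sub>R X) = mexp (t *\<^sub>R X) ** X"
      by (rule mexp_commute) (simp add: mm.scaleR_left mm.scaleR_right)
    moreover have "(w has_vector_derivative
        (mexp (t *\<^sub>R X) ** mexp Y) ** (1 *\<^sub>R (X ** mexp (t *\<^sub>R X))) +
        (mexp (t *\<^sub>R X) ** 0 + 1 *\<^sub>R (X ** mexp (t *\<^sub>R X)) ** mexp Y) ** mexp (t *\<^sub>R X)) (at t)"
      unfolding w_def
      by (rule has_vector_derivative_matrix_mult[OF has_vector_derivative_matrix_mult[OF
            has_vector_derivative_mexp[OF DERIV_ident] has_vector_derivative_const] has_vector_derivative_mexp[OF DERIV_ident]])
    ultimately show ?thesis by (simp add: w_def matrix_mul_assoc mm.zero_right add.commute)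
  qed
  define z where "z = (\<lambda>t. mlog (w t))"
  have z: "mexp (z t) = w t" "z t \<in> Sym" for t
    unfolding z_def using mexp_mlog[OF w_SPD] by blast+
  have "\<exists>z'. (z has_vector_derivative z') (at t) \<and> z' \<in> Sym \<and> dexp (z t) z' = X ** w t + w t ** X" for t
    by (rule mlog_has_vector_derivative[OF w']) (use w_SPD in \<open>auto simp: z_def\<close>)
  then obtain z' where z': "\<And>t. (z has_vector_derivative z' t) (at t)" "\<And>t. z' t \<in> Sym"
    "\<And>t. dexp (z t) (z' t) = X ** w t + w t ** X"
    by metis
  have "compact (z ` {0..1})"
    by (intro compact_continuous_image continuous_at_imp_continuous_on ballI
        has_vector_derivative_continuous[OF z'(1)] compact_Icc)
  then have "bounded (z ` {0..1})" by (rule compact_imp_bounded)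
  then obtain R where R: "\<And>t. t \<in> {0..1} \<Longrightarrow> norm (z t) \<le> R"
    unfolding bounded_iff by blast
  have R0: "0 \<le> R" by (rule order_trans[OF norm_ge_zero R[of 0]]) simp
  define H where "H = ?k * (1 + exp (R + 1) * R)"
  have H0: "0 \<le> H" unfolding H_def using R0 by simp
  have H: "norm (mexp A) \<le> H" if "norm A \<le> R" for A :: "real^'n^'n"
    unfolding H_def by (rule norm_mexp_le[OF that])
  \<comment> \<open>\<open>B\<close> bounds \<open>z'\<close> through
    \<open>|z'| \<le> |gexp z z'|\<close>. \<open>K\<close> combines the Lipschitz constants of
    \<open>dexp\<close> and \<open>mexp\<close> on the ball of radius \<open>R\<close>; the outer
    factors \<open>H\<close> bound the two factors \<open>e^(-W/2)\<close> of
    \<open>gexp\<close>.\<close>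
  define B where "B = H * (2 * norm X * H) * H"
  define K where "K = H * (?k * B * exp (R + 2) + 2 * norm X * (?k * exp (R + 1))) * H"
  define p where "p t = z t - oproj E (z t)" for t
  define q where "q t = z' t - oproj E (z' t)" for t
  have p': "(p has_vector_derivative q t) (at t)" for t
    unfolding p_def q_def
    by (intro has_vector_derivative_diff z' bounded_linear.has_vector_derivative[OF bounded_linear_oproj])
  have conj_le: "norm (P ** A ** P) \<le> H * a * H" if "norm P \<le> H" "norm A \<le> a" for P A :: "real^'n^'n" and a
  proof -
    have "norm (P ** A ** P) \<le> norm P * norm A * norm P"
      by (intro order_trans[OF norm_matrix_mult_le] mult_right_mono norm_matrix_mult_le norm_ge_zero)
    also have "\<dots> \<le> H * a * H"
      using that H0 order_trans[OF norm_ge_zero that(2)] by (intro mult_mono) auto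
    finally show ?thesis .
  qed
  have q_le: "norm (q t) \<le> K * norm (p t)" if t: "t \<in> {0..1}" for t
  proof -
    define Z where "Z = z t"
    define A where "A = z' t"
    \<comment> \<open>The differential equation is compared with itself at \<open>W\<close>, a point
      of \<open>E\<close> at distance \<open>norm (p t)\<close> from \<open>Z\<close>: there
      \<open>gexp W\<close> and \<open>2 cosh (ad W / 2)\<close> preserve \<open>E\<close>, so
      pairing with \<open>q t\<close> removes their contributions.\<close>
    define W where "W = oproj E Z"
    have Z: "Z \<in> Sym" "norm Z \<le> R" using z R[OF t] by (auto simp: Z_def)
    have W: "W \<in> E" "norm W \<le> R"
      using oproj_in[OF sub] norm_oproj_le[OF sub, of Z] Z by (auto simp: W_def)
    have half: "norm (- ((1/2) *\<^sub>R V)) \<le> R" if "norm V \<le> R" for V :: "real^'n^'n"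
      using that R0 by simp
    have dZ: "dexp Z A = X ** mexp Z + mexp Z ** X"
      using z'(3) z(1) by (simp add: Z_def A_def)
    have "norm A \<le> norm (gexp Z A)"
      unfolding A_def by (rule norm_gexp_ge[OF Z(1) z'(2)])
    also have "\<dots> \<le> B"
      unfolding gexp_def B_def dZ
    proof (rule conj_le[OF H[OF half[OF Z(2)]]])
      have "norm (X ** mexp Z + mexp Z ** X) \<le> norm X * norm (mexp Z) + norm (mexp Z) * norm X"
        by (intro norm_triangle_le add_mono norm_matrix_mult_le)
      also have "\<dots> = 2 * norm X * norm (mexp Z)" by simp
      also have "\<dots> \<le> 2 * norm X * H" using H[OF Z(2)] by (intro mult_left_mono) auto
      finally show "norm (X ** mexp Z + mexp Z ** X) \<le> 2 * norm X * H" .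
    qed
    finally have A: "norm A \<le> B" .
    let ?h = "mexp (- ((1/2) *\<^sub>R W))"
    have orth: "q t \<bullet> V = 0" if "V \<in> E" for V
      unfolding q_def by (rule oproj_orth[OF sub that])
    have qSym: "q t \<in> Sym"
      unfolding q_def by (intro subspace_diff[OF subspace_Sym] z' sym[OF oproj_in[OF sub]])
    have "A = q t + oproj E A" by (simp add: q_def A_def)
    then have "gexp W A = gexp W (q t) + gexp W (oproj E A)"
      using linear_add[OF linear_gexp, of W "q t" "oproj E A"] by simp
    then have 1: "(norm (q t))\<^sup>2 \<le> q t \<bullet> gexp W A"
      using inner_gexp_ge[OF sym[OF W(1)] qSym] orth[OF gexp_in_lie_triple[OF E W(1) oproj_in[OF sub]], of A]
      by (simp add: inner_add_right)
    \<comment> \<open>The error made in the differential equation when \<open>Z\<close> is replaced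
      by \<open>W\<close>; its norm is at most a constant times \<open>norm (p t)\<close>.\<close>
    define D where "D = (dexp W A - dexp Z A) + (X ** (mexp Z - mexp W) + (mexp Z - mexp W) ** X)"
    have "?h ** (X ** mexp W + mexp W ** X) ** ?h = conjexp W X (1/2) + conjexp W X (- (1/2))"
    proof -
      have "mexp W = mexp ((1/2) *\<^sub>R W) ** mexp ((1/2) *\<^sub>R W)" by (simp add: mexp_half)
      then show ?thesis
        by (simp add: conjexp_def mm.add_left mm.add_right matrix_mul_assoc add.commute)
    qed
    also have "\<dots> \<in> E" by (rule conjexp_even_in_lie_triple[OF E W(1) X])
    finally have inE: "?h ** (X ** mexp W + mexp W ** X) ** ?h \<in> E" .
    have "dexp W A = D + (X ** mexp W + mexp W ** X)"
      by (simp add: D_def dZ mm.diff_left mm.diff_right)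
    then have "gexp W A = ?h ** D ** ?h + ?h ** (X ** mexp W + mexp W ** X) ** ?h"
      unfolding gexp_def by (simp only: mm.add_left mm.add_right)
    then have "q t \<bullet> gexp W A = q t \<bullet> (?h ** D ** ?h)"
      using orth[OF inE] by (simp add: inner_add_right)
    also have "\<dots> \<le> norm (q t) * norm (?h ** D ** ?h)" by (rule norm_cauchy_schwarz)
    finally have 2: "q t \<bullet> gexp W A \<le> norm (q t) * norm (?h ** D ** ?h)" .
    have "norm (?h ** D ** ?h) \<le> H * ((?k * B * exp (R + 2) + 2 * norm X * (?k * exp (R + 1))) * norm (p t)) * H"
    proof (rule conj_le[OF H[OF half[OF W(2)]]])
      have ZW: "norm (Z - W) = norm (p t)" "norm (W - Z) = norm (p t)"
        by (simp_all add: p_def W_def Z_def norm_minus_commute)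
      have "norm (dexp W A - dexp Z A) \<le> ?k * norm A * exp (R + 2) * norm (p t)"
        using dexp_lipschitz[OF W(2) Z(2), of A] by (simp add: ZW)
      also have "\<dots> \<le> ?k * B * exp (R + 2) * norm (p t)"
        using A by (intro mult_right_mono mult_left_mono) auto
      finally have d1: "norm (dexp W A - dexp Z A) \<le> ?k * B * exp (R + 2) * norm (p t)" .
      have "norm (X ** (mexp Z - mexp W) + (mexp Z - mexp W) ** X) \<le>
          norm X * norm (mexp Z - mexp W) + norm (mexp Z - mexp W) * norm X"
        by (intro norm_triangle_le add_mono norm_matrix_mult_le)
      also have "\<dots> = 2 * norm X * norm (mexp Z - mexp W)" by simp
      also have "\<dots> \<le> 2 * norm X * (?k * exp (R + 1) * norm (p t))"
        using mexp_lipschitz[OF Z(2) W(2)] by (intro mult_left_mono) (auto simp: ZW)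
      finally have d2: "norm (X ** (mexp Z - mexp W) + (mexp Z - mexp W) ** X) \<le>
          2 * norm X * (?k * exp (R + 1) * norm (p t))" .
      have "norm D \<le> ?k * B * exp (R + 2) * norm (p t) + 2 * norm X * (?k * exp (R + 1) * norm (p t))"
        unfolding D_def by (rule norm_triangle_le[OF add_mono[OF d1 d2]])
      then show "norm D \<le> (?k * B * exp (R + 2) + 2 * norm X * (?k * exp (R + 1))) * norm (p t)"
        by (simp add: algebra_simps)
    qed
    also have "\<dots> = K * norm (p t)" by (simp add: K_def)
    finally have "norm (q t) * norm (?h ** D ** ?h) \<le> norm (q t) * (K * norm (p t))"
      by (rule mult_left_mono) simp
    with 1 2 have "(norm (q t))\<^sup>2 \<le> norm (q t) * (K * norm (p t))" by linarith
    moreover have "0 \<le> K * norm (p t)"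
    proof -
      have "0 \<le> B" using A norm_ge_zero[of A] by linarith
      then show ?thesis using H0 by (auto simp: K_def)
    qed
    ultimately show ?thesis
      by (cases "q t = 0") (auto simp: power2_eq_square)
  qed
  have f': "((\<lambda>t. p t \<bullet> p t) has_real_derivative 2 * (p t \<bullet> q t)) (at t)" for t
    using bounded_bilinear.has_vector_derivative[OF bounded_bilinear_inner p' p', of t]
    by (simp add: has_real_derivative_iff_has_vector_derivative inner_commute)
  have "p 1 \<bullet> p 1 = 0"
  proof (rule gronwall_zero[where f = "\<lambda>t. p t \<bullet> p t" and K = "2 * K"])
    show "continuous_on {0..1} (\<lambda>t. p t \<bullet> p t)"
      by (intro continuous_at_imp_continuous_on ballI DERIV_isCont[OF f'])
    have "z 0 = Y" using mlog_mexp[OF sym[OF Y]] by (simp add: z_def w_def)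
    then show "p 0 \<bullet> p 0 = 0" using oproj_ident[OF sub Y] by (simp add: p_def)
    show "\<exists>d. ((\<lambda>t. p t \<bullet> p t) has_real_derivative d) (at t) \<and> d \<le> 2 * K * (p t \<bullet> p t)"
      if "0 < t" "t < 1" for t
    proof -
      have "p t \<bullet> q t \<le> norm (p t) * (K * norm (p t))"
        using that by (intro order_trans[OF norm_cauchy_schwarz] mult_left_mono q_le) auto
      then have "2 * (p t \<bullet> q t) \<le> 2 * K * (p t \<bullet> p t)"
        by (simp add: dot_square_norm power2_eq_square ac_simps)
      with f' show ?thesis by blast
    qed
  qed simp
  then have "z 1 = oproj E (z 1)" by (simp add: p_def)
  then have "z 1 \<in> E" using oproj_in[OF sub, of "z 1"] by simp
  moreover have "mexp (z 1) = mexp X ** mexp Y ** mexp X" by (simp add: z(1)) (simp add: w_def)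
  ultimately show ?thesis by (metis imageI)
qed

section \<open>Geodesics\<close>

lemma mexp_image_SPD: "lie_triple E \<Longrightarrow> mexp ` E \<subseteq> SPD"
  using lie_triple_Sym mexp_SPD by blast

lemma mlog_in_lie_triple: "lie_triple E \<Longrightarrow> p \<in> mexp ` E \<Longrightarrow> mlog p \<in> E"
  using mlog_mexp[OF lie_triple_Sym[of E]] by auto

text \<open>One global chart suffices: the exponential on the model space \<open>E\<close> itself,
  with inverse \<open>mlog\<close>; it is an immersion because \<open>dexp\<close> is injective on
  \<open>Sym\<close>.\<close>

lemma embedded_submanifold_mexp_image:
  assumes E: "lie_triple E"
  shows "embedded_submanifold (mexp ` E)"
proof -
  have hom: "homeomorphism (UNIV \<inter> E) (mexp ` E \<inter> UNIV) mexp mlog"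
    by (rule homeomorphismI)
      (auto simp: mlog_mexp[OF lie_triple_Sym[OF E]] intro!: continuous_intros
        continuous_on_subset[OF continuous_on_mlog mexp_image_SPD[OF E]])
  have "frechet_derivative mexp (at u) v = 0 \<longrightarrow> v = 0" if "u \<in> UNIV \<inter> E" "v \<in> E" for u v
    using that dexp_eq_zero_iff[OF lie_triple_Sym[OF E] lie_triple_Sym[OF E]]
    by (simp add: frechet_derivative_mexp)
  with hom show ?thesis
    unfolding embedded_submanifold_def
    by (intro exI[of _ E] conjI ballI exI[of _ UNIV] exI[of _ mexp] exI[of _ mlog])
      (auto simp: lie_triple_subspace[OF E] smooth_on_mexp)
qed

text \<open>The witness \<open>e^Y e^(tX) e^Y\<close> stays in \<open>exp E\<close> because
  congruences by \<open>E\<close> preserve \<open>exp E\<close>.\<close>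

lemma tangent_vectors_mexp_image:
  assumes E: "lie_triple E" and Y: "Y \<in> E" and X: "X \<in> E"
  shows "mexp Y ** X ** mexp Y \<in> tangent_vectors (mexp ` E) (mexp Y ** mexp Y)"
proof -
  note sub = lie_triple_subspace[OF E]
  let ?c = "\<lambda>t. mexp Y ** mexp (t *\<^sub>R X) ** mexp Y"
  have der: "(?c has_vector_derivative mexp Y ** (X ** mexp (t *\<^sub>R X)) ** mexp Y) (at t)" for t
    using bounded_linear.has_vector_derivative[OF bounded_linear_congruence
        has_vector_derivative_mexp[OF DERIV_ident]] by simp
  have "?c C1_differentiable_on {-1<..<1}"
    unfolding C1_differentiable_on_def using der
    by (intro exI[of _ "\<lambda>t. mexp Y ** (X ** mexp (t *\<^sub>R X)) ** mexp Y"]) (auto intro!: continuous_intros)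
  moreover have "?c t \<in> mexp ` E" for t
    by (rule mexp_lie_triple_congruence[OF E Y subspace_scale[OF sub X]])
  moreover have "(?c has_vector_derivative mexp Y ** X ** mexp Y) (at 0)"
    using der[of 0] by simp
  ultimately show ?thesis
    unfolding tangent_vectors_def by (intro CollectI exI[of _ ?c] exI[of _ 1]) auto
qed

section \<open>The Euler-Lagrange equation of the affine-invariant metric\<close>

lemma at_within_Icc_nontrivial:
  fixes a b t :: real
  assumes "a < b" "t \<in> {a..b}"
  shows "at t within {a..b} \<noteq> bot"
  using assms by (simp add: trivial_limit_within islimpt_Icc)

lemma has_vector_derivative_matrix_inv:
  fixes c :: "real \<Rightarrow> real^'n^'n"
  assumes "(c has_vector_derivative c') (at t within S)" and "invertible (c t)"
  shows "((\<lambda>s. matrix_inv (c s)) has_vector_derivative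
    - (matrix_inv (c t) ** c' ** matrix_inv (c t))) (at t within S)"
  using vector_derivative_diff_chain_within[OF assms(1)
      has_derivative_at_withinI[OF has_derivative_matrix_inv[OF assms(2)]]]
  by (simp add: o_def)

lemma bounded_linear_trace: "bounded_linear (trace :: real^'n^'n \<Rightarrow> real)"
  by (intro linear_conv_bounded_linear[THEN iffD1] linearI) (simp_all add: trace_def sum.distrib sum_distrib_left)

lemma trace_minus: "trace (- A) = - trace (A::real^'n^'n)"
  by (rule linear_neg[OF bounded_linear.linear[OF bounded_linear_trace]])

lemma frechet_derivative_spd_metric:
  fixes p V Z :: "real^'n^'n"
  assumes p: "invertible p"
  shows "frechet_derivative (\<lambda>p. spd_metric p V V) (at p) Z =
    - 2 * spd_metric p (V ** matrix_inv p ** V) Z"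
proof -
  let ?i = "matrix_inv p"
  have inv: "((\<lambda>q. matrix_inv q ** V) has_derivative (\<lambda>H. - (?i ** H ** ?i) ** V)) (at p)"
    by (rule bounded_linear.has_derivative[OF mm.bounded_linear_left has_derivative_matrix_inv[OF p]])
  have "((\<lambda>q. trace ((matrix_inv q ** V) ** (matrix_inv q ** V))) has_derivative
      (\<lambda>H. trace ((?i ** V) ** (- (?i ** H ** ?i) ** V) + (- (?i ** H ** ?i) ** V) ** (?i ** V)))) (at p)"
    by (rule bounded_linear.has_derivative[OF bounded_linear_trace mm.FDERIV[OF inv inv]])
  then have d: "((\<lambda>q. spd_metric q V V) has_derivative
      (\<lambda>H. trace ((?i ** V) ** (- (?i ** H ** ?i) ** V) + (- (?i ** H ** ?i) ** V) ** (?i ** V)))) (at p)"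
    by (simp add: spd_metric_def matrix_mul_assoc)
  have "frechet_derivative (\<lambda>p. spd_metric p V V) (at p) Z =
      trace ((?i ** V) ** (- (?i ** Z ** ?i) ** V) + (- (?i ** Z ** ?i) ** V) ** (?i ** V))"
    by (simp only: frechet_derivative_at[OF d, symmetric])
  also have "\<dots> = - trace ((?i ** V ** ?i ** Z) ** (?i ** V)) - trace ((?i ** Z) ** (?i ** V ** ?i ** V))"
    by (simp add: trace_sub trace_minus mm.minus_left mm.minus_right matrix_mul_assoc)
  also have "\<dots> = - 2 * spd_metric p (V ** ?i ** V) Z"
    by (subst trace_mul_sym, subst (2) trace_mul_sym) (simp add: spd_metric_def matrix_mul_assoc)
  finally show ?thesis .
qed

lemma has_real_derivative_spd_metric:
  fixes c v :: "real \<Rightarrow> real^'n^'n" and Z :: "real^'n^'n"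
  assumes c: "(c has_vector_derivative v t) (at t within S)" and v: "(v has_vector_derivative v') (at t within S)"
    and inv: "invertible (c t)"
  defines "W \<equiv> v t ** matrix_inv (c t) ** v t"
  shows "((\<lambda>s. spd_metric (c s) (v s) Z) has_real_derivative
    spd_metric (c t) (v' - W) Z - spd_metric (c t) W Z) (at t within S)"
proof -
  let ?i = "matrix_inv (c t)"
  note di = has_vector_derivative_matrix_inv[OF c inv]
  have "((\<lambda>s. trace (matrix_inv (c s) ** v s ** matrix_inv (c s) ** Z)) has_vector_derivative
     trace ((?i ** v t ** ?i) ** 0 + ((?i ** v t) ** (- (?i ** v t ** ?i)) + (?i ** v' + (- (?i ** v t ** ?i)) ** v t) ** ?i) ** Z))
     (at t within S)"
    by (rule bounded_linear.has_vector_derivative[OF bounded_linear_trace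
          has_vector_derivative_matrix_mult[OF has_vector_derivative_matrix_mult[OF
          has_vector_derivative_matrix_mult[OF di v] di] has_vector_derivative_const]])
  moreover have "trace ((?i ** v t ** ?i) ** 0 + ((?i ** v t) ** (- (?i ** v t ** ?i)) + (?i ** v' + (- (?i ** v t ** ?i)) ** v t) ** ?i) ** Z) =
      spd_metric (c t) (v' - W) Z - spd_metric (c t) W Z"
    unfolding spd_metric_def W_def mm.zero_right mm.minus_left mm.minus_right mm.add_left
      mm.diff_left mm.diff_right matrix_mul_assoc trace_add trace_sub trace_minus
    by (simp add: trace_0[simplified mat_0])
  ultimately show ?thesis
    by (simp add: has_real_derivative_iff_has_vector_derivative spd_metric_def)
qed

lemma differentiable_on_imp_velocity:
  fixes c :: "real \<Rightarrow> 'a::real_normed_vector"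
  assumes "c differentiable_on S" "t \<in> S"
  shows "(c has_vector_derivative velocity S c t) (at t within S)"
  using assms unfolding velocity_def differentiable_on_def
  by (intro vector_derivative_works[THEN iffD1]) blast

text \<open>Both sides of Koszul's formula contain the term \<open>- spd_metric (c t) ?W Z\<close>,
  one from differentiating the inverses along the curve, the other from half the derivative of the
  metric. It cancels, and uniqueness of derivatives within a nondegenerate interval turns the
  differentiability statement into an equation.\<close>

lemma euler_lagrange_iff:
  fixes c :: "real \<Rightarrow> real^'n^'n"
  assumes ab: "a < b" and t: "t \<in> {a..b}" and inv: "invertible (c t)"
    and diff: "c differentiable_on {a..b}" "velocity {a..b} c differentiable_on {a..b}"
  defines "v \<equiv> velocity {a..b} c"
  shows "((\<lambda>s. spd_metric (c s) (v s) Z) has_real_derivative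
       (1/2) * frechet_derivative (\<lambda>p. spd_metric p (v t) (v t)) (at (c t)) Z) (at t within {a..b}) \<longleftrightarrow>
    spd_metric (c t) (velocity {a..b} v t - v t ** matrix_inv (c t) ** v t) Z = 0"
proof -
  let ?W = "v t ** matrix_inv (c t) ** v t"
  have d: "((\<lambda>s. spd_metric (c s) (v s) Z) has_real_derivative
      spd_metric (c t) (velocity {a..b} v t - ?W) Z - spd_metric (c t) ?W Z) (at t within {a..b})"
    using diff t inv unfolding v_def
    by (intro has_real_derivative_spd_metric differentiable_on_imp_velocity)
  have "((\<lambda>s. spd_metric (c s) (v s) Z) has_real_derivative y) (at t within {a..b}) \<longleftrightarrow>
      y = spd_metric (c t) (velocity {a..b} v t - ?W) Z - spd_metric (c t) ?W Z" for y
    using d vector_derivative_unique_within[OF at_within_Icc_nontrivial[OF ab t]]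
    unfolding has_real_derivative_iff_has_vector_derivative by blast
  then show ?thesis
    unfolding frechet_derivative_spd_metric[OF inv] by auto
qed

text \<open>With \<open>z = log c\<close>, the velocity moved to the identity is
  \<open>gexp z z'\<close>. As \<open>z\<close> runs in \<open>E\<close>, so does \<open>z'\<close>,
  and \<open>gexp z\<close> preserves \<open>E\<close>.\<close>

lemma gexp_transport_in_lie_triple:
  assumes E: "lie_triple E" and c: "(c has_vector_derivative v) (at t within S)"
    and S: "at t within S \<noteq> bot" and M: "c ` S \<subseteq> mexp ` E" and t: "t \<in> S"
  shows "mexp (- ((1/2) *\<^sub>R mlog (c t))) ** v ** mexp (- ((1/2) *\<^sub>R mlog (c t))) \<in> E"
proof -
  have SPD: "c ` S \<subseteq> SPD" using M mexp_image_SPD[OF E] by blast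
  have mem: "mlog (c s) \<in> E" if "s \<in> S" for s
    using M that by (intro mlog_in_lie_triple[OF E]) blast
  obtain z' where z': "((\<lambda>t. mlog (c t)) has_vector_derivative z') (at t within S)"
    "dexp (mlog (c t)) z' = v"
    by (rule mlog_has_vector_derivative[OF c S SPD t])
  have "z' \<in> E"
    by (rule has_vector_derivative_in_subspace[OF lie_triple_subspace[OF E] z'(1) S mem t])
  then have "gexp (mlog (c t)) z' \<in> E"
    by (rule gexp_in_lie_triple[OF E mem[OF t]])
  then show ?thesis by (simp add: gexp_def z'(2))
qed

text \<open>After moving \<open>c t\<close> to the identity, \<open>c'' - c' c\<^sup>-\<^sup>1 c'\<close> is the derivative at \<open>t\<close> of
  \<open>e\<^bsup>-z/2\<^esup> c' e\<^bsup>-z/2\<^esup>\<close>, \<open>z = log c\<close>, which is a curve in \<open>E\<close>. Hence it is tangent to \<open>exp E\<close>.\<close>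

lemma acceleration_in_lie_triple:
  fixes c :: "real \<Rightarrow> real^'n^'n"
  assumes E: "lie_triple E" and c: "\<And>s. s \<in> S \<Longrightarrow> (c has_vector_derivative v s) (at s within S)"
    and v: "(v has_vector_derivative v') (at t within S)"
    and S: "\<And>s. s \<in> S \<Longrightarrow> at s within S \<noteq> bot" and M: "c ` S \<subseteq> mexp ` E" and t: "t \<in> S"
  defines "h \<equiv> mexp (- ((1/2) *\<^sub>R mlog (c t)))"
  shows "h ** (v' - v t ** matrix_inv (c t) ** v t) ** h \<in> E"
proof -
  note sub = lie_triple_subspace[OF E]
  have ct: "mlog (c t) \<in> E" "mexp (mlog (c t)) = c t"
    using M t mexp_image_SPD[OF E] by (auto intro!: mlog_in_lie_triple[OF E] mexp_mlog(1))
  have Y: "- ((1/2) *\<^sub>R mlog (c t)) \<in> E"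
    by (intro subspace_neg[OF sub] subspace_scale[OF sub] ct)
  have hh: "h ** h = matrix_inv (c t)"
    using mexp_half[of "- mlog (c t)"] matrix_inv_mexp[of "mlog (c t)"] by (simp add: h_def ct(2))
  \<comment> \<open>This congruence keeps the curve in \<open>exp E\<close> and puts
    \<open>w t\<close> at the identity, where the logarithm vanishes and \<open>dexp 0\<close> is
    the identity map.\<close>
  define w where "w = (\<lambda>s. h ** c s ** h)"
  have w: "(w has_vector_derivative h ** v s ** h) (at s within S)" if "s \<in> S" for s
    unfolding w_def by (rule bounded_linear.has_vector_derivative[OF bounded_linear_congruence c[OF that]])
  have wM: "w ` S \<subseteq> mexp ` E"
  proof (rule image_subsetI)
    fix s assume "s \<in> S"
    then obtain X where "X \<in> E" "c s = mexp X" using M by blast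
    then show "w s \<in> mexp ` E"
      unfolding w_def h_def using mexp_lie_triple_congruence[OF E Y] by simp
  qed
  have w_SPD: "w ` S \<subseteq> SPD" using wM mexp_image_SPD[OF E] by blast
  have "w t = mexp (- ((1/2) *\<^sub>R mlog (c t))) ** mexp (mlog (c t)) ** mexp (- ((1/2) *\<^sub>R mlog (c t)))"
    unfolding w_def h_def ct(2) ..
  also have "\<dots> = (mexp (- ((1/2) *\<^sub>R mlog (c t))) ** mexp ((1/2) *\<^sub>R mlog (c t))) **
      (mexp ((1/2) *\<^sub>R mlog (c t)) ** mexp (- ((1/2) *\<^sub>R mlog (c t))))"
    by (subst mexp_half[of "mlog (c t)", symmetric]) (simp only: matrix_mul_assoc)
  also have "\<dots> = mat 1" by (simp only: mexp_minus_left mexp_minus_right matrix_mul_lid)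
  finally have "mlog (w t) = 0"
    using mlog_mexp[OF subspace_0[OF subspace_Sym]] by simp
  define z where "z = (\<lambda>s. mlog (w s))"
  have z0: "z t = 0" using \<open>mlog (w t) = 0\<close> by (simp add: z_def)
  obtain z' where z': "(z has_vector_derivative z') (at t within S)" "dexp (z t) z' = h ** v t ** h"
    unfolding z_def by (rule mlog_has_vector_derivative[OF w[OF t] S[OF t] w_SPD t])
  then have z'_eq: "z' = h ** v t ** h" by (simp add: z0 dexp_zero)
  let ?H = "\<lambda>s. mexp (- ((1/2) *\<^sub>R z s))"
  have "((\<lambda>s. - ((1/2) *\<^sub>R z s)) has_vector_derivative - ((1/2) *\<^sub>R z')) (at t within S)"
    by (intro has_vector_derivative_minus bounded_linear.has_vector_derivative[OF bounded_linear_scaleR_right z'(1)])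
  from has_vector_derivative_mexp_compose[OF this]
  have H: "(?H has_vector_derivative - ((1/2) *\<^sub>R z')) (at t within S)"
    by (simp add: z0 dexp_zero)
  have V: "((\<lambda>s. h ** v s ** h) has_vector_derivative h ** v' ** h) (at t within S)"
    by (rule bounded_linear.has_vector_derivative[OF bounded_linear_congruence v])
  have "((\<lambda>s. ?H s ** (h ** v s ** h) ** ?H s) has_vector_derivative
      (?H t ** (h ** v t ** h)) ** (- ((1/2) *\<^sub>R z')) +
      (?H t ** (h ** v' ** h) + (- ((1/2) *\<^sub>R z')) ** (h ** v t ** h)) ** ?H t) (at t within S)"
    by (rule has_vector_derivative_matrix_mult[OF has_vector_derivative_matrix_mult[OF H V] H])
  moreover have "?H s ** (h ** v s ** h) ** ?H s \<in> E" if "s \<in> S" for s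
    using gexp_transport_in_lie_triple[OF E w[OF that] S[OF that] wM that] by (simp add: z_def)
  ultimately have "(?H t ** (h ** v t ** h)) ** (- ((1/2) *\<^sub>R z')) +
      (?H t ** (h ** v' ** h) + (- ((1/2) *\<^sub>R z')) ** (h ** v t ** h)) ** ?H t \<in> E"
    by (rule has_vector_derivative_in_subspace[OF sub _ S[OF t] _ t])
  moreover have "(?H t ** (h ** v t ** h)) ** (- ((1/2) *\<^sub>R z')) +
      (?H t ** (h ** v' ** h) + (- ((1/2) *\<^sub>R z')) ** (h ** v t ** h)) ** ?H t =
      h ** (v' - v t ** matrix_inv (c t) ** v t) ** h"
  proof -
    \<comment> \<open>At \<open>t\<close> one has \<open>?H t = mat 1\<close> and
      \<open>z' = h ** v t ** h\<close>, so each of the two derivatives of \<open>?H\<close>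
      contributes \<open>- Q/2\<close>. Since \<open>h ** h\<close> is the inverse of
      \<open>c t\<close>, the total \<open>- Q\<close> is the transported quadratic term.\<close>
    define Q where "Q = (h ** v t ** h) ** (h ** v t ** h)"
    have "Q = h ** (v t ** (h ** h) ** v t) ** h" by (simp add: Q_def matrix_mul_assoc)
    then have Q: "h ** (v t ** matrix_inv (c t) ** v t) ** h = Q" by (simp add: hh)
    have "(?H t ** (h ** v t ** h)) ** (- ((1/2) *\<^sub>R z')) = - ((1/2) *\<^sub>R Q)"
      by (simp only: z0 scaleR_zero_right minus_zero mexp_zero matrix_mul_lid mm.minus_right mm.scaleR_right z'_eq Q_def)
    moreover have "(?H t ** (h ** v' ** h) + (- ((1/2) *\<^sub>R z')) ** (h ** v t ** h)) ** ?H t = h ** v' ** h - (1/2) *\<^sub>R Q"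
      by (simp only: z0 scaleR_zero_right minus_zero mexp_zero matrix_mul_lid matrix_mul_rid mm.minus_left mm.scaleR_left
          z'_eq Q_def) simp
    moreover have "- ((1/2) *\<^sub>R Q) + (h ** v' ** h - (1/2) *\<^sub>R Q) = h ** v' ** h - (1/2) *\<^sub>R (Q + Q)"
      by (simp only: scaleR_add_right) simp
    ultimately show ?thesis
      by (simp only: scaleR_half_double mm.diff_left mm.diff_right Q)
  qed
  ultimately show ?thesis by simp
qed

definition geodesic_equation :: "real \<Rightarrow> real \<Rightarrow> (real \<Rightarrow> real^'n^'n) \<Rightarrow> bool" where
  "geodesic_equation a b c \<longleftrightarrow> (\<forall>t\<in>{a..b}. velocity {a..b} (velocity {a..b} c) t =
     velocity {a..b} c t ** matrix_inv (c t) ** velocity {a..b} c t)"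

text \<open>The covariant acceleration \<open>?A t\<close> computed in \<open>SPD\<close> is tangent
  to \<open>exp E\<close>, so the Euler-Lagrange condition may be tested on \<open>?A t\<close>
  itself and forces it to vanish. The resulting equation does not mention \<open>E\<close>;
  comparing the cases \<open>E\<close> and \<open>Sym\<close> shows that geodesics of
  \<open>exp E\<close> are geodesics of \<open>SPD\<close>.\<close>

lemma spd_geodesic_in_lie_triple_iff:
  assumes E: "lie_triple E"
  shows "spd_geodesic_in (mexp ` E) a b c \<longleftrightarrow> a < b \<and> c ` {a..b} \<subseteq> mexp ` E \<and>
    c differentiable_on {a..b} \<and> velocity {a..b} c differentiable_on {a..b} \<and> geodesic_equation a b c"
proof -
  have "(\<forall>t\<in>{a..b}. \<forall>Z\<in>tangent_vectors (mexp ` E) (c t).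
        ((\<lambda>s. spd_metric (c s) (velocity {a..b} c s) Z) has_real_derivative
           (1/2) * frechet_derivative
                     (\<lambda>p. spd_metric p (velocity {a..b} c t) (velocity {a..b} c t)) (at (c t)) Z)
        (at t within {a..b})) \<longleftrightarrow> geodesic_equation a b c"
    if ab: "a < b" and M: "c ` {a..b} \<subseteq> mexp ` E"
      and diff: "c differentiable_on {a..b}" "velocity {a..b} c differentiable_on {a..b}"
  proof -
    let ?v = "velocity {a..b} c"
    let ?A = "\<lambda>t. velocity {a..b} ?v t - ?v t ** matrix_inv (c t) ** ?v t"
    have SPD: "c t \<in> SPD" if "t \<in> {a..b}" for t
      using M mexp_image_SPD[OF E] that by blast
    have EL: "((\<lambda>s. spd_metric (c s) (?v s) Z) has_real_derivative
           (1/2) * frechet_derivative (\<lambda>p. spd_metric p (?v t) (?v t)) (at (c t)) Z)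
        (at t within {a..b}) \<longleftrightarrow> spd_metric (c t) (?A t) Z = 0" if "t \<in> {a..b}" for t Z
      by (rule euler_lagrange_iff[OF ab that invertible_SPD[OF SPD[OF that]] diff])
    have A0: "?A t = 0" if t: "t \<in> {a..b}"
      and geo: "\<forall>Z\<in>tangent_vectors (mexp ` E) (c t). spd_metric (c t) (?A t) Z = 0" for t
    proof -
      define Y where "Y = (1/2) *\<^sub>R mlog (c t)"
      have logE: "mlog (c t) \<in> E" and log: "mexp (mlog (c t)) = c t"
        using M t SPD[OF t] by (auto intro!: mlog_in_lie_triple[OF E] mexp_mlog(1))
      have Y: "Y \<in> E" unfolding Y_def by (rule subspace_scale[OF lie_triple_subspace[OF E] logE])
      define U where "U = mexp (- Y) ** ?A t ** mexp (- Y)"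
      have U: "U \<in> E"
        unfolding U_def Y_def
        by (rule acceleration_in_lie_triple[OF E _ _ _ M t])
          (auto intro!: differentiable_on_imp_velocity diff t at_within_Icc_nontrivial[OF ab])
      have A: "?A t = mexp Y ** U ** mexp Y"
        by (simp add: U_def matrix_mul_assoc)
      have "mexp Y ** mexp Y = c t" unfolding Y_def by (simp add: mexp_half log)
      then have "?A t \<in> tangent_vectors (mexp ` E) (c t)"
        using tangent_vectors_mexp_image[OF E Y U] by (simp add: A)
      with geo have "spd_metric (c t) (?A t) (?A t) = 0" by blast
      moreover have "?A t \<in> Sym"
        unfolding A using mexp_in_Sym[OF lie_triple_Sym[OF E Y]] lie_triple_Sym[OF E U]
        by (simp add: Sym_iff matrix_transpose_mul matrix_mul_assoc)
      ultimately have "U \<bullet> U = 0"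
        using spd_metric_mexp[OF lie_triple_Sym[OF E logE], of "?A t" "?A t"]
        by (simp only: log U_def Y_def)
      then show ?thesis using A by (simp add: mm.zero_left mm.zero_right)
    qed
    have 1: "geodesic_equation a b c"
      if "\<forall>t\<in>{a..b}. \<forall>Z\<in>tangent_vectors (mexp ` E) (c t). spd_metric (c t) (?A t) Z = 0"
      unfolding geodesic_equation_def
    proof
      fix t assume t: "t \<in> {a..b}"
      with that have "?A t = 0" by (intro A0) blast+
      then show "velocity {a..b} ?v t = ?v t ** matrix_inv (c t) ** ?v t" by simp
    qed
    have "spd_metric (c t) 0 Z = 0" for t Z
      by (simp add: spd_metric_def mm.zero_left mm.zero_right trace_def)
    then have 2: "spd_metric (c t) (?A t) Z = 0" if "geodesic_equation a b c" "t \<in> {a..b}" for t Z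
      using that by (simp add: geodesic_equation_def)
    show ?thesis (is "?L \<longleftrightarrow> _")
    proof
      assume ?L
      then show "geodesic_equation a b c" by (intro 1 ballI iffD1[OF EL]) auto
    next
      assume "geodesic_equation a b c"
      then show ?L by (intro ballI iffD2[OF EL] 2)
    qed
  qed
  then show ?thesis unfolding spd_geodesic_in_def by blast
qed

lemma totally_geodesic_mexp_image:
  assumes E: "lie_triple E"
  shows "totally_geodesic_submanifold (mexp ` E)"
  unfolding totally_geodesic_submanifold_def
proof (intro conjI allI impI)
  fix a b c assume "spd_geodesic_in (mexp ` E) a b c"
  then have "spd_geodesic_in (mexp ` Sym) a b c"
    unfolding spd_geodesic_in_lie_triple_iff[OF E] spd_geodesic_in_lie_triple_iff[OF lie_triple_Sym_all]
    using lie_triple_Sym[OF E] by blast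
  then show "spd_geodesic_in SPD a b c" by (simp add: mexp_image_Sym)
qed (intro mexp_image_SPD embedded_submanifold_mexp_image E)+

text \<open>Along a geodesic \<open>w^-1 w'\<close> is a first integral. With the end point moved to
  the identity its value is \<open>V\<close>, so \<open>w' = w V\<close> and
  \<open>w t = e^((t-1)V)\<close>. The end point is the base because the angle is measured at the
  foot of the projection.\<close>

lemma spd_geodesic_transported_start:
  fixes c :: "real \<Rightarrow> real^'n^'n"
  assumes geo: "spd_geodesic_in SPD 0 1 c" and Y: "Y \<in> Sym" and end1: "c 1 = mexp Y ** mexp Y"
  defines "V \<equiv> mexp (- Y) ** velocity {0..1} c 1 ** mexp (- Y)"
  shows "mexp (- Y) ** c 0 ** mexp (- Y) = mexp (- V)" "V \<in> Sym"
proof -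
  let ?v = "velocity {0..1} c" and ?h = "mexp (- Y)"
  have "spd_geodesic_in (mexp ` Sym) 0 1 c" using geo by (simp add: mexp_image_Sym)
  from this[unfolded spd_geodesic_in_lie_triple_iff[OF lie_triple_Sym_all]]
  have SPD: "c ` {0..1} \<subseteq> SPD" and diff: "c differentiable_on {0..1}" "?v differentiable_on {0..1}"
    and eq: "\<And>t. t \<in> {0..1} \<Longrightarrow> velocity {0..1} ?v t = ?v t ** matrix_inv (c t) ** ?v t"
    by (auto simp: mexp_image_Sym geodesic_equation_def)
  have hSym: "- Y \<in> Sym" by (rule subspace_neg[OF subspace_Sym Y])
  define w where "w = (\<lambda>t. ?h ** c t ** ?h)"
  define u where "u = (\<lambda>t. ?h ** ?v t ** ?h)"
  have inv: "invertible (c t)" "invertible (w t)" "w t \<in> SPD" if "t \<in> {0..1}" for t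
  proof -
    have ct: "c t \<in> SPD" using SPD that by blast
    then show "invertible (c t)" by (rule invertible_SPD)
    show "w t \<in> SPD" unfolding w_def by (rule congruence_mexp_SPD[OF ct hSym])
    then show "invertible (w t)" by (rule invertible_SPD)
  qed
  have w': "(w has_vector_derivative u t) (at t within {0..1})" if "t \<in> {0..1}" for t
    unfolding w_def u_def
    by (rule bounded_linear.has_vector_derivative[OF bounded_linear_congruence
          differentiable_on_imp_velocity[OF diff(1) that]])
  have u': "(u has_vector_derivative u t ** matrix_inv (w t) ** u t) (at t within {0..1})" if t: "t \<in> {0..1}" for t
  proof -
    have "(u has_vector_derivative ?h ** velocity {0..1} ?v t ** ?h) (at t within {0..1})"
      unfolding u_def
      by (rule bounded_linear.has_vector_derivative[OF bounded_linear_congruence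
            differentiable_on_imp_velocity[OF diff(2) t]])
    moreover have "?h ** velocity {0..1} ?v t ** ?h = u t ** matrix_inv (w t) ** u t"
      unfolding eq[OF t] u_def w_def matrix_inv_congruence[OF inv(1)[OF t]] minus_minus
      by (simp add: matrix_mul_assoc)
    ultimately show ?thesis by simp
  qed
  have w1: "w 1 = mat 1"
    by (simp add: w_def end1 matrix_mul_assoc)
  have V: "u 1 = V" by (simp add: u_def V_def)
  define K where "K = (\<lambda>t. matrix_inv (w t) ** u t)"
  have "(K has_vector_derivative 0) (at t within {0..1})" if t: "t \<in> {0..1}" for t
  proof -
    have "(K has_vector_derivative matrix_inv (w t) ** (u t ** matrix_inv (w t) ** u t) +
        (- (matrix_inv (w t) ** u t ** matrix_inv (w t))) ** u t) (at t within {0..1})"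
      unfolding K_def
      by (rule has_vector_derivative_matrix_mult[OF has_vector_derivative_matrix_inv[OF w'[OF t] inv(2)[OF t]] u'[OF t]])
    then show ?thesis by (simp add: mm.minus_left matrix_mul_assoc)
  qed
  then obtain k where "\<And>t. t \<in> {0..1} \<Longrightarrow> K t = k"
    using has_vector_derivative_zero_constant[OF convex_real_interval(5)] by blast
  moreover have "K 1 = V"
    using matrix_inv_mexp[of "0 :: real^'n^'n"] by (simp add: K_def w1 V)
  ultimately have KV: "K t = V" if "t \<in> {0..1}" for t using that by force
  have uV: "u t = w t ** V" if t: "t \<in> {0..1}" for t
    unfolding KV[OF t, symmetric] K_def matrix_mul_assoc matrix_inv_inverse[OF inv(2)[OF t]] by simp
  define g where "g = (\<lambda>t. w t ** mexp ((1 - t) *\<^sub>R V))"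
  have "(g has_vector_derivative 0) (at t within {0..1})" if t: "t \<in> {0..1}" for t
  proof -
    have 1: "((\<lambda>r. 1 - r) has_real_derivative (-1)) (at t within {0..1})"
      by (auto intro!: derivative_eq_intros)
    have "(g has_vector_derivative w t ** ((-1) *\<^sub>R (V ** mexp ((1 - t) *\<^sub>R V))) + u t ** mexp ((1 - t) *\<^sub>R V))
        (at t within {0..1})"
      unfolding g_def by (rule has_vector_derivative_matrix_mult[OF w'[OF t] has_vector_derivative_mexp[OF 1]])
    then show ?thesis by (simp add: uV[OF t] mm.minus_right matrix_mul_assoc)
  qed
  then obtain l where "\<And>t. t \<in> {0..1} \<Longrightarrow> g t = l"
    using has_vector_derivative_zero_constant[OF convex_real_interval(5)] by blast
  then have "g 0 = g 1" by simp
  then have "w 0 ** mexp V = mat 1" by (simp add: g_def w1)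
  then have "w 0 ** mexp V ** mexp (- V) = mexp (- V)" by simp
  then show "?h ** c 0 ** ?h = mexp (- V)" by (simp add: w_def)
  have "w t \<in> Sym" if "t \<in> {0..1}" for t using inv(3)[OF that] SPD_subset_Sym by blast
  then have "u 1 \<in> Sym"
    using w'[of 1] at_within_Icc_nontrivial[of 0 1 1]
    by (intro has_vector_derivative_in_subspace[OF subspace_Sym, of w "u 1" 1 "{0..1}"]) auto
  then show "V \<in> Sym" by (simp add: V)
qed

section \<open>The orthogonal projection\<close>

context
  fixes E :: "(real^'n^'n) set"
  assumes E: "lie_triple E"
begin

lemma norm_diff_orthogonal:
  assumes "\<forall>X\<in>E. V \<bullet> X = 0" "W \<in> E"
  shows "(norm (V - W))\<^sup>2 = (norm V)\<^sup>2 + (norm W)\<^sup>2"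
  using norm_add_Pythagorean[of V "- W"] assms by (simp add: orthogonal_def)

context
  fixes Y V :: "real^'n^'n"
  assumes Y: "Y \<in> E" and V: "V \<in> Sym" and orth: "\<forall>X\<in>E. V \<bullet> X = 0"
begin

lemma spd_dist_foot: "spd_dist (mexp Y ** mexp V ** mexp Y) (mexp Y ** mexp Y) = norm V"
  using spd_dist_congruence[OF lie_triple_Sym[OF E Y], of "mexp V" "mat 1"] spd_dist_mexp_one[OF V] by simp

text \<open>The congruence by \<open>e^(-Y)\<close> moves \<open>q\<close> to some
  \<open>e^W\<close> within \<open>exp E\<close>; then \<open>|V - W|\<close> bounds the distance
  from below and Pythagoras applies. The surplus \<open>|W|^2\<close> is kept because it yields
  uniqueness of the foot.\<close>

lemma spd_dist_ge_foot:
  assumes q: "q \<in> mexp ` E"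
  obtains W where "W \<in> E" "q = mexp Y ** mexp W ** mexp Y"
    "(norm V)\<^sup>2 + (norm W)\<^sup>2 \<le> (spd_dist (mexp Y ** mexp V ** mexp Y) q)\<^sup>2"
proof -
  obtain X where X: "X \<in> E" "q = mexp X" using q by blast
  have Y': "- Y \<in> E" by (rule subspace_neg[OF lie_triple_subspace[OF E] Y])
  from mexp_lie_triple_congruence[OF E Y' X(1)]
  obtain W where W: "W \<in> E" "mexp (- Y) ** mexp X ** mexp (- Y) = mexp W" by (rule imageE)
  have q: "q = mexp Y ** mexp W ** mexp Y" by (simp add: W(2)[symmetric] X(2) matrix_mul_assoc)
  have "spd_dist (mexp Y ** mexp V ** mexp Y) q = spd_dist (mexp V) (mexp W)"
    unfolding q by (rule spd_dist_congruence[OF lie_triple_Sym[OF E Y]])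
  then have "norm (V - W) \<le> spd_dist (mexp Y ** mexp V ** mexp Y) q"
    using spd_dist_mexp_ge[OF V lie_triple_Sym[OF E W(1)]] by simp
  then have "(norm (V - W))\<^sup>2 \<le> (spd_dist (mexp Y ** mexp V ** mexp Y) q)\<^sup>2"
    by (intro power_mono) auto
  with that[OF W(1) q] show ?thesis
    by (simp add: norm_diff_orthogonal[OF orth W(1)])
qed

lemma spd_dist_foot_le:
  assumes "q \<in> mexp ` E"
  shows "spd_dist (mexp Y ** mexp V ** mexp Y) (mexp Y ** mexp Y) \<le> spd_dist (mexp Y ** mexp V ** mexp Y) q"
proof -
  obtain W where W: "W \<in> E" "q = mexp Y ** mexp W ** mexp Y"
    "(norm V)\<^sup>2 + (norm W)\<^sup>2 \<le> (spd_dist (mexp Y ** mexp V ** mexp Y) q)\<^sup>2"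
    by (rule spd_dist_ge_foot[OF assms])
  have "spd_dist (mexp Y ** mexp V ** mexp Y) q = spd_dist (mexp V) (mexp W)"
    unfolding W(2) by (rule spd_dist_congruence[OF lie_triple_Sym[OF E Y]])
  also have "\<dots> \<ge> 0"
    using order_trans[OF norm_ge_zero spd_dist_mexp_ge[OF V lie_triple_Sym[OF E W(1)]]] .
  finally have "spd_dist (mexp Y ** mexp V ** mexp Y) q \<ge> 0" .
  moreover have "(norm V)\<^sup>2 \<le> (spd_dist (mexp Y ** mexp V ** mexp Y) q)\<^sup>2"
    using W(3) zero_le_power2[of "norm W"] by linarith
  ultimately show ?thesis unfolding spd_dist_foot by (rule power2_le_imp_le[rotated])
qed

text \<open>This gives properness of the decomposition. The congruence by \<open>e^Y\<close> sends
  \<open>e^(-2Y)\<close> to the identity, so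
  \<open>|log x| = dist x 1 = dist (e^V) (e^(-2Y)) \<ge> |V + 2Y|\<close>, and \<open>V\<close> is
  orthogonal to \<open>Y\<close>.\<close>

lemma norm_decomposition_le:
  "norm V \<le> norm (mlog (mexp Y ** mexp V ** mexp Y))" "norm Y \<le> norm (mlog (mexp Y ** mexp V ** mexp Y))"
proof -
  define x where "x = mexp Y ** mexp V ** mexp Y"
  have x: "x \<in> SPD"
    unfolding x_def by (intro congruence_mexp_SPD mexp_SPD V lie_triple_Sym[OF E Y])
  have Y2: "(-2) *\<^sub>R Y \<in> E" by (rule subspace_scale[OF lie_triple_subspace[OF E] Y])
  have one: "mexp Y ** mexp ((-2) *\<^sub>R Y) ** mexp Y = mat 1"
    using mexp_add_scaleR[of 1 Y "-2"] by simp
  have "norm (V - (-2) *\<^sub>R Y) \<le> spd_dist (mexp V) (mexp ((-2) *\<^sub>R Y))"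
    by (rule spd_dist_mexp_ge[OF V lie_triple_Sym[OF E Y2]])
  also have "\<dots> = spd_dist x (mat 1)"
    using spd_dist_congruence[OF lie_triple_Sym[OF E Y], of "mexp V" "mexp ((-2) *\<^sub>R Y)"]
    by (simp only: one x_def)
  also have "\<dots> = norm (mlog x)"
    using spd_dist_mexp_one[OF mexp_mlog(2)[OF x]] by (simp add: mexp_mlog(1)[OF x])
  finally have "(norm (V - (-2) *\<^sub>R Y))\<^sup>2 \<le> (norm (mlog x))\<^sup>2"
    by (intro power_mono) auto
  then have sq: "(norm V)\<^sup>2 + (norm ((-2) *\<^sub>R Y))\<^sup>2 \<le> (norm (mlog x))\<^sup>2"
    by (simp only: norm_diff_orthogonal[OF orth Y2])
  show "norm V \<le> norm (mlog (mexp Y ** mexp V ** mexp Y))"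
    unfolding x_def[symmetric]
    by (rule power2_le_imp_le[OF _ norm_ge_zero])
      (use sq zero_le_power2[of "norm ((-2) *\<^sub>R Y)"] in linarith)
  have "norm ((-2) *\<^sub>R Y) \<le> norm (mlog x)"
    by (rule power2_le_imp_le[OF _ norm_ge_zero]) (use sq zero_le_power2[of "norm V"] in linarith)
  moreover have "norm Y \<le> norm ((-2) *\<^sub>R Y)" by (simp only: norm_scaleR) simp
  ultimately show "norm Y \<le> norm (mlog (mexp Y ** mexp V ** mexp Y))"
    unfolding x_def[symmetric] by linarith
qed

end

text \<open>Each foot minimizes the distance from the common point to \<open>exp E\<close>, so both
  distances agree and the surplus \<open>|W|^2\<close> of the second foot relative to the first is
  zero. Hence \<open>e^(2Y) = e^(2Y')\<close>, and injectivity of the exponential on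
  \<open>Sym\<close> gives \<open>Y\<close> and then \<open>V\<close>.\<close>

lemma decomposition_unique:
  assumes 1: "Y \<in> E" "V \<in> Sym" "\<forall>X\<in>E. V \<bullet> X = 0"
    and 2: "Y' \<in> E" "V' \<in> Sym" "\<forall>X\<in>E. V' \<bullet> X = 0"
    and eq: "mexp Y ** mexp V ** mexp Y = mexp Y' ** mexp V' ** mexp Y'"
  shows "Y = Y'" "V = V'"
proof -
  have foot: "mexp X ** mexp X \<in> mexp ` E" "mexp X ** mexp X = mexp (2 *\<^sub>R X)" if "X \<in> E" for X
  proof -
    show "mexp X ** mexp X = mexp (2 *\<^sub>R X)" using mexp_add_scaleR[of 1 X 1] by simp
    then show "mexp X ** mexp X \<in> mexp ` E"
      using subspace_scale[OF lie_triple_subspace[OF E] that, of 2] by simp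
  qed
  obtain W where W: "W \<in> E" "mexp Y' ** mexp Y' = mexp Y ** mexp W ** mexp Y"
    "(norm V)\<^sup>2 + (norm W)\<^sup>2 \<le> (spd_dist (mexp Y ** mexp V ** mexp Y) (mexp Y' ** mexp Y'))\<^sup>2"
    by (rule spd_dist_ge_foot[OF 1 foot(1)[OF 2(1)]])
  have "norm V' \<le> norm V"
    using spd_dist_foot_le[OF 2 foot(1)[OF 1(1)]]
    unfolding spd_dist_foot[OF 2] unfolding eq[symmetric] spd_dist_foot[OF 1] .
  then have "(norm V')\<^sup>2 \<le> (norm V)\<^sup>2" by (rule power_mono) simp
  moreover have "(norm V)\<^sup>2 + (norm W)\<^sup>2 \<le> (norm V')\<^sup>2"
    using W(3) unfolding eq spd_dist_foot[OF 2] .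
  ultimately have "(norm W)\<^sup>2 \<le> 0" by linarith
  then have "W = 0" by simp
  then have "mexp Y' ** mexp Y' = mexp Y ** mexp Y" using W(2) by simp
  then have "mexp (2 *\<^sub>R Y') = mexp (2 *\<^sub>R Y)"
    by (simp only: foot(2)[OF 1(1)] foot(2)[OF 2(1)])
  moreover have "2 *\<^sub>R Y' \<in> Sym" "2 *\<^sub>R Y \<in> Sym"
    by (intro subspace_scale[OF subspace_Sym] lie_triple_Sym[OF E] 1(1) 2(1))+
  ultimately have "2 *\<^sub>R Y' = 2 *\<^sub>R Y"
    by (rule inj_onD[OF inj_on_mexp_Sym])
  then show Y: "Y = Y'" by (simp only: scaleR_cancel_left) simp
  have "mexp (- Y) ** (mexp Y ** mexp V ** mexp Y) ** mexp (- Y) =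
      mexp (- Y) ** (mexp Y ** mexp V' ** mexp Y) ** mexp (- Y)"
    using eq by (simp only: Y)
  then have "mexp V = mexp V'" by (simp add: matrix_mul_assoc)
  then show "V = V'" by (rule inj_onD[OF inj_on_mexp_Sym _ 1(2) 2(2)])
qed

text \<open>As for \<open>symexp\<close>, the decomposition \<open>x = e\<^bsup>Y\<^esup> e\<^bsup>V\<^esup> e\<^bsup>Y\<^esup>\<close> with \<open>Y \<in> E\<close> and \<open>V \<bottom> E\<close> is extended to all
  matrices by the identity on the antisymmetric part.\<close>

definition mostow :: "real^'n^'n \<Rightarrow> real^'n^'n" where
  "mostow A = mexp (oproj E A) ** mexp (sympart A - oproj E A) ** mexp (oproj E A) + (A - sympart A)"

lemma orthogonal_part:
  "oproj E A \<in> E" "sympart A - oproj E A \<in> Sym" "\<forall>X\<in>E. (sympart A - oproj E A) \<bullet> X = 0"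
proof -
  note sub = lie_triple_subspace[OF E]
  show 1: "oproj E A \<in> E" by (rule oproj_in[OF sub])
  show "sympart A - oproj E A \<in> Sym"
    by (intro subspace_diff[OF subspace_Sym] sympart_in_Sym lie_triple_Sym[OF E 1])
  show "\<forall>X\<in>E. (sympart A - oproj E A) \<bullet> X = 0"
  proof
    fix X assume X: "X \<in> E"
    have "transpose A \<bullet> X = A \<bullet> X"
      using lie_triple_Sym[OF E X] inner_transpose[of A X] by (simp add: Sym_iff)
    then have "sympart A \<bullet> X = A \<bullet> X" by (simp add: sympart_def inner_add_left)
    then show "(sympart A - oproj E A) \<bullet> X = 0"
      using oproj_orth[OF sub X, of A] by (simp add: inner_diff_left)
  qed
qed

lemma mostow_symmetric_factor:
  "mexp (oproj E A) ** mexp (sympart A - oproj E A) ** mexp (oproj E A) \<in> SPD"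
  by (rule congruence_mexp_SPD[OF mexp_SPD[OF orthogonal_part(2)] lie_triple_Sym[OF E orthogonal_part(1)]])

lemma sympart_mostow:
  "sympart (mostow A) = mexp (oproj E A) ** mexp (sympart A - oproj E A) ** mexp (oproj E A)"
proof -
  have "mexp (oproj E A) ** mexp (sympart A - oproj E A) ** mexp (oproj E A) \<in> Sym"
    using mostow_symmetric_factor SPD_subset_Sym by (rule subsetD[rotated])
  then show ?thesis
    by (simp add: mostow_def sympart_add sympart_diff sympart_ident)
qed

lemma homeomorphism_mostow: "homeomorphism UNIV (sympart -` SPD) mostow (inv mostow)"
proof (rule proper_injective_homeomorphism)
  note lin = bounded_linear.continuous_on[OF bounded_linear_oproj]
  show "continuous_on UNIV mostow"
    unfolding mostow_def by (intro continuous_intros lin)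
  show "inj mostow"
  proof (rule injI)
    fix A B assume eq: "mostow A = mostow B"
    have "mexp (oproj E A) ** mexp (sympart A - oproj E A) ** mexp (oproj E A) =
        mexp (oproj E B) ** mexp (sympart B - oproj E B) ** mexp (oproj E B)"
      using arg_cong[OF eq, of sympart] by (simp only: sympart_mostow)
    note D = decomposition_unique[OF orthogonal_part orthogonal_part this]
    have "sympart A = sympart B" using D by simp
    with D eq show "A = B" by (simp add: mostow_def)
  qed
  show "connected (sympart -` SPD :: (real^'n^'n) set)" by (rule connected_sympart_SPD)
  show "range mostow \<subseteq> sympart -` SPD"
    using mostow_symmetric_factor by (auto simp: sympart_mostow)
  show "bounded (range X)" if y: "y \<in> sympart -` SPD" and lim: "(\<lambda>n. mostow (X n)) \<longlonglongrightarrow> y" for X y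
  proof -
    let ?x = "\<lambda>n. sympart (mostow (X n))"
    have 1: "?x \<longlonglongrightarrow> sympart y"
      by (rule bounded_linear.tendsto[OF bounded_linear_sympart lim])
    \<comment> \<open>Convergence of the logarithms bounds both \<open>Y\<close> and
      \<open>V\<close> by \<open>norm_decomposition_le\<close>; the antisymmetric part is bounded
      because it converges.\<close>
    have "(\<lambda>n. mlog (?x n)) \<longlonglongrightarrow> mlog (sympart y)"
      using continuous_on_tendsto_compose[OF continuous_on_mlog 1] y mostow_symmetric_factor
      by (simp add: sympart_mostow)
    then have "Bseq (\<lambda>n. mlog (?x n))" by (intro convergent_imp_Bseq) (auto simp: convergent_def)
    then obtain K where K: "\<And>n. norm (mlog (?x n)) \<le> K" by (auto simp: Bseq_def)
    have "convergent (\<lambda>n. mostow (X n) - ?x n)"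
      unfolding convergent_def using tendsto_diff[OF lim 1] by blast
    then have "Bseq (\<lambda>n. X n - sympart (X n))"
      unfolding sympart_mostow unfolding mostow_def by (intro convergent_imp_Bseq) simp
    then obtain L where L: "\<And>n. norm (X n - sympart (X n)) \<le> L" by (auto simp: Bseq_def)
    have "norm (X n) \<le> L + K + K" for n
    proof -
      let ?A = "X n"
      have "norm (sympart ?A - oproj E ?A) \<le> K" "norm (oproj E ?A) \<le> K"
        using norm_decomposition_le[OF orthogonal_part, of ?A] K[of n]
        unfolding sympart_mostow by (auto intro: order_trans)
      moreover have "norm ((?A - sympart ?A) + (sympart ?A - oproj E ?A) + oproj E ?A) \<le>
          norm (?A - sympart ?A) + norm (sympart ?A - oproj E ?A) + norm (oproj E ?A)"
        by (intro norm_triangle_le add_mono norm_triangle_ineq order_refl)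
      ultimately show ?thesis using L[of n] by simp
    qed
    then show ?thesis by (auto simp: bounded_iff)
  qed
qed

section \<open>The projection: continuity, image, minimality and orthogonality\<close>

definition spd_proj :: "real^'n^'n \<Rightarrow> real^'n^'n" where
  "spd_proj x = mexp (oproj E (inv mostow x)) ** mexp (oproj E (inv mostow x))"

lemma SPD_subset_vimage: "SPD \<subseteq> sympart -` SPD"
  using SPD_subset_Sym by (auto simp: sympart_ident)

lemma continuous_on_spd_proj: "continuous_on SPD spd_proj"
proof -
  have "continuous_on SPD (inv mostow)"
    using homeomorphism_mostow continuous_on_subset[OF _ SPD_subset_vimage]
    by (auto simp: homeomorphism_def)
  then show ?thesis
    unfolding spd_proj_def
    by (intro continuous_intros bounded_linear.continuous_on[OF bounded_linear_oproj])
qed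

lemma spd_proj_decomposition:
  assumes x: "x \<in> SPD"
  obtains Y V where "Y \<in> E" "V \<in> Sym" "\<forall>X\<in>E. V \<bullet> X = 0"
    "x = mexp Y ** mexp V ** mexp Y" "spd_proj x = mexp Y ** mexp Y"
proof -
  let ?A = "inv mostow x"
  have "mostow ?A = x"
    using homeomorphism_mostow x SPD_subset_vimage by (auto simp: homeomorphism_def)
  then have "sympart x = mexp (oproj E ?A) ** mexp (sympart ?A - oproj E ?A) ** mexp (oproj E ?A)"
    using sympart_mostow[of ?A] by simp
  then have "x = mexp (oproj E ?A) ** mexp (sympart ?A - oproj E ?A) ** mexp (oproj E ?A)"
    using x SPD_subset_Sym by (auto simp: sympart_ident)
  then show ?thesis
    by (rule that[OF orthogonal_part]) (simp_all add: spd_proj_def)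
qed

lemma spd_proj_image: "spd_proj ` SPD = mexp ` E"
proof
  note sub = lie_triple_subspace[OF E]
  have "mexp Y ** mexp Y \<in> mexp ` E" if "Y \<in> E" for Y
    using mexp_lie_triple_congruence[OF E that subspace_0[OF sub]] by simp
  then show "spd_proj ` SPD \<subseteq> mexp ` E"
    unfolding spd_proj_def using oproj_in[OF sub] by blast
  show "mexp ` E \<subseteq> spd_proj ` SPD"
  proof
    fix y assume "y \<in> mexp ` E"
    then obtain Z where Z: "Z \<in> E" "y = mexp Z" by blast
    have Zh: "(1/2) *\<^sub>R Z \<in> E" by (rule subspace_scale[OF sub Z(1)])
    \<comment> \<open>For an argument in \<open>E\<close> the component \<open>V\<close> is 0, so a
      point \<open>e^Z\<close> of \<open>exp E\<close> has \<open>Y = Z/2\<close> and is its own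
      foot.\<close>
    have "mostow ((1/2) *\<^sub>R Z) = y"
      using oproj_ident[OF sub Zh] sympart_ident[OF lie_triple_Sym[OF E Zh]]
      by (simp add: mostow_def mexp_half Z(2))
    moreover have "inv mostow (mostow ((1/2) *\<^sub>R Z)) = (1/2) *\<^sub>R Z"
      using homeomorphism_mostow by (simp add: homeomorphism_def)
    ultimately have "inv mostow y = (1/2) *\<^sub>R Z" by simp
    then have "spd_proj y = y"
      by (simp add: spd_proj_def oproj_ident[OF sub Zh] mexp_half Z(2))
    moreover have "y \<in> SPD" using Z mexp_image_SPD[OF E] by blast
    ultimately show "y \<in> spd_proj ` SPD" by (rule image_eqI[OF sym])
  qed
qed

lemma spd_setdist_spd_proj:
  assumes x: "x \<in> SPD"
  shows "spd_setdist x (mexp ` E) = spd_dist x (spd_proj x)"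
proof -
  have mem: "spd_proj x \<in> mexp ` E" using x spd_proj_image by blast
  obtain Y V where D: "Y \<in> E" "V \<in> Sym" "\<forall>X\<in>E. V \<bullet> X = 0"
    "x = mexp Y ** mexp V ** mexp Y" "spd_proj x = mexp Y ** mexp Y"
    by (rule spd_proj_decomposition[OF x])
  have "spd_dist x (spd_proj x) \<le> spd_dist x q" if "q \<in> mexp ` E" for q
    unfolding D(5) unfolding D(4) by (rule spd_dist_foot_le[OF D(1-3) that])
  then show ?thesis
    unfolding spd_setdist_def using mem by (intro cInf_eq_minimum) auto
qed

text \<open>Both velocities are moved to the identity by \<open>e^(-Y)\<close>. The one of
  \<open>c\<close> becomes some \<open>U\<close> with \<open>e^(-U) = e^V\<close>, hence
  \<open>U = -V\<close>; this uses only that \<open>c\<close> joins \<open>x\<close> to its foot.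
  The one of \<open>d\<close> lies in \<open>E\<close>, to which \<open>V\<close> is
  orthogonal.\<close>

lemma spd_proj_orthogonal:
  assumes x: "x \<in> SPD"
    and c: "spd_geodesic_in SPD 0 1 c" "c 0 = x" "c 1 = spd_proj x"
    and d: "spd_geodesic_in SPD 0 b d" "d 0 = spd_proj x" "d ` {0..b} \<subseteq> mexp ` E"
  shows "spd_metric (spd_proj x) (velocity {0..1} c 1) (velocity {0..b} d 0) = 0"
proof -
  obtain Y V where D: "Y \<in> E" "V \<in> Sym" "\<forall>X\<in>E. V \<bullet> X = 0"
    "x = mexp Y ** mexp V ** mexp Y" "spd_proj x = mexp Y ** mexp Y"
    by (rule spd_proj_decomposition[OF x])
  define U where "U = mexp (- Y) ** velocity {0..1} c 1 ** mexp (- Y)"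
  define T where "T = mexp (- Y) ** velocity {0..b} d 0 ** mexp (- Y)"
  have U: "mexp (- Y) ** c 0 ** mexp (- Y) = mexp (- U)" "U \<in> Sym"
    unfolding U_def
    by (rule spd_geodesic_transported_start[OF c(1) lie_triple_Sym[OF E D(1)]], simp add: c(3) D(5))+
  have "mexp (- U) = mexp V"
    unfolding U(1)[symmetric] by (simp add: c(2) D(4) matrix_mul_assoc)
  then have UV: "- U = V"
    by (rule inj_onD[OF inj_on_mexp_Sym _ subspace_neg[OF subspace_Sym U(2)] D(2)])
  have b: "0 < b" and diff: "d differentiable_on {0..b}"
    using d(1) by (auto simp: spd_geodesic_in_def)
  have "2 *\<^sub>R Y \<in> Sym" by (rule subspace_scale[OF subspace_Sym lie_triple_Sym[OF E D(1)]])
  moreover have "d 0 = mexp (2 *\<^sub>R Y)" using mexp_add_scaleR[of 1 Y 1] by (simp add: d(2) D(5))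
  ultimately have "(1/2) *\<^sub>R mlog (d 0) = (1/2) *\<^sub>R (2 *\<^sub>R Y)" by (simp only: mlog_mexp)
  then have log: "(1/2) *\<^sub>R mlog (d 0) = Y" by (simp only: scaleR_scaleR) simp
  have "mexp (- ((1/2) *\<^sub>R mlog (d 0))) ** velocity {0..b} d 0 ** mexp (- ((1/2) *\<^sub>R mlog (d 0))) \<in> E"
    using b by (intro gexp_transport_in_lie_triple[OF E
        differentiable_on_imp_velocity[OF diff] at_within_Icc_nontrivial d(3)]) auto
  then have T: "T \<in> E" unfolding log T_def .
  have "spd_metric (mexp Y ** mat 1 ** mexp Y) (mexp Y ** U ** mexp Y) (mexp Y ** T ** mexp Y) =
      spd_metric (mat 1) U T"
    by (rule spd_metric_congruence[OF invertible_SPD[OF mat_1_SPD]])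
  then have "spd_metric (spd_proj x) (velocity {0..1} c 1) (velocity {0..b} d 0) = spd_metric (mat 1) U T"
    by (simp add: U_def T_def D(5) matrix_mul_assoc)
  also have "\<dots> = U \<bullet> T"
    using spd_metric_mexp[OF subspace_0[OF subspace_Sym] U(2), of T] by simp
  also have "\<dots> = - (V \<bullet> T)" by (simp flip: UV)
  also have "\<dots> = 0" using D(3) T by simp
  finally show ?thesis .
qed

end

theorem theorem4p2:
  fixes E :: "(real^'n^'n) set"
  assumes "subspace E" and "E \<subseteq> Sym"
    and "\<And>X Y. X \<in> E \<Longrightarrow> Y \<in> E \<Longrightarrow> mbracket X (mbracket X Y) \<in> E"
  shows "totally_geodesic_submanifold (mexp ` E) \<and>
    (\<exists>\<pi> :: real^'n^'n \<Rightarrow> real^'n^'n.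
       continuous_on SPD \<pi> \<and> \<pi> ` SPD = mexp ` E \<and>
       (\<forall>x\<in>SPD.
          spd_setdist x (mexp ` E) = spd_dist x (\<pi> x) \<and>
          (\<forall>c. spd_geodesic_in SPD 0 1 c \<and> c 0 = x \<and> c 1 = \<pi> x \<longrightarrow>
             (\<forall>d b. spd_geodesic_in SPD 0 b d \<and> d 0 = \<pi> x \<and> d ` {0..b} \<subseteq> mexp ` E \<longrightarrow>
                spd_metric (\<pi> x) (velocity {0..1} c 1) (velocity {0..b} d 0) = 0))))"
proof -
  have "mbracket X (mbracket X Y) \<in> E" if "X \<in> E" "Y \<in> E" for X Y
    by (rule assms(3)[OF that])
  with assms(1,2) have E: "lie_triple E" unfolding lie_triple_def by blast
  show ?thesis
  proof (intro conjI exI[of _ "spd_proj E"] ballI allI impI)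
    show "totally_geodesic_submanifold (mexp ` E)" by (rule totally_geodesic_mexp_image[OF E])
    show "continuous_on SPD (spd_proj E)" by (rule continuous_on_spd_proj[OF E])
    show "spd_proj E ` SPD = mexp ` E" by (rule spd_proj_image[OF E])
    fix x :: "real^'n^'n" assume x: "x \<in> SPD"
    show "spd_setdist x (mexp ` E) = spd_dist x (spd_proj E x)" by (rule spd_setdist_spd_proj[OF E x])
    fix c d b
    assume "spd_geodesic_in SPD 0 1 c \<and> c 0 = x \<and> c 1 = spd_proj E x"
      and "spd_geodesic_in SPD 0 b d \<and> d 0 = spd_proj E x \<and> d ` {0..b} \<subseteq> mexp ` E"
    then show "spd_metric (spd_proj E x) (velocity {0..1} c 1) (velocity {0..b} d 0) = 0"
      by (elim conjE) (rule spd_proj_orthogonal[OF E x])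
  qed
qed

end
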